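(* Let $M=(M,Y_M)$ be a $V$-module. Then: (1) $\bar M=M(1)\otimes\Omega_M$ is a $V$-submodule of $M$. (2) $\Omega_M'$ is an $A$-module by sending $d$ to $d(0)$ and $e_\alpha$ to $T_\alpha$, for $d\in\mathfrak{h}_D$ and $\alpha\in L_C$. (3) If $M$ is irreducible and $\Omega_M\neq0$, then $\Omega_M'=\Omega_M$ and $M$ is isomorphic to $V_{\lambda,\Omega_M}$ for some $\lambda\in\frac1kL_D$.
   Context: Fix an integer $\nu\ge1$ and a nonzero integer $k$. Let $L_C=\bigoplus_{i=1}^{\nu}\mathbb{Z}c_i$, $L_D=\bigoplus_{i=1}^{\nu}\mathbb{Z}d_i$, $L=L_C\oplus L_D$, with symmetric bilinear form $(c_i,d_j)=k\delta_{ij}$, $(c_i,c_j)=(d_i,d_j)=0$. Put $\mathfrak{h}=\mathbb{C}\otimes L$, $\mathfrak{h}_C=\mathbb{C}\otimes L_C$, $\mathfrak{h}_D=\mathbb{C}\otimes L_D$. Let $\hat{\mathfrak{h}}=\mathfrak{h}\otimes\mathbb{C}[t,t^{-1}]\oplus\mathbb{C}c$, $\alpha(n)=\alpha\otimes t^n$, $[\alpha(m),\beta(n)]=m(\alpha,\beta)\delta_{m+n,0}c$, $c$ central. $M(1)=S(\mathfrak{h}\otimes t^{-1}\mathbb{C}[t^{-1}])$ is the Fock space with $c=1$. $A$ is the unital associative $\mathbb{C}$-algebra generated by $e_\alpha$ ($\alpha\in L_C$) and $d_i$ ($1\le i\le\nu$) with relations $e_0=1$, $e_{\alpha+\beta}=e_\alpha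 e_\beta$, $d_ie_\alpha-e_\alpha d_i=(d_i,\alpha)e_\alpha$, $d_id_j=d_jd_i$. $V_{\lambda,W}$: for an $A$-module $W$ and $\lambda\in\frac1kL_D$, $V_{\lambda,W}=M(1)\otimes W$ with: $c=1$; $\alpha(n)$ acts as $\alpha(n)\otimes1$ for $n\ne0$; $\beta(0)$ acts as the scalar $(\beta,\lambda)$ for $\beta\in\mathfrak{h}_C$; $\gamma(0)$ acts as $1\otimes\gamma$ for $\gamma\in\mathfrak{h}_D$; for $\alpha\in L_C$, $e^\alpha$ acts as $1\otimes e_\alpha$ and $z^\alpha$ as $z^{(\alpha,\lambda)}$. With $\alpha(z)=\sum_{n\in\mathbb{Z}}\alpha(n)z^{-n-1}$, $E^{\pm}(\beta,z)=\exp\big(\sum_{n\in\pm\mathbb{Z}_{>0}}\frac{\beta(n)}{n}z^{-n}\big)$, $\partial_n=\frac1{n!}(\frac{\partial}{\partial z})^n$, its vertex operators are $Y_{\lambda,W}(e^\beta,z)=E^-(-\beta,z)E^+(-\beta,z)e^\beta z^\beta$ and $Y_{\lambda,W}(\alpha_1(-n_1)\cdots\alpha_s(-n_s)e^\alpha,z)=\,:(\partial_{n_1-1}\alpha_1(z))\cdots(\partial_{n_s-1}\alpha_s(z))Y_{\lambda,W}(e^\alpha,z):$, where normal ordering places $\alpha(n)$, $n<0$, to the left and $\alpha(n)$, $n\ge0$, to the right. With these, $V_{\lambda,W}$ is a $V$-module. $V=M(1)\otimes\mathbb{C}[L_C]$ is the vertex subalgebra of the lattice vertex algebra $V_L$ (basis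 elements $e^\alpha$, $\alpha\in L_C$, of the group algebra), with vacuum $1\otimes e^0$; $\alpha(n)$, $n\neq0$, acts on $M(1)$, $\alpha(0)e^\beta=(\alpha,\beta)e^\beta$, $e^\alpha$ acts by multiplication, and its vertex operators $Y(v,z)$ are given by the same formulas as $Y_{\lambda,W}$ with $z^\beta$ ($\beta\in L_C$) acting as the identity. A $V$-module is a vector space $M$ with a linear map $Y_M:V\to(\mathrm{End}\,M)[[z,z^{-1}]]$, $Y_M(u,z)=\sum u_nz^{-n-1}$, satisfying $u_nw=0$ for $n$ large, $Y_M(\mathbf 1,z)=1$ and the Jacobi identity (no grading is assumed). For a $V$-module $M$ write $Y_M(\alpha(-1),z)=\sum_{n\in\mathbb{Z}}\alpha(n)z^{-n-1}$ for $\alpha\in\mathfrak{h}$; these operators make $M$ an $\hat{\mathfrak{h}}$-module with $c=1$. Let $\Omega_M=\{w\in M:\alpha(n)w=0\ \text{for all }\alpha\in\mathfrak{h},\,n>0\}$. The space $M(1)\otimes\Omega_M$ is identified with the $\hat{\mathfrak{h}}$-submodule of $M$ generated by $\Omega_M$. For $\alpha\in L_C$ put, on $\Omega_M$, $$Z(\alpha,z)=\exp\Big(\sum_{n<0}\tfrac{\alpha(n)}{n}z^{-n}\Big)Y_M(e^\alpha,z)\exp\Big(\sum_{n>0}\tfrac{\alpha(n)}{n}z^{-n}\Big)$$ (the last factor is the identity on $\Omega_M$); its coefficients map $\Omega_M$ into $\Omega_M$. For $\lambda\in\frac1kL_D$ let $\Omega_M(\lambda)=\{w\in\Omega_M:\alpha(0)w=(\alpha,\lambda)w\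 \text{for all }\alpha\in L_C\}$ and $\Omega_M'=\sum_{\lambda\in\frac1kL_D}\Omega_M(\lambda)$. Let $z^\alpha$ act on $\Omega_M(\lambda)$ as $z^{(\alpha,\lambda)}$, and set $T_\alpha=Z(\alpha,z)z^{-\alpha}$, an operator on $\Omega_M'$ which does not depend on $z$. In (3), $\Omega_M=\Omega_M'$ carries the $A$-module structure of (2). *)

theory Defs
  imports
    "HOL-Analysis.Finite_Cartesian_Product"
    "HOL-Library.Poly_Mapping"
    "HOL-Library.Multiset"
    "HOL-Algebra.QuotRing"
begin

section \<open>The lattice and its form\<close>

text \<open>
  The rank \<open>\<nu>\<close> is \<open>CARD('n)\<close>. A vector of \<open>\<hh> = \<complex> \<otimes> L\<close> is given by its coordinates in the basis
  \<open>c\<^sub>i\<close> (index \<open>Inl i\<close>), \<open>d\<^sub>i\<close> (index \<open>Inr i\<close>), and an element of \<open>L\<^sub>C\<close> by its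
  integer coordinates in the basis \<open>c\<^sub>i\<close>; \<open>lat\<close> is the inclusion of \<open>L\<^sub>C\<close> into \<open>\<hh>\<close>. A weight \<open>\<lambda>\<close> is
  called \<open>lam\<close> in formulas.
\<close>

type_synonym 'n hsp = "complex ^ ('n + 'n)"
type_synonym 'n latC = "int ^ 'n"

definition form :: "int \<Rightarrow> 'n::finite hsp \<Rightarrow> 'n hsp \<Rightarrow> complex" where
  "form k \<alpha> \<beta> = of_int k * (\<Sum>i\<in>UNIV. \<alpha> $ Inl i * \<beta> $ Inr i + \<alpha> $ Inr i * \<beta> $ Inl i)"

definition basis_vec :: "'n + 'n \<Rightarrow> 'n::finite hsp" where
  "basis_vec b = axis b 1"

definition lat :: "'n::finite latC \<Rightarrow> 'n hsp" where
  "lat \<alpha> = (\<Sum>i\<in>UNIV. of_int (\<alpha> $ i) *s basis_vec (Inl i))"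

definition h_D :: "'n::finite hsp set" where
  "h_D = {\<gamma>. \<forall>i. \<gamma> $ Inl i = 0}"

text \<open>The set \<open>(1/k) L\<^sub>D\<close>:\<close>

definition dual_D :: "int \<Rightarrow> 'n::finite hsp set" where
  "dual_D k = {(\<Sum>i\<in>UNIV. (of_int (m i) / of_int k) *s basis_vec (Inr i)) |m. True}"


section \<open>The associative algebra \<open>A\<close>\<close>

text \<open>
  The free algebra is the monoid algebra (with the convolution product of \<open>\<Rightarrow>\<^sub>0\<close>) of the free monoid
  on the generators, and \<open>A\<close> is its quotient by the two-sided ideal generated by the relations.
\<close>

datatype 'a word = Word (letters: "'a list")

instantiation word :: (type) monoid_add
begin
definition zero_word :: "'a word" where "0 = Word []"
definition plus_word :: "'a word \<Rightarrow> 'a word \<Rightarrow> 'a word"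
  where "u + v = Word (letters u @ letters v)"
instance by standard (simp_all add: zero_word_def plus_word_def)
end

datatype 'n gen = Gen_e "'n latC" | Gen_d 'n

type_synonym 'n free_alg = "'n gen word \<Rightarrow>\<^sub>0 complex"

definition free_ring :: "('n::finite free_alg) ring" where
  "free_ring = \<lparr>carrier = UNIV, monoid.mult = (*), one = 1, ring.zero = 0, add = (+)\<rparr>"

definition free_const :: "complex \<Rightarrow> 'n::finite free_alg" where
  "free_const a = Poly_Mapping.single 0 a"

definition free_e :: "'n::finite latC \<Rightarrow> 'n free_alg" where
  "free_e \<alpha> = Poly_Mapping.single (Word [Gen_e \<alpha>]) 1"

definition free_d :: "'n::finite \<Rightarrow> 'n free_alg" where
  "free_d i = Poly_Mapping.single (Word [Gen_d i]) 1"

definition A_relators :: "int \<Rightarrow> ('n::finite free_alg) set" where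
  "A_relators k =
     {free_e 0 - 1}
     \<union> {free_e (\<alpha> + \<beta>) - free_e \<alpha> * free_e \<beta> |\<alpha> \<beta>. True}
     \<union> {free_d i * free_e \<alpha> - free_e \<alpha> * free_d i
          - free_const (form k (basis_vec (Inr i)) (lat \<alpha>)) * free_e \<alpha> |i \<alpha>. True}
     \<union> {free_d i * free_d j - free_d j * free_d i |i j. True}"

definition A_ideal :: "int \<Rightarrow> ('n::finite free_alg) set" where
  "A_ideal k = Idl\<^bsub>free_ring\<^esub> (A_relators k)"

definition A_alg :: "int \<Rightarrow> ('n::finite free_alg set) ring" where
  "A_alg k = free_ring Quot (A_ideal k)"

definition A_class :: "int \<Rightarrow> 'n::finite free_alg \<Rightarrow> 'n free_alg set" where
  "A_class k x = A_ideal k +>\<^bsub>free_ring\<^esub> x"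

definition A_const :: "int \<Rightarrow> complex \<Rightarrow> 'n::finite free_alg set" where
  "A_const k a = A_class k (free_const a)"

definition A_e :: "int \<Rightarrow> 'n::finite latC \<Rightarrow> 'n free_alg set" where
  "A_e k \<alpha> = A_class k (free_e \<alpha>)"

text \<open>The element \<open>\<Sum>\<^sub>i \<gamma>\<^sub>i d\<^sub>i\<close> of \<open>A\<close> given by the \<open>\<hh>\<^sub>D\<close>-component of \<open>\<gamma>\<close>:\<close>

definition A_d :: "int \<Rightarrow> 'n::finite hsp \<Rightarrow> 'n free_alg set" where
  "A_d k \<gamma> = A_class k (\<Sum>i\<in>UNIV. free_const (\<gamma> $ Inr i) * free_d i)"

definition A_module ::
  "int \<Rightarrow> (complex \<Rightarrow> 'm \<Rightarrow> 'm) \<Rightarrow> 'm::ab_group_add set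
     \<Rightarrow> ('n::finite free_alg set \<Rightarrow> 'm \<Rightarrow> 'm) \<Rightarrow> bool" where
  "A_module k sc W \<rho> \<longleftrightarrow>
     module.subspace sc W \<and>
     (\<forall>x\<in>carrier (A_alg k). \<forall>w\<in>W. \<rho> x w \<in> W) \<and>
     (\<forall>x\<in>carrier (A_alg k). \<forall>v\<in>W. \<forall>w\<in>W. \<rho> x (v + w) = \<rho> x v + \<rho> x w) \<and>
     (\<forall>x\<in>carrier (A_alg k). \<forall>y\<in>carrier (A_alg k). \<forall>w\<in>W.
        \<rho> (x \<oplus>\<^bsub>A_alg k\<^esub> y) w = \<rho> x w + \<rho> y w) \<and>
     (\<forall>x\<in>carrier (A_alg k). \<forall>y\<in>carrier (A_alg k). \<forall>w\<in>W.
        \<rho> (x \<otimes>\<^bsub>A_alg k\<^esub> y) w = \<rho> x (\<rho> y w)) \<and>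
     (\<forall>w\<in>W. \<rho> \<one>\<^bsub>A_alg k\<^esub> w = w) \<and>
     (\<forall>a. \<forall>w\<in>W. \<rho> (A_const k a) w = sc a w)"


section \<open>Operator-valued formal series in \<open>z\<close>\<close>

text \<open>
  \<open>F p\<close> is the coefficient of \<open>z\<^sup>p\<close>. The sums in products and exponentials are taken pointwise,
  after application to a vector. \<open>Sum_any\<close> adds up the nonzero terms; in all the uses below
  there are only finitely many of them.
\<close>

type_synonym 'w series = "int \<Rightarrow> 'w \<Rightarrow> 'w"

definition sconst :: "('w \<Rightarrow> 'w) \<Rightarrow> 'w::ab_group_add series" where
  "sconst T p w = (if p = 0 then T w else 0)"

definition sprod :: "'w::ab_group_add series \<Rightarrow> 'w series \<Rightarrow> 'w series" (infixr \<open>\<star>\<close> 70) where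
  "(F \<star> G) p w = Sum_any (\<lambda>q. F q (G (p - q) w))"

primrec spower :: "'w::ab_group_add series \<Rightarrow> nat \<Rightarrow> 'w series" where
  "spower F 0 = sconst id"
| "spower F (Suc j) = F \<star> spower F j"

definition sexp :: "(complex \<Rightarrow> 'w \<Rightarrow> 'w) \<Rightarrow> 'w::ab_group_add series \<Rightarrow> 'w series" where
  "sexp sc F p w = Sum_any (\<lambda>j. sc (1 / fact j) (spower F j p w))"

definition sderiv :: "(complex \<Rightarrow> 'w \<Rightarrow> 'w) \<Rightarrow> 'w::ab_group_add series \<Rightarrow> 'w series" where
  "sderiv sc F p w = sc (of_int (p + 1)) (F (p + 1) w)"

text \<open>\<open>\<partial>\<^sub>n = (1/n!) (\<partial>/\<partial>z)\<^sup>n\<close>:\<close>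

definition divided_deriv ::
  "(complex \<Rightarrow> 'w \<Rightarrow> 'w) \<Rightarrow> nat \<Rightarrow> 'w::ab_group_add series \<Rightarrow> 'w series" where
  "divided_deriv sc n F p w = sc (1 / fact n) ((sderiv sc ^^ n) F p w)"

text \<open>
  In the following \<open>a \<alpha> n\<close> is the action of \<open>\<alpha>(n)\<close> on some representation. The part of
  \<open>\<alpha>(z) = \<Sum>\<^sub>n \<alpha>(n) z\<^sup>-\<^sup>n\<^sup>-\<^sup>1\<close> with \<open>n \<in> N\<close> is \<open>cur_part a N \<alpha>\<close>.
\<close>

definition cur_part ::
  "('n hsp \<Rightarrow> int \<Rightarrow> 'w \<Rightarrow> 'w) \<Rightarrow> int set \<Rightarrow> 'n::finite hsp \<Rightarrow> 'w::ab_group_add series" where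
  "cur_part a N \<alpha> p w = (if - p - 1 \<in> N then a \<alpha> (- p - 1) w else 0)"

definition half_exp ::
  "(complex \<Rightarrow> 'w \<Rightarrow> 'w) \<Rightarrow> ('n hsp \<Rightarrow> int \<Rightarrow> 'w \<Rightarrow> 'w) \<Rightarrow> int set \<Rightarrow> 'n::finite hsp
     \<Rightarrow> 'w::ab_group_add series" where
  "half_exp sc a N \<beta> =
     sexp sc (\<lambda>p w. if - p \<in> N then sc (1 / of_int (- p)) (a \<beta> (- p) w) else 0)"

definition E_minus ::
  "(complex \<Rightarrow> 'w \<Rightarrow> 'w) \<Rightarrow> ('n hsp \<Rightarrow> int \<Rightarrow> 'w \<Rightarrow> 'w) \<Rightarrow> 'n::finite hsp
     \<Rightarrow> 'w::ab_group_add series" where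
  "E_minus sc a \<beta> = half_exp sc a {..<0} \<beta>"

definition E_plus ::
  "(complex \<Rightarrow> 'w \<Rightarrow> 'w) \<Rightarrow> ('n hsp \<Rightarrow> int \<Rightarrow> 'w \<Rightarrow> 'w) \<Rightarrow> 'n::finite hsp
     \<Rightarrow> 'w::ab_group_add series" where
  "E_plus sc a \<beta> = half_exp sc a {0<..} \<beta>"

text \<open>The normally ordered product \<open>:(\<partial>\<^sub>n \<alpha>(z)) X(z):\<close> with a normally ordered \<open>X(z)\<close>:\<close>

definition normal_mult ::
  "(complex \<Rightarrow> 'w \<Rightarrow> 'w) \<Rightarrow> ('n hsp \<Rightarrow> int \<Rightarrow> 'w \<Rightarrow> 'w) \<Rightarrow> 'n::finite hsp \<Rightarrow> nat
     \<Rightarrow> 'w::ab_group_add series \<Rightarrow> 'w series" where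
  "normal_mult sc a \<alpha> n X p w =
     (divided_deriv sc n (cur_part a {..<0} \<alpha>) \<star> X) p w
     + (X \<star> divided_deriv sc n (cur_part a {0..} \<alpha>)) p w"


section \<open>The spaces \<open>M(1) \<otimes> W\<close> and their vertex operators\<close>

text \<open>
  \<open>M(1) = S(\<hh> \<otimes> t\<^sup>-\<^sup>1 \<complex>[t\<^sup>-\<^sup>1])\<close> has as basis the monomials in the variables \<open>b(-n-1)\<close>, where \<open>b\<close> is a
  basis vector of \<open>\<hh>\<close> and \<open>n \<ge> 0\<close>. Such a variable is encoded as the pair \<open>(b, n)\<close>, without
  the shift, and a monomial as the multiset of its factors. Hence \<open>M(1) \<otimes> W\<close> is the space of
  finitely supported functions from monomials to \<open>W\<close>.
\<close>

type_synonym 'n monom = "(('n + 'n) \<times> nat) multiset"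
type_synonym ('n, 'w) fock = "'n monom \<Rightarrow>\<^sub>0 'w"

definition pm_scale :: "(complex \<Rightarrow> 'w \<Rightarrow> 'w) \<Rightarrow> complex \<Rightarrow> ('x \<Rightarrow>\<^sub>0 'w::ab_group_add) \<Rightarrow> ('x \<Rightarrow>\<^sub>0 'w)"
  where "pm_scale sc a f = Poly_Mapping.map (sc a) f"

text \<open>
  The action of \<open>\<alpha>(n)\<close> on \<open>M(1) \<otimes> W\<close>, where \<open>\<alpha>(0)\<close> acts on \<open>W\<close> as \<open>z0 \<alpha>\<close>: multiplication for
  \<open>n < 0\<close>, and for \<open>n > 0\<close> the derivation \<open>n \<Sum>\<^sub>b (\<alpha>, b) \<partial>/\<partial>b(-n)\<close>.
\<close>

definition fock_mode ::
  "int \<Rightarrow> (complex \<Rightarrow> 'w \<Rightarrow> 'w) \<Rightarrow> ('n hsp \<Rightarrow> 'w \<Rightarrow> 'w) \<Rightarrow> 'n::finite hsp \<Rightarrow> int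
     \<Rightarrow> ('n, 'w::ab_group_add) fock \<Rightarrow> ('n, 'w) fock" where
  "fock_mode k sc z0 \<alpha> n f =
     (if n < 0 then
        \<Sum>M\<in>Poly_Mapping.keys f. \<Sum>b\<in>UNIV.
          Poly_Mapping.single (add_mset (b, nat (- n - 1)) M)
            (sc (\<alpha> $ b) (Poly_Mapping.lookup f M))
      else if n = 0 then Poly_Mapping.map (z0 \<alpha>) f
      else
        \<Sum>M\<in>Poly_Mapping.keys f. \<Sum>b\<in>UNIV.
          Poly_Mapping.single (M - {#(b, nat (n - 1))#})
            (sc (of_int n * form k \<alpha> (basis_vec b) * of_nat (count M (b, nat (n - 1))))
              (Poly_Mapping.lookup f M)))"

text \<open>
  \<open>z\<^sup>\<beta>\<close> acts as \<open>z\<^sup>(\<^sup>\<beta>\<^sup>,\<^sup>\<lambda>\<^sup>)\<close>, i.e. as the series whose only nonzero coefficient is the identity at the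
  power \<open>p\<close> with \<open>p = (\<beta>, \<lambda>)\<close>; this is an integer for \<open>\<lambda> \<in> (1/k) L\<^sub>D\<close>.
\<close>

definition z_pow :: "int \<Rightarrow> 'n::finite hsp \<Rightarrow> 'n latC \<Rightarrow> 'w::ab_group_add series" where
  "z_pow k lam \<beta> p w = (if of_int p = form k (lat \<beta>) lam then w else 0)"

text \<open>
  In the next three definitions the data on \<open>W\<close> are: the scalar multiplication \<open>sc\<close>, the action \<open>z0 \<alpha>\<close>
  of \<open>\<alpha>(0)\<close>, the action \<open>ea \<beta>\<close> of \<open>e\<^sup>\<beta>\<close>, and the weight \<open>lam\<close> by which \<open>z\<^sup>\<beta>\<close> acts.
\<close>

definition vop_exp ::
  "int \<Rightarrow> (complex \<Rightarrow> 'w \<Rightarrow> 'w) \<Rightarrow> ('n hsp \<Rightarrow> 'w \<Rightarrow> 'w) \<Rightarrow> ('n latC \<Rightarrow> 'w \<Rightarrow> 'w) \<Rightarrow> 'n hsp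
     \<Rightarrow> 'n::finite latC \<Rightarrow> ('n, 'w::ab_group_add) fock series" where
  "vop_exp k sc z0 ea lam \<beta> =
     (let a = fock_mode k sc z0; S = pm_scale sc
      in E_minus S a (- lat \<beta>) \<star> E_plus S a (- lat \<beta>)
           \<star> sconst (Poly_Mapping.map (ea \<beta>)) \<star> z_pow k lam \<beta>)"

text \<open>The list \<open>[(\<alpha>\<^sub>1, n\<^sub>1), \<dots>, (\<alpha>\<^sub>s, n\<^sub>s)]\<close> stands for \<open>\<alpha>\<^sub>1(-n\<^sub>1-1) \<cdots> \<alpha>\<^sub>s(-n\<^sub>s-1)\<close>.\<close>

definition vop_word ::
  "int \<Rightarrow> (complex \<Rightarrow> 'w \<Rightarrow> 'w) \<Rightarrow> ('n hsp \<Rightarrow> 'w \<Rightarrow> 'w) \<Rightarrow> ('n latC \<Rightarrow> 'w \<Rightarrow> 'w) \<Rightarrow> 'n hsp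
     \<Rightarrow> ('n hsp \<times> nat) list \<Rightarrow> 'n::finite latC \<Rightarrow> ('n, 'w::ab_group_add) fock series" where
  "vop_word k sc z0 ea lam xs \<beta> =
     foldr (\<lambda>(\<alpha>, n). normal_mult (pm_scale sc) (fock_mode k sc z0) \<alpha> n) xs
       (vop_exp k sc z0 ea lam \<beta>)"

text \<open>The underlying space of \<open>V = M(1) \<otimes> \<complex>[L\<^sub>C]\<close>:\<close>

type_synonym 'n VC = "('n, 'n latC \<Rightarrow>\<^sub>0 complex) fock"

text \<open>
  \<open>vop \<dots> v n\<close> is the mode \<open>v\<^sub>n\<close> of the vertex operator of \<open>v \<in> V\<close> on \<open>M(1) \<otimes> W\<close>: the formula for
  monomials, extended linearly. The factors of a monomial are listed in an arbitrary order,
  which is immaterial by normal ordering.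
\<close>

definition vop ::
  "int \<Rightarrow> (complex \<Rightarrow> 'w \<Rightarrow> 'w) \<Rightarrow> ('n hsp \<Rightarrow> 'w \<Rightarrow> 'w) \<Rightarrow> ('n latC \<Rightarrow> 'w \<Rightarrow> 'w) \<Rightarrow> 'n hsp
     \<Rightarrow> 'n::finite VC \<Rightarrow> int \<Rightarrow> ('n, 'w::ab_group_add) fock \<Rightarrow> ('n, 'w) fock" where
  "vop k sc z0 ea lam v n f =
     (\<Sum>M\<in>Poly_Mapping.keys v. \<Sum>\<beta>\<in>Poly_Mapping.keys (Poly_Mapping.lookup v M).
        pm_scale sc (Poly_Mapping.lookup (Poly_Mapping.lookup v M) \<beta>)
          (vop_word k sc z0 ea lam
             (map (\<lambda>(b, j). (basis_vec b, j)) (SOME xs. mset xs = M)) \<beta> (- n - 1) f))"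


section \<open>The vertex algebra \<open>V\<close>\<close>

definition V_scale :: "complex \<Rightarrow> 'n::finite VC \<Rightarrow> 'n VC" where
  "V_scale = pm_scale (pm_scale (*))"

definition V_exp :: "'n::finite latC \<Rightarrow> 'n VC" where
  "V_exp \<beta> = Poly_Mapping.single {#} (Poly_Mapping.single \<beta> 1)"

definition V_vac :: "'n::finite VC" where
  "V_vac = V_exp 0"

text \<open>\<open>\<alpha>(0) e\<^sup>\<beta> = (\<alpha>, \<beta>) e\<^sup>\<beta>\<close> on the group algebra \<open>\<complex>[L\<^sub>C]\<close>:\<close>

definition V_zero_mode ::
  "int \<Rightarrow> 'n::finite hsp \<Rightarrow> ('n latC \<Rightarrow>\<^sub>0 complex) \<Rightarrow> ('n latC \<Rightarrow>\<^sub>0 complex)" where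
  "V_zero_mode k \<alpha> w = Poly_Mapping.mapp (\<lambda>\<beta> x. form k \<alpha> (lat \<beta>) * x) w"

text \<open>\<open>\<alpha>(-1) = \<alpha>(-1)\<one>\<close>:\<close>

definition V_cur :: "int \<Rightarrow> 'n::finite hsp \<Rightarrow> 'n VC" where
  "V_cur k \<alpha> = fock_mode k (pm_scale (*)) (V_zero_mode k) \<alpha> (- 1) V_vac"

text \<open>\<open>z\<^sup>\<beta>\<close> acts as the identity on \<open>V\<close>, which is the weight \<open>\<lambda> = 0\<close>.\<close>

definition V_Y :: "int \<Rightarrow> 'n::finite VC \<Rightarrow> int \<Rightarrow> 'n VC \<Rightarrow> 'n VC" where
  "V_Y k = vop k (pm_scale (*)) (V_zero_mode k) (\<lambda>\<beta> w. Poly_Mapping.single \<beta> 1 * w) 0"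


section \<open>\<open>V\<close>-modules\<close>

text \<open>
  \<open>Y u n\<close> is the mode \<open>u\<^sub>n\<close>. The last condition is the Jacobi identity
  \<open>z\<^sub>0\<^sup>-\<^sup>1 \<delta>((z\<^sub>1-z\<^sub>2)/z\<^sub>0) Y(u,z\<^sub>1) Y(v,z\<^sub>2) - z\<^sub>0\<^sup>-\<^sup>1 \<delta>((z\<^sub>2-z\<^sub>1)/-z\<^sub>0) Y(v,z\<^sub>2) Y(u,z\<^sub>1)
    = z\<^sub>2\<^sup>-\<^sup>1 \<delta>((z\<^sub>1-z\<^sub>0)/z\<^sub>2) Y(Y(u,z\<^sub>0)v,z\<^sub>2)\<close>,
  namely the equality of the coefficients of \<open>z\<^sub>0\<^sup>-\<^sup>l\<^sup>-\<^sup>1 z\<^sub>1\<^sup>-\<^sup>m\<^sup>-\<^sup>1 z\<^sub>2\<^sup>-\<^sup>n\<^sup>-\<^sup>1\<close> on both sides.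
\<close>

definition V_module ::
  "int \<Rightarrow> (complex \<Rightarrow> 'm \<Rightarrow> 'm) \<Rightarrow> ('n::finite VC \<Rightarrow> int \<Rightarrow> 'm::ab_group_add \<Rightarrow> 'm) \<Rightarrow> bool" where
  "V_module k sc Y \<longleftrightarrow>
     vector_space sc \<and>
     (\<forall>u n. Vector_Spaces.linear sc sc (Y u n)) \<and>
     (\<forall>n w. Vector_Spaces.linear V_scale sc (\<lambda>u. Y u n w)) \<and>
     (\<forall>u w. \<exists>N. \<forall>n\<ge>N. Y u n w = 0) \<and>
     (\<forall>n w. Y V_vac n w = (if n = - 1 then w else 0)) \<and>
     (\<forall>u v w l m n.
        Sum_any (\<lambda>i::nat. sc ((- 1) ^ i * (of_int l gchoose i))
                            (Y u (m + l - int i) (Y v (n + int i) w)))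
        - Sum_any (\<lambda>i::nat. sc ((- 1) powi l * (- 1) ^ i * (of_int l gchoose i))
                            (Y v (n + l - int i) (Y u (m + int i) w)))
        = Sum_any (\<lambda>i::nat. sc (of_int m gchoose i)
                            (Y (V_Y k u (l + int i) v) (m + n - int i) w)))"

definition V_submodule ::
  "(complex \<Rightarrow> 'm \<Rightarrow> 'm) \<Rightarrow> ('n::finite VC \<Rightarrow> int \<Rightarrow> 'm::ab_group_add \<Rightarrow> 'm) \<Rightarrow> 'm set \<Rightarrow> bool" where
  "V_submodule sc Y U \<longleftrightarrow> module.subspace sc U \<and> (\<forall>v n. \<forall>w\<in>U. Y v n w \<in> U)"

definition V_irreducible ::
  "(complex \<Rightarrow> 'm \<Rightarrow> 'm) \<Rightarrow> ('n::finite VC \<Rightarrow> int \<Rightarrow> 'm::ab_group_add \<Rightarrow> 'm) \<Rightarrow> bool" where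
  "V_irreducible sc Y \<longleftrightarrow>
     (UNIV :: 'm set) \<noteq> {0} \<and> (\<forall>U. V_submodule sc Y U \<longrightarrow> U = {0} \<or> U = UNIV)"

text \<open>Isomorphism of modules with underlying spaces \<open>U1\<close> and \<open>U2\<close>:\<close>

definition V_isomorphic ::
  "(complex \<Rightarrow> 'a \<Rightarrow> 'a) \<Rightarrow> ('n::finite VC \<Rightarrow> int \<Rightarrow> 'a \<Rightarrow> 'a) \<Rightarrow> 'a::ab_group_add set
     \<Rightarrow> (complex \<Rightarrow> 'b \<Rightarrow> 'b) \<Rightarrow> ('n VC \<Rightarrow> int \<Rightarrow> 'b \<Rightarrow> 'b) \<Rightarrow> 'b::ab_group_add set \<Rightarrow> bool" where
  "V_isomorphic sc1 Y1 U1 sc2 Y2 U2 \<longleftrightarrow>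
     (\<exists>\<phi>. bij_betw \<phi> U1 U2 \<and>
        (\<forall>x\<in>U1. \<forall>y\<in>U1. \<phi> (x + y) = \<phi> x + \<phi> y) \<and>
        (\<forall>a. \<forall>x\<in>U1. \<phi> (sc1 a x) = sc2 a (\<phi> x)) \<and>
        (\<forall>v n. \<forall>x\<in>U1. \<phi> (Y1 v n x) = Y2 v n (\<phi> x)))"

text \<open>
  The module \<open>V\<^sub>\<lambda>\<^sub>,\<^sub>W\<close> for an \<open>A\<close>-module structure \<open>\<rho>\<close> on a subspace \<open>W\<close>. In the zero modes,
  \<open>form k \<alpha> lam\<close> depends only on the \<open>\<hh>\<^sub>C\<close>-component of \<open>\<alpha>\<close> (as \<open>lam \<in> \<hh>\<^sub>D\<close>) and \<open>A_d k \<alpha>\<close> only on its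
  \<open>\<hh>\<^sub>D\<close>-component.
\<close>

definition VlW_space :: "'w set \<Rightarrow> ('n::finite, 'w::ab_group_add) fock set" where
  "VlW_space W = {f. \<forall>M. Poly_Mapping.lookup f M \<in> W}"

definition VlW_Y ::
  "int \<Rightarrow> (complex \<Rightarrow> 'w \<Rightarrow> 'w) \<Rightarrow> ('n free_alg set \<Rightarrow> 'w \<Rightarrow> 'w) \<Rightarrow> 'n hsp
     \<Rightarrow> 'n::finite VC \<Rightarrow> int \<Rightarrow> ('n, 'w::ab_group_add) fock \<Rightarrow> ('n, 'w) fock" where
  "VlW_Y k sc \<rho> lam =
     vop k sc (\<lambda>\<alpha> w. sc (form k \<alpha> lam) w + \<rho> (A_d k \<alpha>) w) (\<lambda>\<beta>. \<rho> (A_e k \<beta>)) lam"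


section \<open>Vacuum spaces and the operators \<open>T\<^sub>\<alpha>\<close>\<close>

definition heis ::
  "int \<Rightarrow> ('n::finite VC \<Rightarrow> int \<Rightarrow> 'm \<Rightarrow> 'm) \<Rightarrow> 'n hsp \<Rightarrow> int \<Rightarrow> 'm \<Rightarrow> 'm" where
  "heis k Y \<alpha> n = Y (V_cur k \<alpha>) n"

definition Omega ::
  "int \<Rightarrow> ('n::finite VC \<Rightarrow> int \<Rightarrow> 'm::ab_group_add \<Rightarrow> 'm) \<Rightarrow> 'm set" where
  "Omega k Y = {w. \<forall>\<alpha> n. n > 0 \<longrightarrow> heis k Y \<alpha> n w = 0}"

text \<open>\<open>M(1) \<otimes> \<Omega>\<^sub>M\<close>, the submodule for the Heisenberg algebra generated by \<open>\<Omega>\<^sub>M\<close>:\<close>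

definition M_bar ::
  "int \<Rightarrow> (complex \<Rightarrow> 'm \<Rightarrow> 'm) \<Rightarrow> ('n::finite VC \<Rightarrow> int \<Rightarrow> 'm::ab_group_add \<Rightarrow> 'm) \<Rightarrow> 'm set" where
  "M_bar k sc Y = \<Inter>{U. module.subspace sc U \<and> Omega k Y \<subseteq> U \<and>
                        (\<forall>\<alpha> n. \<forall>w\<in>U. heis k Y \<alpha> n w \<in> U)}"

definition Omega_wt ::
  "int \<Rightarrow> (complex \<Rightarrow> 'm \<Rightarrow> 'm) \<Rightarrow> ('n::finite VC \<Rightarrow> int \<Rightarrow> 'm::ab_group_add \<Rightarrow> 'm)
     \<Rightarrow> 'n hsp \<Rightarrow> 'm set" where
  "Omega_wt k sc Y lam =
     {w \<in> Omega k Y. \<forall>\<alpha>. heis k Y (lat \<alpha>) 0 w = sc (form k (lat \<alpha>) lam) w}"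

definition Omega' ::
  "int \<Rightarrow> (complex \<Rightarrow> 'm \<Rightarrow> 'm) \<Rightarrow> ('n::finite VC \<Rightarrow> int \<Rightarrow> 'm::ab_group_add \<Rightarrow> 'm) \<Rightarrow> 'm set" where
  "Omega' k sc Y = module.span sc (\<Union>lam\<in>dual_D k. Omega_wt k sc Y lam)"

text \<open>The decomposition of \<open>w \<in> \<Omega>'\<^sub>M\<close> into its components in the spaces \<open>\<Omega>\<^sub>M(\<lambda>)\<close>, whose sum is direct:\<close>

definition wt_decomp ::
  "int \<Rightarrow> (complex \<Rightarrow> 'm \<Rightarrow> 'm) \<Rightarrow> ('n::finite VC \<Rightarrow> int \<Rightarrow> 'm::ab_group_add \<Rightarrow> 'm)
     \<Rightarrow> 'm \<Rightarrow> ('n hsp \<Rightarrow>\<^sub>0 'm)" where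
  "wt_decomp k sc Y w =
     (THE f. Poly_Mapping.keys f \<subseteq> dual_D k \<and>
             (\<forall>lam\<in>Poly_Mapping.keys f. Poly_Mapping.lookup f lam \<in> Omega_wt k sc Y lam) \<and>
             (\<Sum>lam\<in>Poly_Mapping.keys f. Poly_Mapping.lookup f lam) = w)"

text \<open>\<open>z\<^sup>\<alpha>\<close> as a series of operators on \<open>\<Omega>'\<^sub>M\<close>, acting as \<open>z\<^sup>(\<^sup>\<alpha>\<^sup>,\<^sup>\<lambda>\<^sup>)\<close> on \<open>\<Omega>\<^sub>M(\<lambda>)\<close>:\<close>

definition Omega_z_pow ::
  "int \<Rightarrow> (complex \<Rightarrow> 'm \<Rightarrow> 'm) \<Rightarrow> ('n::finite VC \<Rightarrow> int \<Rightarrow> 'm::ab_group_add \<Rightarrow> 'm)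
     \<Rightarrow> 'n latC \<Rightarrow> 'm series" where
  "Omega_z_pow k sc Y \<alpha> p w =
     (let f = wt_decomp k sc Y w
      in \<Sum>lam\<in>Poly_Mapping.keys f. z_pow k lam \<alpha> p (Poly_Mapping.lookup f lam))"

definition Z_op ::
  "int \<Rightarrow> (complex \<Rightarrow> 'm \<Rightarrow> 'm) \<Rightarrow> ('n::finite VC \<Rightarrow> int \<Rightarrow> 'm::ab_group_add \<Rightarrow> 'm)
     \<Rightarrow> 'n latC \<Rightarrow> 'm series" where
  "Z_op k sc Y \<alpha> =
     E_minus sc (heis k Y) (lat \<alpha>) \<star> (\<lambda>p. Y (V_exp \<alpha>) (- p - 1))
       \<star> E_plus sc (heis k Y) (lat \<alpha>)"

text \<open>\<open>Z(\<alpha>,z) z\<^sup>-\<^sup>\<alpha>\<close> as a series of operators on \<open>\<Omega>'\<^sub>M\<close>:\<close>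

definition T_series ::
  "int \<Rightarrow> (complex \<Rightarrow> 'm \<Rightarrow> 'm) \<Rightarrow> ('n::finite VC \<Rightarrow> int \<Rightarrow> 'm::ab_group_add \<Rightarrow> 'm)
     \<Rightarrow> 'n latC \<Rightarrow> 'm series" where
  "T_series k sc Y \<alpha> = Z_op k sc Y \<alpha> \<star> Omega_z_pow k sc Y (- \<alpha>)"

text \<open>
  \<open>\<rho>\<close> is an \<open>A\<close>-module structure on \<open>\<Omega>'\<^sub>M\<close> for which \<open>d \<in> \<hh>\<^sub>D\<close> acts as \<open>d(0)\<close> and \<open>e\<^sub>\<alpha>\<close> as \<open>T\<^sub>\<alpha>\<close>. The last
  condition says that \<open>Z(\<alpha>,z) z\<^sup>-\<^sup>\<alpha>\<close> is, as a formal series, the operator \<open>\<rho>(e\<^sub>\<alpha>)\<close>, so it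
  includes that \<open>T\<^sub>\<alpha> = Z(\<alpha>,z) z\<^sup>-\<^sup>\<alpha>\<close> does not depend on \<open>z\<close>.
\<close>

definition Omega_A_structure ::
  "int \<Rightarrow> (complex \<Rightarrow> 'm \<Rightarrow> 'm) \<Rightarrow> ('n::finite VC \<Rightarrow> int \<Rightarrow> 'm::ab_group_add \<Rightarrow> 'm)
     \<Rightarrow> ('n free_alg set \<Rightarrow> 'm \<Rightarrow> 'm) \<Rightarrow> bool" where
  "Omega_A_structure k sc Y \<rho> \<longleftrightarrow>
     A_module k sc (Omega' k sc Y) \<rho> \<and>
     (\<forall>\<gamma>\<in>h_D. \<forall>w\<in>Omega' k sc Y. \<rho> (A_d k \<gamma>) w = heis k Y \<gamma> 0 w) \<and>
     (\<forall>\<alpha>. \<forall>w\<in>Omega' k sc Y. \<forall>p. T_series k sc Y \<alpha> p w = sconst (\<rho> (A_e k \<alpha>)) p w)"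

end

theory Submission
  imports Defs
begin

text \<open>
  The commutators of \<open>\<alpha>(m)\<close> with the \<open>\<beta>(n)\<close> and with \<open>Y(e\<^sup>\<beta>, z)\<close>, the product formula
  \<open>Y(e\<^sup>\<alpha>, z) Y(e\<^sup>\<beta>, z) = Y(e\<^sup>\<alpha>\<^sup>+\<^sup>\<beta>, z)\<close> and the differential equation
  \<open>d/dz Y(e\<^sup>\<beta>, z) = :\<beta>(z) Y(e\<^sup>\<beta>, z):\<close> are instances of the Jacobi identity. The commutators show
  that the coefficients of \<open>Z(\<beta>, z)\<close> preserve \<open>\<Omega>\<^sub>M\<close>, so that \<open>Y(e\<^sup>\<beta>, z)\<close> preserves
  \<open>M(1) \<otimes> \<Omega>\<^sub>M\<close>. On a vector \<open>w\<close> of weight \<open>\<lambda>\<close> the differential equation is a recursion for the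
  coefficients of \<open>Y(e\<^sup>\<beta>, z)w\<close>: the lowest one is that of \<open>z\<^sup>(\<^sup>\<beta>\<^sup>,\<^sup>\<lambda>\<^sup>)\<close>, it equals \<open>T\<^sub>\<beta> w\<close>, and
  \<open>Y(e\<^sup>\<beta>, z)w = E\<^sup>-(-\<beta>, z) T\<^sub>\<beta> w z\<^sup>(\<^sup>\<beta>\<^sup>,\<^sup>\<lambda>\<^sup>)\<close>. The product formula then gives \<open>T\<^sub>\<alpha>\<^sub>+\<^sub>\<beta> = T\<^sub>\<alpha> T\<^sub>\<beta>\<close>.

  For \<open>\<alpha> \<in> L\<^sub>C\<close> the operator \<open>\<alpha>(0)\<close> commutes with all of \<open>V\<close>, and by the differential equation the
  lowest coefficient of \<open>Y(e\<^sup>\<alpha>, z)w\<close>, for \<open>w \<in> \<Omega>\<^sub>M\<close> nonzero, is an eigenvector of it with an integral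
  eigenvalue. Its eigenspaces are submodules, so it is a scalar on an irreducible \<open>M\<close>, and
  \<open>\<Omega>\<^sub>M = \<Omega>\<^sub>M(\<lambda>)\<close>. The canonical map from \<open>M(1) \<otimes> \<Omega>\<^sub>M\<close> to \<open>M\<close> is injective because its kernel is
  stable under partial derivatives; since \<open>Y(e\<^sup>\<beta>, z)\<close> is determined on \<open>M(1) \<otimes> \<Omega>\<^sub>M\<close> by its values on \<open>\<Omega>\<^sub>M\<close> and its
  commutators with the creation operators, the map intertwines the vertex operators.
\<close>


section \<open>Finite sums and finitely supported functions\<close>

lemma Sum_any_eq_sum:
  assumes "finite A" "\<And>x. x \<notin> A \<Longrightarrow> g x = 0"
  shows "Sum_any g = sum g A"
  using assms by (intro Sum_any.expand_superset) auto

lemma Sum_any_single: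
  assumes "\<And>x. x \<noteq> a \<Longrightarrow> g x = 0"
  shows "Sum_any g = g a"
  using assms by (subst Sum_any_eq_sum[of "{a}"]) auto

lemma sum_triangle_swap:
  fixes n :: nat
  shows "(\<Sum>q=1..n. \<Sum>r=1..n-q. g q r) = (\<Sum>r=1..n. \<Sum>q=1..n-r. g q r)"
proof -
  have "(\<Sum>q=1..n. \<Sum>r=1..n-q. g q r) = (\<Sum>q=1..n. \<Sum>r | r \<in> {1..n} \<and> q + r \<le> n. g q r)"
    by (intro sum.cong) auto
  also have "\<dots> = (\<Sum>r=1..n. \<Sum>q | q \<in> {1..n} \<and> q + r \<le> n. g q r)"
    by (rule sum.swap_restrict) auto
  also have "\<dots> = (\<Sum>r=1..n. \<Sum>q=1..n-r. g q r)"
    by (intro sum.cong) auto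
  finally show ?thesis .
qed

definition pm_sum :: "('x \<Rightarrow> 'c::zero \<Rightarrow> 'b::comm_monoid_add) \<Rightarrow> ('x \<Rightarrow>\<^sub>0 'c) \<Rightarrow> 'b" where
  "pm_sum h f = (\<Sum>x\<in>Poly_Mapping.keys f. h x (Poly_Mapping.lookup f x))"

lemma pm_sum_zero [simp]: "pm_sum h 0 = 0"
  by (simp add: pm_sum_def)

lemma pm_sum_single:
  assumes "h x 0 = 0"
  shows "pm_sum h (Poly_Mapping.single x c) = h x c"
  using assms by (auto simp: pm_sum_def)

lemma pm_sum_add:
  assumes "\<And>x. h x 0 = 0"
    and "\<And>x. h x (Poly_Mapping.lookup f x + Poly_Mapping.lookup g x)
              = h x (Poly_Mapping.lookup f x) + h x (Poly_Mapping.lookup g x)"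
  shows "pm_sum h (f + g) = pm_sum h f + pm_sum h g"
  unfolding pm_sum_def using assms by (intro setsum_keys_plus_distrib) auto

lemma pm_expand: "f = (\<Sum>x\<in>Poly_Mapping.keys f. Poly_Mapping.single x (Poly_Mapping.lookup f x))"
proof (rule poly_mapping_eqI)
  fix y
  show "Poly_Mapping.lookup f y = Poly_Mapping.lookup
          (\<Sum>x\<in>Poly_Mapping.keys f. Poly_Mapping.single x (Poly_Mapping.lookup f x)) y"
    by (cases "y \<in> Poly_Mapping.keys f")
      (auto simp: lookup_sum lookup_single when_def in_keys_iff sum.delta' intro: sum.neutral)
qed

text \<open>The values are confined to a set \<open>W\<close> closed under addition, because the
  operators of an \<open>A\<close>-module structure on a subspace are known to be additive on that
  subspace only.\<close>

lemma pm_values_induct [case_names lookup zero single add]: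
  fixes f :: "'x \<Rightarrow>\<^sub>0 'c::comm_monoid_add"
  assumes "\<And>x. Poly_Mapping.lookup f x \<in> W"
    and "P 0"
    and "\<And>x c. c \<in> W \<Longrightarrow> P (Poly_Mapping.single x c)"
    and "\<And>g h. (\<And>x. Poly_Mapping.lookup g x \<in> W) \<Longrightarrow> (\<And>x. Poly_Mapping.lookup h x \<in> W)
           \<Longrightarrow> (\<And>x. Poly_Mapping.lookup (g + h) x \<in> W) \<Longrightarrow> P g \<Longrightarrow> P h \<Longrightarrow> P (g + h)"
    and W: "0 \<in> W" "\<And>v w. v \<in> W \<Longrightarrow> w \<in> W \<Longrightarrow> v + w \<in> W"
  shows "P f"
proof -
  define s where "s x = Poly_Mapping.single x (Poly_Mapping.lookup f x)" for x
  have "P (sum s A) \<and> (\<forall>x. Poly_Mapping.lookup (sum s A) x \<in> W)" if "finite A" for A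
    using that
  proof (induction A)
    case empty
    then show ?case using assms by simp
  next
    case (insert a A)
    have s: "P (s a)" "Poly_Mapping.lookup (s a) x \<in> W" for x
      using assms by (auto simp: s_def lookup_single when_def)
    show ?case
      using insert s W(2) assms(4)[of "s a" "sum s A"] by (simp add: lookup_add)
  qed
  then show ?thesis
    using pm_expand[of f] by (metis (mono_tags, lifting) finite_keys s_def sum.cong)
qed

lemma pm_induct [case_names zero single add]:
  fixes f :: "'x \<Rightarrow>\<^sub>0 'c::ab_group_add"
  assumes "P 0" "\<And>x c. P (Poly_Mapping.single x c)" "\<And>g h. P g \<Longrightarrow> P h \<Longrightarrow> P (g + h)"
  shows "P f"
  by (rule pm_values_induct[where W = UNIV]) (use assms in auto)

lemma lookup_map_zero:
  assumes "f 0 = 0"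
  shows "Poly_Mapping.lookup (Poly_Mapping.map f p) x = f (Poly_Mapping.lookup p x)"
  using assms by (simp add: Poly_Mapping.map.rep_eq when_def)


section \<open>Exponentials of formal series\<close>

lemma lin_add: "Vector_Spaces.linear s1 s2 f \<Longrightarrow> f (x + y) = f x + f y"
  unfolding module_hom_iff_linear[symmetric] by (rule module_hom.add)

lemma lin_scale: "Vector_Spaces.linear s1 s2 f \<Longrightarrow> f (s1 c x) = s2 c (f x)"
  unfolding module_hom_iff_linear[symmetric] by (rule module_hom.scale)

lemma lin_zero: "Vector_Spaces.linear s1 s2 f \<Longrightarrow> f 0 = 0"
  unfolding module_hom_iff_linear[symmetric] by (rule module_hom.zero)

lemma lin_diff: "Vector_Spaces.linear s1 s2 f \<Longrightarrow> f (x - y) = f x - f y"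
  unfolding module_hom_iff_linear[symmetric] by (rule module_hom.diff)

lemma lin_neg: "Vector_Spaces.linear s1 s2 f \<Longrightarrow> f (- x) = - f x"
  unfolding module_hom_iff_linear[symmetric] by (rule module_hom.neg)

lemma lin_sum: "Vector_Spaces.linear s1 s2 f \<Longrightarrow> f (sum g S) = (\<Sum>a\<in>S. f (g a))"
  unfolding module_hom_iff_linear[symmetric] by (rule module_hom.sum)

lemmas lin_simps = lin_add lin_scale lin_zero lin_diff lin_neg lin_sum

text \<open>The coefficient of z^n in (X_1 z + X_2 z^2 + ...)^j.\<close>

primrec conv_pow :: "(nat \<Rightarrow> 'w \<Rightarrow> 'w) \<Rightarrow> nat \<Rightarrow> nat \<Rightarrow> 'w::ab_group_add \<Rightarrow> 'w" where
  "conv_pow X 0 n w = (if n = 0 then w else 0)"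
| "conv_pow X (Suc j) n w = (\<Sum>q=1..n. X q (conv_pow X j (n - q) w))"

text \<open>The coefficient of z^n in exp(X_1 z + X_2 z^2 + ...): if each X_q sends 0 to 0, the
  powers with j > n contribute nothing to it.\<close>

definition exp_coeff ::
  "(complex \<Rightarrow> 'w \<Rightarrow> 'w) \<Rightarrow> (nat \<Rightarrow> 'w \<Rightarrow> 'w) \<Rightarrow> nat \<Rightarrow> 'w::ab_group_add \<Rightarrow> 'w" where
  "exp_coeff sc X n w = (\<Sum>j\<le>n. sc (1 / fact j) (conv_pow X j n w))"

lemma conv_pow_eq_0:
  assumes "\<And>q. X q 0 = 0" "n < j"
  shows "conv_pow X j n w = 0"
  using assms(2)
proof (induction j arbitrary: n)
  case (Suc j)
  then show ?case by (auto intro!: sum.neutral simp: assms(1))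
qed simp

lemma conv_pow_killed:
  assumes "\<And>q. X q 0 = 0" "\<And>q. q > 0 \<Longrightarrow> X q w = 0" "j > 0 \<or> n > 0"
  shows "conv_pow X j n w = 0"
  using assms(3)
proof (induction j arbitrary: n)
  case (Suc j)
  have "X q (conv_pow X j (n - q) w) = 0" if "q > 0" for q
    using Suc.IH[of "n - q"] that assms(1,2) by (cases "j = 0") (auto split: if_splits)
  then show ?case by (simp add: sum.neutral)
qed simp

text \<open>A series in \<open>z\<close> or in \<open>1/z\<close>, according to the sign \<open>s\<close>.\<close>

locale half_series =
  fixes s :: int and F :: "'w::ab_group_add series"
  assumes sign: "s = 1 \<or> s = - 1"
    and supp: "\<And>p w. s * p \<le> 0 \<Longrightarrow> F p w = 0"
    and F0: "\<And>p. F p 0 = 0"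
begin

lemma s_sq: "s * (s * x) = x"
  using sign by auto

lemma spower_supp: "s * p < int j \<Longrightarrow> spower F j p w = 0"
proof (induction j arbitrary: p)
  case 0
  then show ?case using sign by (auto simp: sconst_def)
next
  case (Suc j)
  have "F q (spower F j (p - q) w) = 0" for q
  proof (cases "s * q \<le> 0")
    case False
    then have "s * (p - q) < int j" using Suc.prems by (simp add: right_diff_distrib)
    then show ?thesis using Suc.IH F0 by simp
  qed (simp add: supp)
  then show ?case by (simp add: sprod_def)
qed

lemma spower_conv_pow: "spower F j (s * int n) w = conv_pow (\<lambda>q. F (s * int q)) j n w"
proof (induction j arbitrary: n)
  case 0
  then show ?case using sign by (auto simp: sconst_def)
next
  case (Suc j)
  let ?g = "\<lambda>q. F q (spower F j (s * int n - q) w)"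
  have inj: "inj_on (\<lambda>q. s * int q) {1..n}"
    using sign by (auto intro!: inj_onI)
  have "?g q = 0" if "q \<notin> (\<lambda>q. s * int q) ` {1..n}" for q
  proof (cases "s * q \<le> 0")
    case False
    have "q = s * int (nat (s * q))" using False s_sq[of q] by auto
    then have "n < nat (s * q)" using that False by (metis atLeastAtMost_iff imageI
      linorder_not_less nat_0_iff less_one)
    then have "s * (s * int n - q) < 0" using s_sq[of "int n"] unfolding right_diff_distrib by linarith
    then have "spower F j (s * int n - q) w = 0"
      by (intro spower_supp) auto
    then show ?thesis by (simp add: F0)
  qed (simp add: supp)
  then have "spower F (Suc j) (s * int n) w = sum ?g ((\<lambda>q. s * int q) ` {1..n})"
    unfolding spower.simps sprod_def by (intro Sum_any_eq_sum) auto
  also have "\<dots> = (\<Sum>q=1..n. F (s * int q) (spower F j (s * int n - s * int q) w))"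
    unfolding sum.reindex[OF inj] comp_def ..
  also have "\<dots> = (\<Sum>q=1..n. F (s * int q) (spower F j (s * int (n - q)) w))"
    by (intro sum.cong refl) (simp add: of_nat_diff right_diff_distrib)
  finally show ?case by (simp only: Suc.IH conv_pow.simps)
qed

lemma sexp_neg:
  assumes "\<And>c. sc c 0 = 0" "s * p < 0"
  shows "sexp sc F p w = 0"
  using assms spower_supp[of p _ w] by (simp add: sexp_def)

lemma sexp_exp_coeff:
  assumes "\<And>c. sc c 0 = 0"
  shows "sexp sc F (s * int n) w = exp_coeff sc (\<lambda>q. F (s * int q)) n w"
proof -
  have "spower F j (s * int n) w = 0" if "j \<notin> {..n}" for j
    using that by (simp add: spower_conv_pow conv_pow_eq_0 F0)
  then have "sexp sc F (s * int n) w = (\<Sum>j\<le>n. sc (1 / fact j) (spower F j (s * int n) w))"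
    unfolding sexp_def by (intro Sum_any_eq_sum) (auto simp: assms)
  then show ?thesis by (simp add: exp_coeff_def spower_conv_pow)
qed

end

context vector_space
begin

text \<open>The Euler operator D = z d/dz satisfies D(X^(j+1)) = (j+1) (D X) X^j because the
  coefficients of X commute; this is the coefficient of z^n.\<close>

lemma conv_pow_derivation:
  assumes lin: "\<And>q. Vector_Spaces.linear scale scale (X q)"
    and comm: "\<And>q r w. X q (X r w) = X r (X q w)"
  shows "scale (of_nat n) (conv_pow X (Suc j) n w)
       = scale (of_nat (Suc j)) (\<Sum>q=1..n. scale (of_nat q) (X q (conv_pow X j (n - q) w)))"
proof (induction j arbitrary: n)
  case 0
  have "scale (of_nat n) (X q (conv_pow X 0 (n - q) w))
      = scale (of_nat q) (X q (conv_pow X 0 (n - q) w))" if "q \<in> {1..n}" for q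
    using that lin_zero[OF lin] by (cases "q = n") auto
  then have "(\<Sum>q=1..n. scale (of_nat n) (X q (conv_pow X 0 (n - q) w)))
      = (\<Sum>q=1..n. scale (of_nat q) (X q (conv_pow X 0 (n - q) w)))"
    by (rule sum.cong[OF refl])
  then show ?case by (simp add: scale_sum_right del: conv_pow.simps(1))
next
  case (Suc j)
  let ?P = "\<lambda>j n. conv_pow X j n w"
  \<comment> \<open>Leibniz rule: n = q + (n - q) distributes D over the first factor X and the
    remaining power. The induction hypothesis treats the latter, and X_q is moved past X_r.\<close>
  have step: "scale (of_nat n) (X q (?P (Suc j) (n - q)))
      = scale (of_nat q) (X q (?P (Suc j) (n - q)))
        + scale (of_nat (Suc j)) (\<Sum>r=1..n-q. scale (of_nat r) (X r (X q (?P j (n - r - q)))))"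
    if "q \<in> {1..n}" for q
  proof -
    have "(of_nat n :: 'a) = of_nat q + of_nat (n - q)"
      using that by (simp flip: of_nat_add)
    then have "scale (of_nat n) (X q (?P (Suc j) (n - q)))
      = scale (of_nat q) (X q (?P (Suc j) (n - q)))
        + X q (scale (of_nat (n - q)) (?P (Suc j) (n - q)))"
      by (simp add: scale_left_distrib lin_scale[OF lin] del: conv_pow.simps)
    also have "X q (scale (of_nat (n - q)) (?P (Suc j) (n - q)))
        = scale (of_nat (Suc j)) (\<Sum>r=1..n-q. scale (of_nat r) (X q (X r (?P j (n - q - r)))))"
      by (simp only: Suc.IH lin_scale[OF lin] lin_sum[OF lin])
    also have "\<dots> = scale (of_nat (Suc j)) (\<Sum>r=1..n-q. scale (of_nat r) (X r (X q (?P j (n - r - q)))))"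
      by (simp add: comm[of q] add.commute)
    finally show ?thesis .
  qed
  have "scale (of_nat n) (?P (Suc (Suc j)) n)
      = (\<Sum>q=1..n. scale (of_nat q) (X q (?P (Suc j) (n - q))))
        + scale (of_nat (Suc j)) (\<Sum>q=1..n. \<Sum>r=1..n-q. scale (of_nat r) (X r (X q (?P j (n - r - q)))))"
    unfolding conv_pow.simps(2)[of X "Suc j"] scale_sum_right
    by (simp only: step sum.distrib scale_sum_right cong: sum.cong)
  also have "(\<Sum>q=1..n. \<Sum>r=1..n-q. scale (of_nat r) (X r (X q (?P j (n - r - q)))))
      = (\<Sum>q=1..n. scale (of_nat q) (X q (?P (Suc j) (n - q))))"
    by (subst sum_triangle_swap) (simp add: lin_sum[OF lin] scale_sum_right)
  finally show ?case
    unfolding of_nat_Suc[of "Suc j"] scale_left_distrib scale_one by (simp only:)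
qed

end

locale complex_vector_space = vector_space scale
  for scale :: "complex \<Rightarrow> 'w::ab_group_add \<Rightarrow> 'w"
begin

lemma scale_left_cancel_nat: "n > 0 \<Longrightarrow> scale (of_nat n) v = scale (of_nat n) w \<Longrightarrow> v = w"
  by (simp add: scale_cancel_left)

text \<open>Summing \<open>conv_pow_derivation\<close> over j with (j+1)/(j+1)! = 1/j! gives D(exp
  X) = (D X) exp X.\<close>

lemma exp_coeff_recursion:
  assumes lin: "\<And>q. Vector_Spaces.linear scale scale (X q)"
    and comm: "\<And>q r w. X q (X r w) = X r (X q w)"
  shows "scale (of_nat n) (exp_coeff scale X n w)
       = (\<Sum>q=1..n. scale (of_nat q) (X q (exp_coeff scale X (n - q) w)))"
proof (cases n)
  case (Suc m)
  let ?P = "\<lambda>j n. conv_pow X j n w"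
  have X0: "X q 0 = 0" for q by (rule lin_zero[OF lin])
  have "scale (of_nat n) (exp_coeff scale X n w)
      = (\<Sum>j\<le>m. scale (1 / fact (Suc j)) (scale (of_nat n) (?P (Suc j) n)))"
    unfolding exp_coeff_def Suc sum.atMost_Suc_shift scale_sum_right scale_right_distrib
    by (simp add: scale_sum_right scale_left_commute del: conv_pow.simps(2) fact_Suc)
  also have "\<dots> = (\<Sum>j\<le>m. scale (1 / fact j) (\<Sum>q=1..n. scale (of_nat q) (X q (?P j (n - q)))))"
  proof (intro sum.cong refl)
    fix j
    have "1 / fact (Suc j) * of_nat (Suc j) = (1 / fact j :: complex)"
      by (simp add: field_simps del: of_nat_Suc)
    then show "scale (1 / fact (Suc j)) (scale (of_nat n) (?P (Suc j) n))
        = scale (1 / fact j) (\<Sum>q=1..n. scale (of_nat q) (X q (?P j (n - q))))"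
      by (simp only: conv_pow_derivation[OF lin comm] scale_scale)
  qed
  also have "\<dots> = (\<Sum>q=1..n. \<Sum>j\<le>m. scale (1 / fact j) (scale (of_nat q) (X q (?P j (n - q)))))"
    by (subst sum.swap) (simp add: scale_sum_right)
  also have "\<dots> = (\<Sum>q=1..n. scale (of_nat q) (X q (exp_coeff scale X (n - q) w)))"
  proof (intro sum.cong refl)
    fix q assume q: "q \<in> {1..n}"
    have "exp_coeff scale X (n - q) w = (\<Sum>j\<le>m. scale (1 / fact j) (?P j (n - q)))"
      unfolding exp_coeff_def using q Suc
      by (intro sum.mono_neutral_left) (auto simp: conv_pow_eq_0 X0)
    then show "(\<Sum>j\<le>m. scale (1 / fact j) (scale (of_nat q) (X q (?P j (n - q)))))
        = scale (of_nat q) (X q (exp_coeff scale X (n - q) w))"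
      by (simp only: lin_sum[OF lin] lin_scale[OF lin] scale_sum_right scale_left_commute)
  qed
  finally show ?thesis .
qed simp

end

text \<open>
  \<open>E(z) = \<Sum>\<^sub>n E\<^sub>n z\<^sup>n\<close> with \<open>z E'(z) = z X'(z) E(z)\<close> and \<open>E\<^sub>0 = 1\<close>, that is, \<open>E = exp X\<close>. All that is
  needed of the exponentials is derived from this differential equation.
\<close>

locale exp_rec = complex_vector_space scale
  for scale :: "complex \<Rightarrow> 'w::ab_group_add \<Rightarrow> 'w" +
  fixes X E :: "nat \<Rightarrow> 'w \<Rightarrow> 'w"
  assumes X_lin: "\<And>q. Vector_Spaces.linear scale scale (X q)"
    and E0: "\<And>w. E 0 w = w"
    and rec: "\<And>n w. scale (of_nat n) (E n w) = (\<Sum>q=1..n. scale (of_nat q) (X q (E (n - q) w)))"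
begin

text \<open>For n > 0 the integer n is invertible, so the recursion determines E_n from the earlier
  coefficients and linearity is inherited. The same division by n underlies the next lemmas.\<close>

lemma E_lin: "Vector_Spaces.linear scale scale (E n)"
proof -
  have "E n (v + w) = E n v + E n w \<and> E n (scale c w) = scale c (E n w)" for v w c
  proof (induction n rule: less_induct)
    case (less n)
    show ?case
    proof (cases "n = 0")
      case False
      have "scale (of_nat n) (E n (v + w)) = scale (of_nat n) (E n v + E n w)"
        unfolding scale_right_distrib rec sum.distrib[symmetric]
        using less by (intro sum.cong refl) (simp add: lin_simps[OF X_lin] scale_right_distrib)
      moreover have "scale (of_nat n) (E n (scale c w)) = scale (of_nat n) (scale c (E n w))"
        unfolding scale_left_commute[of _ c] rec scale_sum_right
        using less
        by (intro sum.cong refl) (simp add: lin_simps[OF X_lin] mult.commute)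
      ultimately show ?thesis
        using False scale_left_cancel_nat by blast
    qed (simp add: E0)
  qed
  then show ?thesis
    by unfold_locales (auto simp: scale_right_distrib scale_left_distrib)
qed

text \<open>Commutation with A is a derivation: a scalar [A, X(z)] = c z^m gives [A, exp X(z)] = c
  z^m exp X(z). The proof compares coefficients in the recursion.\<close>

lemma E_commutator:
  assumes A: "Vector_Spaces.linear scale scale A"
    and AX: "\<And>q w. A (X q w) = X q (A w) + (if q = m then scale c w else 0)"
    and m: "m \<ge> 1"
  shows "A (E n w) = E n (A w) + (if m \<le> n then scale c (E (n - m) w) else 0)"
proof (induction n rule: less_induct)
  case (less n)
  show ?case
  proof (cases "n = 0")
    case False
    let ?d = "\<lambda>n. if m \<le> n then scale c (E (n - m) w) else 0"
    have "scale (of_nat n) (A (E n w)) = A (scale (of_nat n) (E n w))"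
      by (simp add: lin_scale[OF A])
    also have "\<dots> = (\<Sum>q=1..n. scale (of_nat q) (A (X q (E (n - q) w))))"
      by (simp add: rec lin_sum[OF A] lin_scale[OF A])
    also have "\<dots> = (\<Sum>q=1..n. scale (of_nat q) (X q (E (n - q) (A w)))
        + scale (of_nat q) (X q (?d (n - q)))
        + (if q = m then scale (of_nat q) (scale c (E (n - q) w)) else 0))"
      by (intro sum.cong refl)
        (use False in \<open>simp add: AX less lin_simps[OF X_lin] scale_right_distrib\<close>)
    also have "\<dots> = scale (of_nat n) (E n (A w))
        + (\<Sum>q=1..n. scale (of_nat q) (X q (?d (n - q))))
        + (if m \<le> n then scale (of_nat m) (scale c (E (n - m) w)) else 0)"
      using m by (simp add: sum.distrib rec)
    \<comment> \<open>The recursion for E_(n-m) evaluates this sum; its weight n - m and the weight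
      m of the term q = m add up to n.\<close>
    also have "(\<Sum>q=1..n. scale (of_nat q) (X q (?d (n - q))))
        = (if m \<le> n then scale c (scale (of_nat (n - m)) (E (n - m) w)) else 0)"
    proof (cases "m \<le> n")
      case True
      have "(\<Sum>q=1..n. scale (of_nat q) (X q (?d (n - q))))
          = (\<Sum>q=1..n-m. scale (of_nat q) (X q (scale c (E (n - m - q) w))))"
        using True m
        by (intro sum.mono_neutral_cong_right)
          (auto simp: lin_simps[OF X_lin] diff_commute add.commute)
      then show ?thesis using True
        by (simp add: rec scale_sum_right lin_simps[OF X_lin] mult.commute del: of_nat_diff)
    next
      case False
      then show ?thesis by (auto simp: lin_simps[OF X_lin] intro!: sum.neutral)
    qed
    finally have "scale (of_nat n) (A (E n w)) = scale (of_nat n) (E n (A w) + ?d n)"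
      by (cases "m \<le> n")
        (auto simp: scale_right_distrib of_nat_diff algebra_simps mult.commute
          scale_left_diff_distrib scale_left_distrib)
    then show ?thesis
      using False scale_left_cancel_nat by blast
  qed (use m in \<open>simp add: E0\<close>)
qed

lemma E_commute:
  assumes "Vector_Spaces.linear scale scale A" "\<And>q w. A (X q w) = X q (A w)"
  shows "A (E n w) = E n (A w)"
  using E_commutator[of A 1 0] assms by simp

text \<open>A solution of the differential equation is determined by its constant term. Here
  \<open>y\<close> is a series of vectors; it will be Y(e^\<beta>, z)w with its lowest power of z
  divided out.\<close>

lemma solution_unique:
  assumes "\<And>n. scale (of_nat n) (y n) = (\<Sum>q=1..n. scale (of_nat q) (X q (y (n - q))))"
  shows "y n = E n (y 0)"
proof (induction n rule: less_induct)
  case (less n)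
  show ?case
  proof (cases "n = 0")
    case False
    have "scale (of_nat n) (y n) = scale (of_nat n) (E n (y 0))"
      unfolding assms rec
    proof (intro sum.cong refl)
      fix q assume "q \<in> {1..n}"
      then have "y (n - q) = E (n - q) (y 0)" using False by (intro less) auto
      then show "scale (of_nat q) (X q (y (n - q))) = scale (of_nat q) (X q (E (n - q) (y 0)))"
        by (rule arg_cong)
    qed
    then show ?thesis using False scale_left_cancel_nat by blast
  qed (simp add: E0)
qed

text \<open>Here D y = -(D X) y, so D(E y) = 0 and E y is constant: exp X cancels a solution of the
  equation of exp(-X).\<close>

lemma inverse_solution:
  assumes comm: "\<And>q r w. X q (X r w) = X r (X q w)"
    and y: "\<And>n. scale (of_nat n) (y n) = - (\<Sum>q=1..n. scale (of_nat q) (X q (y (n - q))))"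
    and n: "n > 0"
  shows "(\<Sum>q\<le>n. E q (y (n - q))) = 0"
proof -
  have EX: "E q (X r w) = X r (E q w)" for q r w
    using E_commute[OF X_lin comm] by simp
  have "scale (of_nat n) (E q (y (n - q)))
      = scale (of_nat q) (E q (y (n - q))) + E q (scale (of_nat (n - q)) (y (n - q)))"
    if "q \<le> n" for q
  proof -
    have "(of_nat n :: complex) = of_nat q + of_nat (n - q)"
      using that by (simp flip: of_nat_add)
    then show ?thesis by (simp add: scale_left_distrib lin_simps[OF E_lin])
  qed
  then have "scale (of_nat n) (\<Sum>q\<le>n. E q (y (n - q)))
      = (\<Sum>q\<le>n. \<Sum>r=1..q. scale (of_nat r) (X r (E (q - r) (y (n - q)))))
        - (\<Sum>q\<le>n. \<Sum>r=1..n-q. scale (of_nat r) (X r (E q (y (n - q - r)))))"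
    by (simp add: scale_sum_right rec y lin_simps[OF E_lin] EX sum.distrib sum_negf
        sum_subtractf del: of_nat_diff)
  also have "(\<Sum>q\<le>n. \<Sum>r=1..q. scale (of_nat r) (X r (E (q - r) (y (n - q)))))
      = (\<Sum>q\<le>n. \<Sum>r=1..n-q. scale (of_nat r) (X r (E q (y (n - q - r)))))"
    \<comment> \<open>The index q - r in the first double sum becomes the index q of the
      second.\<close>
    unfolding sum.Sigma[OF finite_atMost ballI, OF finite_atLeastAtMost]
    by (rule sum.reindex_bij_witness[where
          i = "\<lambda>(q, r). (q + r, r)" and j = "\<lambda>(q, r). (q - r, r)"]) auto
  finally show ?thesis using n by simp
qed

end


section \<open>Vertex operators on Fock spaces\<close>

subsection \<open>The two half exponentials\<close>

text \<open>The coefficient of z^q in the exponent of E^-(\<beta>, z), so that q X_q = -\<beta>(-q).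
  In \<open>plus_arg\<close> the index q belongs to z^(-q), and q X_q = \<beta>(q).\<close>

definition minus_arg ::
  "(complex \<Rightarrow> 'w \<Rightarrow> 'w) \<Rightarrow> ('n hsp \<Rightarrow> int \<Rightarrow> 'w \<Rightarrow> 'w) \<Rightarrow> 'n::finite hsp \<Rightarrow> nat \<Rightarrow> 'w::ab_group_add \<Rightarrow> 'w"
  where "minus_arg sc a \<beta> q w = (if q = 0 then 0 else sc (1 / of_int (- int q)) (a \<beta> (- int q) w))"

definition plus_arg ::
  "(complex \<Rightarrow> 'w \<Rightarrow> 'w) \<Rightarrow> ('n hsp \<Rightarrow> int \<Rightarrow> 'w \<Rightarrow> 'w) \<Rightarrow> 'n::finite hsp \<Rightarrow> nat \<Rightarrow> 'w::ab_group_add \<Rightarrow> 'w"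
  where "plus_arg sc a \<beta> q w = (if q = 0 then 0 else sc (1 / of_int (int q)) (a \<beta> (int q) w))"

context
  fixes sc :: "complex \<Rightarrow> 'w::ab_group_add \<Rightarrow> 'w" and a :: "'n::finite hsp \<Rightarrow> int \<Rightarrow> 'w \<Rightarrow> 'w"
    and \<beta> :: "'n hsp"
  assumes sc0: "\<And>c. sc c 0 = 0" and a0: "\<And>n. n \<noteq> 0 \<Longrightarrow> a \<beta> n 0 = 0"
begin

lemma half_series_minus:
  "half_series 1 (\<lambda>p w. if - p \<in> {..<0} then sc (1 / of_int (- p)) (a \<beta> (- p) w) else 0)"
  by unfold_locales (auto simp: sc0 a0)

lemma half_series_plus:
  "half_series (- 1) (\<lambda>p w. if - p \<in> {0<..} then sc (1 / of_int (- p)) (a \<beta> (- p) w) else 0)"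
  by unfold_locales (auto simp: sc0 a0)

lemma E_minus_neg: "p < 0 \<Longrightarrow> E_minus sc a \<beta> p w = 0"
  unfolding E_minus_def half_exp_def
  by (rule half_series.sexp_neg[OF half_series_minus]) (auto simp: sc0)

lemma E_plus_pos: "p > 0 \<Longrightarrow> E_plus sc a \<beta> p w = 0"
  unfolding E_plus_def half_exp_def
  by (rule half_series.sexp_neg[OF half_series_plus]) (auto simp: sc0)

lemma E_minus_exp_coeff: "E_minus sc a \<beta> (int n) w = exp_coeff sc (minus_arg sc a \<beta>) n w"
proof -
  have "minus_arg sc a \<beta> = (\<lambda>q w. if - (1 * int q) \<in> {..<0}
      then sc (1 / of_int (- (1 * int q))) (a \<beta> (- (1 * int q)) w) else 0)"
    by (auto simp: fun_eq_iff minus_arg_def)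
  then show ?thesis
    using half_series.sexp_exp_coeff[OF half_series_minus, where sc = sc and n = n and w = w, OF sc0]
    by (simp add: E_minus_def half_exp_def)
qed

lemma E_plus_exp_coeff: "E_plus sc a \<beta> (- int n) w = exp_coeff sc (plus_arg sc a \<beta>) n w"
proof -
  have "plus_arg sc a \<beta> = (\<lambda>q w. if - (- 1 * int q) \<in> {0<..}
      then sc (1 / of_int (- (- 1 * int q))) (a \<beta> (- (- 1 * int q)) w) else 0)"
    by (auto simp: fun_eq_iff plus_arg_def)
  then show ?thesis
    using half_series.sexp_exp_coeff[OF half_series_plus, where sc = sc and n = n and w = w, OF sc0]
    by (simp add: E_plus_def half_exp_def)
qed

lemma exp_coeff_killed:
  assumes "\<And>q. X q 0 = 0" "\<And>q. q > 0 \<Longrightarrow> X q w = 0" "sc 1 w = w"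
  shows "exp_coeff sc X n w = (if n = 0 then w else 0)"
proof -
  have "exp_coeff sc X n w = (\<Sum>j\<le>n. if j = 0 then (if n = 0 then w else 0) else 0)"
    unfolding exp_coeff_def
    using conv_pow_killed[of X w, OF assms(1,2)] assms(3)
    by (intro sum.cong) (auto simp: sc0)
  then show ?thesis by simp
qed

lemma E_plus_killed:
  assumes "\<And>n. n > 0 \<Longrightarrow> a \<beta> n w = 0" "sc 1 w = w"
  shows "E_plus sc a \<beta> p w = (if p = 0 then w else 0)"
proof (cases "p > 0")
  case False
  then obtain n where p: "p = - int n" by (metis nonneg_int_cases neg_0_le_iff_le
    minus_minus not_le_imp_less less_le_not_le linorder_not_less)
  have "exp_coeff sc (plus_arg sc a \<beta>) n w = (if n = 0 then w else 0)"
    using assms by (intro exp_coeff_killed) (auto simp: plus_arg_def sc0 a0)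
  then show ?thesis by (simp add: p E_plus_exp_coeff)
qed (simp add: E_plus_pos)

lemma E_minus_killed:
  assumes "\<And>n. n < 0 \<Longrightarrow> a \<beta> n w = 0" "sc 1 w = w"
  shows "E_minus sc a \<beta> p w = (if p = 0 then w else 0)"
proof (cases "p < 0")
  case False
  then obtain n where p: "p = int n" by (metis nonneg_int_cases linorder_not_less)
  have "exp_coeff sc (minus_arg sc a \<beta>) n w = (if n = 0 then w else 0)"
    using assms by (intro exp_coeff_killed) (auto simp: minus_arg_def sc0 a0)
  then show ?thesis by (simp add: p E_minus_exp_coeff)
qed (simp add: E_minus_neg)

lemma E_minus_0: "sc 1 w = w \<Longrightarrow> E_minus sc a \<beta> 0 w = w"
  using E_minus_exp_coeff[of 0 w] by (simp add: exp_coeff_def)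

lemma E_minus_1:
  assumes "sc 1 (sc (- 1) (a \<beta> (- 1) w)) = sc (- 1) (a \<beta> (- 1) w)"
  shows "E_minus sc a \<beta> 1 w = sc (- 1) (a \<beta> (- 1) w)"
  using E_minus_exp_coeff[of 1 w] assms
  by (simp add: exp_coeff_def minus_arg_def sc0)

end

lemma (in complex_vector_space) exp_rec_minus:
  assumes lin: "\<And>n. n \<noteq> 0 \<Longrightarrow> Vector_Spaces.linear scale scale (a \<beta> n)"
    and comm: "\<And>m n w. m < 0 \<Longrightarrow> n < 0 \<Longrightarrow> a \<beta> m (a \<beta> n w) = a \<beta> n (a \<beta> m w)"
  shows "exp_rec scale (minus_arg scale a \<beta>) (\<lambda>n. E_minus scale a \<beta> (int n))"
proof -
  have a0: "a \<beta> n 0 = 0" if "n \<noteq> 0" for n by (rule lin_zero[OF lin[OF that]])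
  have arg_lin: "Vector_Spaces.linear scale scale (minus_arg scale a \<beta> q)" for q
    by unfold_locales
      (auto simp: minus_arg_def lin_simps[OF lin] scale_right_distrib scale_left_distrib mult.commute)
  have arg_comm: "minus_arg scale a \<beta> q (minus_arg scale a \<beta> r w)
      = minus_arg scale a \<beta> r (minus_arg scale a \<beta> q w)" for q r w
    using comm[of "- int q" "- int r" w]
    by (auto simp: minus_arg_def lin_simps[OF lin] mult.commute)
  show ?thesis
    using exp_coeff_recursion[OF arg_lin arg_comm]
    by unfold_locales
      (auto simp: arg_lin lin_simps[OF arg_lin] E_minus_exp_coeff[where sc = scale and a = a and \<beta> = \<beta>, OF scale_zero_right a0]
        E_minus_0[where sc = scale and a = a and \<beta> = \<beta>, OF scale_zero_right a0] scale_right_distrib scale_left_distrib simp del: of_nat_diff)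
qed

lemma (in complex_vector_space) exp_rec_plus:
  assumes lin: "\<And>n. n \<noteq> 0 \<Longrightarrow> Vector_Spaces.linear scale scale (a \<beta> n)"
    and comm: "\<And>m n w. m > 0 \<Longrightarrow> n > 0 \<Longrightarrow> a \<beta> m (a \<beta> n w) = a \<beta> n (a \<beta> m w)"
  shows "exp_rec scale (plus_arg scale a \<beta>) (\<lambda>n. E_plus scale a \<beta> (- int n))"
proof -
  have a0: "a \<beta> n 0 = 0" if "n \<noteq> 0" for n by (rule lin_zero[OF lin[OF that]])
  have arg_lin: "Vector_Spaces.linear scale scale (plus_arg scale a \<beta> q)" for q
    by unfold_locales
      (auto simp: plus_arg_def lin_simps[OF lin] scale_right_distrib scale_left_distrib mult.commute)
  have arg_comm: "plus_arg scale a \<beta> q (plus_arg scale a \<beta> r w)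
      = plus_arg scale a \<beta> r (plus_arg scale a \<beta> q w)" for q r w
    using comm[of "int q" "int r" w]
    by (auto simp: plus_arg_def lin_simps[OF lin] mult.commute)
  have "exp_coeff scale (plus_arg scale a \<beta>) 0 w = w" for w
    by (simp add: exp_coeff_def)
  then show ?thesis
    using exp_coeff_recursion[OF arg_lin arg_comm]
    by unfold_locales
      (auto simp: arg_lin lin_simps[OF arg_lin] E_plus_exp_coeff[where sc = scale and a = a and \<beta> = \<beta>, OF scale_zero_right a0]
        E_plus_exp_coeff[where sc = scale and a = a and \<beta> = \<beta> and n = 0, OF scale_zero_right a0, simplified]
        scale_right_distrib scale_left_distrib simp del: of_nat_diff)
qed


lemma single_sum: "Poly_Mapping.single x (sum g A) = (\<Sum>y\<in>A. Poly_Mapping.single x (g y))"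
  by (induction A rule: infinite_finite_induct) (simp_all add: single_add)

subsection \<open>The Heisenberg action on Fock space\<close>

lemma lookup_pm_scale:
  "sc a 0 = 0 \<Longrightarrow> Poly_Mapping.lookup (pm_scale sc a f) x = sc a (Poly_Mapping.lookup f x)"
  by (simp add: pm_scale_def lookup_map_zero)

lemma pm_scale_single:
  "sc a 0 = 0 \<Longrightarrow> pm_scale sc a (Poly_Mapping.single x w) = Poly_Mapping.single x (sc a w)"
  by (simp add: pm_scale_def)

lemma vector_space_pm_scale:
  assumes "vector_space sc"
  shows "vector_space (pm_scale sc :: complex \<Rightarrow> ('x \<Rightarrow>\<^sub>0 'w::ab_group_add) \<Rightarrow> _)"
proof -
  interpret vector_space sc by fact
  show ?thesis
    by unfold_locales
      (auto intro!: poly_mapping_eqI simp: lookup_pm_scale lookup_add scale_right_distrib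
        scale_left_distrib)
qed

lemma vector_space_mult: "vector_space ((*) :: complex \<Rightarrow> complex \<Rightarrow> complex)"
  by unfold_locales (auto simp: algebra_simps)

lemma vector_space_V_scale: "vector_space (V_scale :: complex \<Rightarrow> 'n::finite VC \<Rightarrow> _)"
  unfolding V_scale_def by (intro vector_space_pm_scale vector_space_mult)

section \<open>The bilinear form and the inclusion of \<open>L\<^sub>C\<close>\<close>

lemma form_add_left: "form k (\<alpha> + \<alpha>') \<beta> = form k \<alpha> \<beta> + form k \<alpha>' \<beta>"
  by (simp add: form_def algebra_simps sum.distrib)
lemma form_scale_left: "form k (c *s \<alpha>) \<beta> = c * form k \<alpha> \<beta>"
  by (simp add: form_def algebra_simps sum_distrib_left)
lemma form_commute: "form k \<alpha> \<beta> = form k \<beta> \<alpha>"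
  by (simp add: form_def algebra_simps)
lemma form_add_right: "form k \<beta> (\<alpha> + \<alpha>') = form k \<beta> \<alpha> + form k \<beta> \<alpha>'"
  by (simp add: form_def algebra_simps sum.distrib)
lemma form_scale_right: "form k \<beta> (c *s \<alpha>) = c * form k \<beta> \<alpha>"
  by (simp add: form_def algebra_simps sum_distrib_left)
lemma form_0 [simp]: "form k 0 \<beta> = 0" "form k \<alpha> 0 = 0"
  by (simp_all add: form_def)
lemma hsp_uminus: "- (v :: 'n::finite hsp) = (- 1) *s v"
  by (simp add: vec_eq_iff)
lemma form_uminus [simp]: "form k (- \<alpha>) \<beta> = - form k \<alpha> \<beta>" "form k \<alpha> (- \<beta>) = - form k \<alpha> \<beta>"
  by (simp_all add: hsp_uminus form_scale_left form_scale_right)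
lemma form_sum_right: "form k \<beta> (sum f A) = (\<Sum>x\<in>A. form k \<beta> (f x))"
  by (induction A rule: infinite_finite_induct) (simp_all add: form_add_right)
lemma form_sum_left: "form k (sum f A) \<beta> = (\<Sum>x\<in>A. form k (f x) \<beta>)"
  by (induction A rule: infinite_finite_induct) (simp_all add: form_add_left)

lemma vec_expand: "\<alpha> = (\<Sum>b\<in>UNIV. (\<alpha> $ b) *s basis_vec b)"
  by (simp add: vec_eq_iff basis_vec_def axis_def if_distrib sum.delta' cong: if_cong)

lemma form_expand_right: "(\<Sum>b\<in>UNIV. form k \<alpha> (basis_vec b) * \<beta> $ b) = form k \<alpha> \<beta>"
  by (subst (2) vec_expand) (simp add: form_sum_right form_scale_right mult.commute)

lemma lat_component [simp]: "lat \<alpha> $ Inl i = of_int (\<alpha> $ i)" "lat \<alpha> $ Inr i = 0"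
  by (simp_all add: lat_def basis_vec_def axis_def if_distrib sum.delta' cong: if_cong)

lemma lat_eqI: "(\<And>i. v $ Inl i = of_int (\<alpha> $ i)) \<Longrightarrow> (\<And>i. v $ Inr i = 0) \<Longrightarrow> lat \<alpha> = v"
  unfolding vec_eq_iff by (metis lat_component sum.exhaust)

lemma lat_add: "lat (\<alpha> + \<beta>) = lat \<alpha> + lat \<beta>"
  by (rule lat_eqI) simp_all
lemma lat_0 [simp]: "lat 0 = 0"
  by (rule lat_eqI) simp_all
lemma lat_uminus: "lat (- \<alpha>) = - lat \<alpha>"
  by (rule lat_eqI) simp_all
lemma form_lat_lat [simp]: "form k (lat \<alpha>) (lat \<beta>) = 0"
  by (simp add: form_def)

context
  fixes k :: int and sc :: "complex \<Rightarrow> 'w::ab_group_add \<Rightarrow> 'w" and z0 :: "'n::finite hsp \<Rightarrow> 'w \<Rightarrow> 'w"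
  assumes vs: "vector_space sc"
begin

interpretation vector_space sc by (rule vs)

lemma fock_mode_neg:
  "n < 0 \<Longrightarrow> fock_mode k sc z0 \<alpha> n f = pm_sum (\<lambda>M w. \<Sum>b\<in>UNIV.
     Poly_Mapping.single (add_mset (b, nat (- n - 1)) M) (sc (\<alpha> $ b) w)) f"
  by (simp add: fock_mode_def pm_sum_def)

lemma fock_mode_pos:
  "n > 0 \<Longrightarrow> fock_mode k sc z0 \<alpha> n f = pm_sum (\<lambda>M w. \<Sum>b\<in>UNIV.
     Poly_Mapping.single (M - {#(b, nat (n - 1))#})
       (sc (of_int n * form k \<alpha> (basis_vec b) * of_nat (count M (b, nat (n - 1)))) w)) f"
  by (simp add: fock_mode_def pm_sum_def)

lemma fock_mode_single_neg:
  "n < 0 \<Longrightarrow> fock_mode k sc z0 \<alpha> n (Poly_Mapping.single M w) = (\<Sum>b\<in>UNIV.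
     Poly_Mapping.single (add_mset (b, nat (- n - 1)) M) (sc (\<alpha> $ b) w))"
  by (subst fock_mode_neg, assumption, subst pm_sum_single) simp_all

lemma fock_mode_single_pos:
  "n > 0 \<Longrightarrow> fock_mode k sc z0 \<alpha> n (Poly_Mapping.single M w) = (\<Sum>b\<in>UNIV.
     Poly_Mapping.single (M - {#(b, nat (n - 1))#})
       (sc (of_int n * form k \<alpha> (basis_vec b) * of_nat (count M (b, nat (n - 1)))) w))"
  by (subst fock_mode_pos, assumption, subst pm_sum_single) simp_all

lemma fock_mode_zero [simp]: "fock_mode k sc z0 \<alpha> n 0 = 0"
  by (simp add: fock_mode_def poly_mapping_eq_iff fun_eq_iff Poly_Mapping.map.rep_eq)

text \<open>Only the zero mode goes through \<open>z0\<close>, which need not be additive on all of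
  its type when it comes from an \<open>A\<close>-module on a subspace; so the conditions are
  confined to n = 0.\<close>

lemma fock_mode_add:
  assumes "n = 0 \<Longrightarrow> z0 \<alpha> 0 = 0" "n = 0 \<Longrightarrow> \<forall>x y. z0 \<alpha> (x + y) = z0 \<alpha> x + z0 \<alpha> y"
  shows "fock_mode k sc z0 \<alpha> n (f + g) = fock_mode k sc z0 \<alpha> n f + fock_mode k sc z0 \<alpha> n g"
proof -
  consider "n < 0" | "n = 0" | "n > 0" by linarith
  then show ?thesis
  proof cases
    case 1
    then show ?thesis unfolding fock_mode_neg[OF 1]
      by (intro pm_sum_add) (simp_all add: scale_right_distrib single_add sum.distrib)
  next
    case 2
    then show ?thesis using assms
      by (auto intro!: poly_mapping_eqI simp: fock_mode_def lookup_add lookup_map_zero)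
  next
    case 3
    then show ?thesis unfolding fock_mode_pos[OF 3]
      by (intro pm_sum_add) (simp_all add: scale_right_distrib single_add sum.distrib)
  qed
qed

lemma fock_mode_basis_neg:
  assumes "n < 0"
  shows "fock_mode k sc z0 (basis_vec b) n (Poly_Mapping.single M w)
       = Poly_Mapping.single (add_mset (b, nat (- n - 1)) M) w"
proof -
  have "fock_mode k sc z0 (basis_vec b) n (Poly_Mapping.single M w) = (\<Sum>b'\<in>UNIV.
     if b' = b then Poly_Mapping.single (add_mset (b, nat (- n - 1)) M) w else 0)"
    unfolding fock_mode_single_neg[OF assms]
    by (intro sum.cong) (auto simp: basis_vec_def axis_def)
  then show ?thesis by simp
qed

lemma fock_mode_index_linear:
  assumes "n = 0 \<Longrightarrow> \<forall>w. z0 \<alpha> w = (\<Sum>b\<in>UNIV. sc (\<alpha> $ b) (z0 (basis_vec b) w))"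
    and "n = 0 \<Longrightarrow> \<forall>\<alpha>. z0 \<alpha> 0 = 0" "n = 0 \<Longrightarrow> \<forall>\<alpha> x y. z0 \<alpha> (x + y) = z0 \<alpha> x + z0 \<alpha> y"
  shows "fock_mode k sc z0 \<alpha> n f = (\<Sum>b\<in>UNIV. pm_scale sc (\<alpha> $ b) (fock_mode k sc z0 (basis_vec b) n f))"
proof (induction f rule: pm_induct)
  case zero
  interpret P: vector_space "pm_scale sc :: complex \<Rightarrow> ('n, 'w) fock \<Rightarrow> _"
    by (rule vector_space_pm_scale[OF vs])
  show ?case by simp
next
  case (add g h)
  interpret P: vector_space "pm_scale sc :: complex \<Rightarrow> ('n, 'w) fock \<Rightarrow> _"
    by (rule vector_space_pm_scale[OF vs])
  show ?case using assms add
    by (simp add: fock_mode_add P.scale_right_distrib sum.distrib)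
next
  case (single M w)
  interpret P: vector_space "pm_scale sc :: complex \<Rightarrow> ('n, 'w) fock \<Rightarrow> _"
    by (rule vector_space_pm_scale[OF vs])
  consider "n < 0" | "n = 0" | "n > 0" by linarith
  then show ?case
  proof cases
    case 1
    then show ?thesis
      by (simp add: fock_mode_basis_neg fock_mode_single_neg[of n \<alpha>] pm_scale_single)
  next
    case 2
    then show ?thesis using assms(1,2)
      by (simp add: fock_mode_def pm_scale_single)
        (rule poly_mapping_eqI, simp add: lookup_sum lookup_single when_def)
  next
    case 3
    have "form k \<alpha> (basis_vec b) = (\<Sum>b'\<in>UNIV. \<alpha> $ b' * form k (basis_vec b') (basis_vec b))" for b
      by (subst vec_expand[of \<alpha>]) (simp add: form_sum_left form_scale_left)
    then have "fock_mode k sc z0 \<alpha> n (Poly_Mapping.single M w) = (\<Sum>b\<in>UNIV. \<Sum>b'\<in>UNIV.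
       Poly_Mapping.single (M - {#(b, nat (n - 1))#})
       (sc (\<alpha> $ b' * (of_int n * form k (basis_vec b') (basis_vec b) * of_nat (count M (b, nat (n - 1))))) w))"
      unfolding fock_mode_single_pos[OF 3]
      by (intro sum.cong refl poly_mapping_eqI)
        (simp add: lookup_sum lookup_single when_def scale_sum_left sum_distrib_left
          sum_distrib_right mult.assoc mult.left_commute)
    also have "\<dots> = (\<Sum>b'\<in>UNIV. pm_scale sc (\<alpha> $ b') (fock_mode k sc z0 (basis_vec b') n (Poly_Mapping.single M w)))"
      unfolding fock_mode_single_pos[OF 3]
      by (subst sum.swap) (simp add: P.scale_sum_right pm_scale_single)
    finally show ?thesis .
  qed
qed

lemma fock_mode_index_0: "n \<noteq> 0 \<Longrightarrow> fock_mode k sc z0 0 n f = 0"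
  by (simp add: fock_mode_def)

lemma fock_mode_index_uminus:
  assumes "n \<noteq> 0"
  shows "pm_scale sc (- 1) (fock_mode k sc z0 (- \<alpha>) n f) = fock_mode k sc z0 \<alpha> n f"
proof -
  interpret P: vector_space "pm_scale sc :: complex \<Rightarrow> ('n, 'w) fock \<Rightarrow> _"
    by (rule vector_space_pm_scale[OF vs])
  show ?thesis
    using assms by (simp add: fock_mode_index_linear[of n "- \<alpha>"] fock_mode_index_linear[of n "\<alpha>"]
      P.scale_sum_right)
qed

end



subsection \<open>Vertex operators of the generators\<close>

lemma vop_pm_sum:
  "vop k sc z0 ea lam v n f = pm_sum (\<lambda>M. pm_sum (\<lambda>\<beta> c. pm_scale sc c
     (vop_word k sc z0 ea lam (map (\<lambda>(b, j). (basis_vec b, j)) (SOME xs. mset xs = M)) \<beta> (- n - 1) f))) v"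
  by (simp add: vop_def pm_sum_def)

lemma some_mset_empty: "(SOME xs. mset xs = {#}) = []"
  by simp

lemma some_mset_single: "(SOME xs. mset xs = {#x#}) = [x]"
  by (metis (mono_tags, lifting) mset_single_iff someI mset.simps)

context
  fixes k :: int and sc :: "complex \<Rightarrow> 'w::ab_group_add \<Rightarrow> 'w" and z0 :: "'n::finite hsp \<Rightarrow> 'w \<Rightarrow> 'w"
    and ea :: "'n latC \<Rightarrow> 'w \<Rightarrow> 'w" and lam :: "'n hsp"
  assumes vs: "vector_space sc"
begin

interpretation P: vector_space "pm_scale sc :: complex \<Rightarrow> ('n, 'w) fock \<Rightarrow> _"
  by (rule vector_space_pm_scale[OF vs])

lemma vop_add: "vop k sc z0 ea lam (u + v) n f = vop k sc z0 ea lam u n f + vop k sc z0 ea lam v n f"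
  unfolding vop_pm_sum
proof (rule pm_sum_add, goal_cases)
  case (2 M)
  show ?case by (rule pm_sum_add) (simp_all add: P.scale_left_distrib)
qed simp

lemma vop_0: "vop k sc z0 ea lam 0 n f = 0"
  by (simp add: vop_pm_sum)

lemma vop_single:
  "vop k sc z0 ea lam (Poly_Mapping.single M (Poly_Mapping.single \<beta> c)) n f = pm_scale sc c
     (vop_word k sc z0 ea lam (map (\<lambda>(b, j). (basis_vec b, j)) (SOME xs. mset xs = M)) \<beta> (- n - 1) f)"
  unfolding vop_pm_sum by (subst pm_sum_single, simp)+ simp

lemma vop_V_exp: "vop k sc z0 ea lam (V_exp \<beta>) n f = vop_exp k sc z0 ea lam \<beta> (- n - 1) f"
  by (simp add: V_exp_def vop_single some_mset_empty vop_word_def)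

lemma sconst_z_pow:
  assumes "f0 0 = 0"
  shows "(sconst (Poly_Mapping.map f0) \<star> z_pow k lam \<beta>) p (f :: ('n, 'w) fock)
    = (if of_int p = form k (lat \<beta>) lam then Poly_Mapping.map f0 f else 0)"
proof -
  have m0: "Poly_Mapping.map f0 (0 :: ('n, 'w) fock) = 0"
    by (rule poly_mapping_eqI) (simp add: lookup_map_zero assms)
  have "(sconst (Poly_Mapping.map f0) \<star> z_pow k lam \<beta>) p f
      = sconst (Poly_Mapping.map f0) 0 (z_pow k lam \<beta> (p - 0) f)"
    unfolding sprod_def by (rule Sum_any_single) (simp add: sconst_def)
  then show ?thesis by (simp add: sconst_def z_pow_def m0)
qed

text \<open>Integrality of (\<beta>, \<lambda>) makes z^\<beta> a shift of the exponents by
  \<open>N\<close>, leaving the two half exponentials applied to the image of f under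
  \<open>ea \<beta>\<close>.\<close>

lemma vop_exp_eq:
  assumes ea0: "ea \<beta> 0 = 0" and N: "of_int N = form k (lat \<beta>) lam"
  shows "vop_exp k sc z0 ea lam \<beta> p (f :: ('n, 'w) fock)
    = (E_minus (pm_scale sc) (fock_mode k sc z0) (- lat \<beta>)
        \<star> E_plus (pm_scale sc) (fock_mode k sc z0) (- lat \<beta>)) (p - N) (Poly_Mapping.map (ea \<beta>) f)"
proof -
  let ?a = "fock_mode k sc z0"
  let ?Em = "E_minus (pm_scale sc) ?a (- lat \<beta>)" and ?Ep = "E_plus (pm_scale sc) ?a (- lat \<beta>)"
  let ?g = "Poly_Mapping.map (ea \<beta>) f"
  have Ep0: "?Ep q 0 = 0" for q
    by (subst E_plus_killed) (simp_all add: fock_mode_zero[OF vs])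
  have inner: "(sconst (Poly_Mapping.map (ea \<beta>)) \<star> z_pow k lam \<beta>) q f = (if q = N then ?g else 0)" for q
    using N by (simp add: sconst_z_pow ea0 flip: N)
  have mid: "(?Ep \<star> sconst (Poly_Mapping.map (ea \<beta>)) \<star> z_pow k lam \<beta>) q f = ?Ep (q - N) ?g" for q
    unfolding sprod_def[of ?Ep] inner
    by (subst Sum_any_single[of "q - N"]) (auto simp: Ep0)
  show ?thesis
    unfolding vop_exp_def Let_def sprod_def[of ?Em] mid
    by (simp only: cancel_ab_semigroup_add_class.diff_right_commute[of p _ N])
qed

lemma E_minus_fock_0: "E_minus (pm_scale sc) (fock_mode k sc z0) \<beta> p 0 = 0"
  by (subst E_minus_killed) (simp_all add: fock_mode_zero[OF vs])

lemma vop_exp_constant: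
  assumes ea0: "ea \<beta> 0 = 0" and N: "of_int N = form k (lat \<beta>) lam"
    and killed: "\<And>n. n > 0 \<Longrightarrow>
      fock_mode k sc z0 (- lat \<beta>) n (Poly_Mapping.map (ea \<beta>) f) = 0"
  shows "vop_exp k sc z0 ea lam \<beta> p (f :: ('n, 'w) fock)
    = E_minus (pm_scale sc) (fock_mode k sc z0) (- lat \<beta>) (p - N) (Poly_Mapping.map (ea \<beta>) f)"
proof -
  have "E_plus (pm_scale sc) (fock_mode k sc z0) (- lat \<beta>) q (Poly_Mapping.map (ea \<beta>) f)
      = (if q = 0 then Poly_Mapping.map (ea \<beta>) f else 0)" for q
    using killed by (intro E_plus_killed) (simp_all add: fock_mode_zero[OF vs])
  then show ?thesis
    unfolding vop_exp_eq[OF ea0 N] sprod_def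
    by (subst Sum_any_single[of "p - N"]) (auto simp: E_minus_fock_0)
qed

lemma vop_exp_0:
  assumes "\<And>w. ea 0 w = w"
  shows "vop_exp k sc z0 ea lam 0 p (f :: ('n, 'w) fock) = (if p = 0 then f else 0)"
proof -
  have map: "Poly_Mapping.map (ea 0) f = f"
    by (rule poly_mapping_eqI) (simp add: lookup_map_zero assms)
  have "vop_exp k sc z0 ea lam 0 p f
      = E_minus (pm_scale sc) (fock_mode k sc z0) (- lat 0) (p - 0) (Poly_Mapping.map (ea 0) f)"
    using assms by (intro vop_exp_constant) (simp_all add: fock_mode_index_0[OF vs])
  also have "\<dots> = (if p = 0 then f else 0)"
    unfolding map
    by (subst E_minus_killed) (simp_all add: fock_mode_index_0[OF vs] fock_mode_zero[OF vs])
  finally show ?thesis .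
qed

end

text \<open>The vertex operator of e^0 is the constant series 1, and in :\<alpha>(z) 1: the creation
  and annihilation halves add up to the full current.\<close>

lemma normal_mult_delta:
  fixes sc :: "complex \<Rightarrow> 'w::ab_group_add \<Rightarrow> 'w"
  assumes "sc 1 = id" "\<And>n. a \<alpha> n 0 = 0"
  shows "normal_mult sc a \<alpha> 0 (\<lambda>p w. if p = 0 then w else 0) p w = a \<alpha> (- p - 1) w"
proof -
  have d: "divided_deriv sc 0 F = F" for F :: "'w series"
    by (simp add: divided_deriv_def assms fun_eq_iff)
  have "(cur_part a {..<0} \<alpha> \<star> (\<lambda>p w. if p = 0 then w else 0)) p w
      = cur_part a {..<0} \<alpha> p w"
    unfolding sprod_def by (subst Sum_any_single[of p]) (auto simp: cur_part_def assms)
  moreover have "((\<lambda>p w. if p = 0 then w else 0) \<star> cur_part a {0..} \<alpha>) p w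
      = cur_part a {0..} \<alpha> p w"
    unfolding sprod_def by (subst Sum_any_single[of 0]) (auto simp: cur_part_def assms)
  ultimately show ?thesis
    by (simp add: normal_mult_def d cur_part_def)
qed


subsection \<open>Products in \<open>V\<close>\<close>

abbreviation group_scale :: "complex \<Rightarrow> ('n::finite latC \<Rightarrow>\<^sub>0 complex) \<Rightarrow> ('n latC \<Rightarrow>\<^sub>0 complex)" where
  "group_scale \<equiv> pm_scale (*)"

abbreviation V_mode :: "int \<Rightarrow> 'n::finite hsp \<Rightarrow> int \<Rightarrow> 'n VC \<Rightarrow> 'n VC" where
  "V_mode k \<equiv> fock_mode k group_scale (V_zero_mode k)"

lemma vector_space_group_scale: "vector_space (group_scale :: _ \<Rightarrow> ('n::finite latC \<Rightarrow>\<^sub>0 complex) \<Rightarrow> _)"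
  by (intro vector_space_pm_scale vector_space_mult)

interpretation GS: vector_space "group_scale :: _ \<Rightarrow> ('n::finite latC \<Rightarrow>\<^sub>0 complex) \<Rightarrow> _"
  by (rule vector_space_group_scale)

interpretation VS: vector_space "V_scale :: _ \<Rightarrow> 'n::finite VC \<Rightarrow> _"
  by (rule vector_space_V_scale)

lemma lookup_V_zero_mode:
  "Poly_Mapping.lookup (V_zero_mode k \<alpha> w) \<beta> = form k \<alpha> (lat \<beta>) * Poly_Mapping.lookup w \<beta>"
  by (simp add: V_zero_mode_def lookup_mapp when_def in_keys_iff)

lemma V_zero_mode_0 [simp]: "V_zero_mode k \<alpha> 0 = 0"
  by (rule poly_mapping_eqI) (simp add: lookup_V_zero_mode)

lemma V_zero_mode_add: "V_zero_mode k \<alpha> (v + w) = V_zero_mode k \<alpha> v + V_zero_mode k \<alpha> w"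
  by (rule poly_mapping_eqI) (simp add: lookup_V_zero_mode lookup_add distrib_left)

lemma V_zero_mode_expand:
  "V_zero_mode k \<alpha> w = (\<Sum>b\<in>UNIV. group_scale (\<alpha> $ b) (V_zero_mode k (basis_vec b) w))"
proof (rule poly_mapping_eqI)
  fix \<beta>
  show "Poly_Mapping.lookup (V_zero_mode k \<alpha> w) \<beta>
      = Poly_Mapping.lookup (\<Sum>b\<in>UNIV. group_scale (\<alpha> $ b) (V_zero_mode k (basis_vec b) w)) \<beta>"
    by (simp add: lookup_sum lookup_pm_scale lookup_V_zero_mode form_commute[of k _ "lat \<beta>"]
        form_expand_right[symmetric, of k "lat \<beta>" \<alpha>] sum_distrib_left sum_distrib_right mult_ac)
qed

lemma V_mode_add: "V_mode k \<alpha> n (u + v) = V_mode k \<alpha> n u + V_mode k \<alpha> n v"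
  by (rule fock_mode_add[OF vector_space_group_scale]) (simp_all add: V_zero_mode_add)

lemma V_mode_index_expand:
  "V_mode k \<alpha> n v = (\<Sum>b\<in>UNIV. V_scale (\<alpha> $ b) (V_mode k (basis_vec b) n v))"
  unfolding V_scale_def
  using V_zero_mode_expand[of k \<alpha>]
  by (intro fock_mode_index_linear[OF vector_space_group_scale]) (auto simp: V_zero_mode_add)

lemma V_mode_0 [simp]: "V_mode k \<alpha> n 0 = 0"
  by (rule fock_mode_zero[OF vector_space_group_scale])

lemma V_mode_sum: "V_mode k \<alpha> n (sum g A) = (\<Sum>x\<in>A. V_mode k \<alpha> n (g x))"
  by (induction A rule: infinite_finite_induct) (simp_all add: V_mode_add)

lemma V_scale_single:
  "V_scale c (Poly_Mapping.single M (Poly_Mapping.single \<beta> x)) = Poly_Mapping.single M (Poly_Mapping.single \<beta> (c * x))"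
  by (simp add: V_scale_def pm_scale_single)

lemma V_cur_expand:
  "V_cur k \<alpha> = (\<Sum>b\<in>UNIV. Poly_Mapping.single {#(b, 0)#} (Poly_Mapping.single 0 (\<alpha> $ b)))"
  by (simp add: V_cur_def V_vac_def V_exp_def fock_mode_single_neg[OF vector_space_group_scale] pm_scale_single
      del: single_one)

lemma V_mode_exp_pos: "n > 0 \<Longrightarrow> V_mode k \<alpha> n (V_exp \<beta>) = 0"
  by (simp add: V_exp_def fock_mode_single_pos[OF vector_space_group_scale])

lemma V_mode_exp_0: "V_mode k \<alpha> 0 (V_exp \<beta>) = V_scale (form k \<alpha> (lat \<beta>)) (V_exp \<beta>)"
proof -
  have "V_zero_mode k \<alpha> (Poly_Mapping.single \<beta> 1) = Poly_Mapping.single \<beta> (form k \<alpha> (lat \<beta>))"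
    by (rule poly_mapping_eqI) (auto simp: lookup_V_zero_mode lookup_single when_def)
  then show ?thesis
    by (simp add: V_exp_def fock_mode_def V_scale_single)
qed

lemma V_mode_cur_0: "V_mode k \<alpha> 0 (V_cur k \<beta>) = 0"
proof -
  have "V_zero_mode k \<alpha> (Poly_Mapping.single 0 c) = 0" for c
    by (rule poly_mapping_eqI) (auto simp: lookup_V_zero_mode lookup_single when_def)
  then show ?thesis
    by (simp add: V_cur_expand V_mode_sum) (simp add: fock_mode_def)
qed

lemma V_mode_cur_pos:
  assumes "n > 0"
  shows "V_mode k \<alpha> n (V_cur k \<beta>) = (if n = 1 then V_scale (form k \<alpha> \<beta>) V_vac else 0)"
proof -
  have "V_mode k \<alpha> n (Poly_Mapping.single {#(b, 0)#} (Poly_Mapping.single 0 (\<beta> $ b)))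
      = (if n = 1 then Poly_Mapping.single {#} (Poly_Mapping.single 0 (form k \<alpha> (basis_vec b) * \<beta> $ b)) else 0)"
    for b
  proof -
    have "V_mode k \<alpha> n (Poly_Mapping.single {#(b, 0)#} (Poly_Mapping.single 0 (\<beta> $ b)))
      = (\<Sum>b'\<in>UNIV. if b' = b then (if n = 1 then Poly_Mapping.single {#} (Poly_Mapping.single 0 (form k \<alpha> (basis_vec b) * \<beta> $ b)) else 0) else 0)"
      unfolding fock_mode_single_pos[OF vector_space_group_scale assms]
      by (intro sum.cong refl) (use assms in \<open>auto simp: pm_scale_single\<close>)
    then show ?thesis by simp
  qed
  then show ?thesis
    by (simp add: V_cur_expand V_mode_sum V_vac_def V_exp_def V_scale_single
        form_expand_right[symmetric, of k \<alpha> \<beta>] single_sum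
        del: single_one)
qed

lemma V_Y_add: "V_Y k (u + v) n f = V_Y k u n f + V_Y k v n f"
  unfolding V_Y_def by (rule vop_add[OF vector_space_group_scale])

lemma V_Y_0 [simp]: "V_Y k 0 n f = 0"
  unfolding V_Y_def by (rule vop_0[OF vector_space_group_scale])

lemma V_Y_sum: "V_Y k (sum g A) n f = (\<Sum>x\<in>A. V_Y k (g x) n f)"
  by (induction A rule: infinite_finite_induct) (simp_all add: V_Y_add)

text \<open>Turns the products of \<alpha>(-1)1 with v in the Jacobi identity into the explicit
  Heisenberg action on Fock space.\<close>

lemma V_Y_cur: "V_Y k (V_cur k \<alpha>) n v = V_mode k \<alpha> n v"
proof -
  have delta: "vop_exp k group_scale (V_zero_mode k) (\<lambda>\<beta> w. Poly_Mapping.single \<beta> 1 * w) 0 0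
      = (\<lambda>p w. if p = 0 then w else 0)"
    by (intro ext vop_exp_0[OF vector_space_group_scale]) simp
  have "V_Y k (Poly_Mapping.single {#(b, 0)#} (Poly_Mapping.single 0 (\<alpha> $ b))) n v
      = V_scale (\<alpha> $ b) (V_mode k (basis_vec b) n v)" for b
    unfolding V_Y_def vop_single[OF vector_space_group_scale] some_mset_single vop_word_def
    by (simp add: delta normal_mult_delta fun_eq_iff flip: V_scale_def)
  then show ?thesis
    by (simp add: V_cur_expand V_Y_sum V_mode_index_expand[of k \<alpha>])
qed

text \<open>E^+ fixes e^(\<alpha>+\<beta>), which contains no oscillators, and z^\<alpha> is trivial
  on V, so only E^- remains. As E^- has no negative powers of z, the products with n >= 0
  vanish.\<close>

lemma V_Y_exp_exp:
  "V_Y k (V_exp \<alpha>) n (V_exp \<beta>) = E_minus V_scale (V_mode k) (- lat \<alpha>) (- n - 1) (V_exp (\<alpha> + \<beta>))"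
proof -
  have map: "Poly_Mapping.map ((*) (Poly_Mapping.single \<alpha> 1)) (V_exp \<beta>) = V_exp (\<alpha> + \<beta>)"
    by (simp add: V_exp_def mult_single)
  have "V_Y k (V_exp \<alpha>) n (V_exp \<beta>) = E_minus (pm_scale group_scale) (V_mode k) (- lat \<alpha>) (- n - 1 - 0)
      (Poly_Mapping.map ((*) (Poly_Mapping.single \<alpha> 1)) (V_exp \<beta>))"
    unfolding V_Y_def vop_V_exp[OF vector_space_group_scale]
    by (rule vop_exp_constant[OF vector_space_group_scale])
      (simp_all add: map V_mode_exp_pos)
  then show ?thesis by (simp add: map V_scale_def)
qed

lemma V_Y_exp_exp_nonneg: "n \<ge> 0 \<Longrightarrow> V_Y k (V_exp \<alpha>) n (V_exp \<beta>) = 0"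
  unfolding V_Y_exp_exp by (rule E_minus_neg) auto

lemma V_Y_exp_exp_minus1: "V_Y k (V_exp \<alpha>) (- 1) (V_exp \<beta>) = V_exp (\<alpha> + \<beta>)"
  unfolding V_Y_exp_exp by (simp add: E_minus_0)

text \<open>The linear term of E^-(-\<alpha>, z), in which two signs cancel. In conformal notation
  this is L(-1)e^\<alpha> = \<alpha>(-1)e^\<alpha>.\<close>

lemma V_Y_exp_vac_minus2: "V_Y k (V_exp \<alpha>) (- 2) V_vac = V_mode k (lat \<alpha>) (- 1) (V_exp \<alpha>)"
proof -
  have "V_Y k (V_exp \<alpha>) (- 2) V_vac = V_scale (- 1) (V_mode k (- lat \<alpha>) (- 1) (V_exp \<alpha>))"
    unfolding V_vac_def V_Y_exp_exp by (simp add: E_minus_1)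
  then show ?thesis
    using fock_mode_index_uminus[OF vector_space_group_scale, of "- 1" k "V_zero_mode k" "lat \<alpha>" "V_exp \<alpha>"]
    by (simp add: V_scale_def)
qed

lemma V_single_word:
  "Poly_Mapping.single (mset xs) (Poly_Mapping.single \<beta> 1)
     = foldr (\<lambda>(b, j). V_mode k (basis_vec b) (- int j - 1)) xs (V_exp \<beta>)"
proof (induction xs)
  case Nil
  then show ?case by (simp add: V_exp_def)
next
  case (Cons x xs)
  then show ?case
    by (cases x) (simp add: fock_mode_basis_neg[OF vector_space_group_scale] flip: Cons.IH)
qed

text \<open>V is spanned by creation operators applied to the e^\<beta>, so a claim about all Y(v,
  z) reduces to exponentials and to the passage from v to b(-j-1)v.\<close>

lemma V_induct [case_names zero add scale exp mode]:
  assumes "P 0" "\<And>u v. P u \<Longrightarrow> P v \<Longrightarrow> P (u + v)" "\<And>c v. P v \<Longrightarrow> P (V_scale c v)"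
    and "\<And>\<beta>. P (V_exp \<beta>)" "\<And>b j v. P v \<Longrightarrow> P (V_mode k (basis_vec b) (- int j - 1) v)"
  shows "P (v :: 'n::finite VC)"
proof (induction v rule: pm_induct)
  case (single M w)
  then show ?case
  proof (induction w rule: pm_induct)
    case (single \<beta> c)
    obtain xs where M: "M = mset xs" by (metis ex_mset)
    have "P (foldr (\<lambda>(b, j). V_mode k (basis_vec b) (- int j - 1)) xs (V_exp \<beta>))"
      by (induction xs) (auto intro: assms)
    then have "P (V_scale c (Poly_Mapping.single M (Poly_Mapping.single \<beta> 1)))"
      unfolding M by (auto intro: assms simp: V_single_word[of xs \<beta> k])
    then show ?case by (simp add: V_scale_single)
  qed (simp_all add: assms single_add)
qed (simp_all add: assms)


section \<open>Consequences of the Jacobi identity\<close>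

lemma Sum_any_reindex:
  assumes "inj f" "\<And>q. q \<notin> range f \<Longrightarrow> g q = 0"
  shows "Sum_any g = Sum_any (\<lambda>i. g (f i))"
proof -
  have "{q. g q \<noteq> 0} = f ` {i. g (f i) \<noteq> 0}"
    using assms(2) by (auto simp: image_iff) (metis rangeE)
  then show ?thesis
    using assms(1) by (simp add: Sum_any.expand_set sum.reindex inj_on_subset[of f UNIV])
qed

section \<open>Binomial coefficients with a negative upper index\<close>

lemma gbinomial_0_left: "(0 gchoose i) = (if i = 0 then 1 else 0 :: complex)"
  by (cases i) auto

lemma gbinomial_neg_Suc:
  "((- 1) ^ i * (of_int (- int j - 1) gchoose i) :: complex) = of_nat ((i + j) choose i)"
proof -
  have "(of_int (- int j - 1) gchoose i :: complex) = (- 1) ^ i * (of_nat (i + j) gchoose i)"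
    by (subst gbinomial_negated_upper) (simp add: algebra_simps)
  moreover have "((- 1) ^ i * (- 1) ^ i :: complex) = 1"
    by (simp flip: power_mult_distrib)
  ultimately show ?thesis
    by (simp add: binomial_gbinomial mult.assoc[symmetric] del: of_nat_add)
qed

lemma gbinomial_neg_int:
  "(of_int (- int i - 1) gchoose j :: complex) = (- 1) ^ j * of_nat ((i + j) choose i)"
proof -
  have "(of_int (- int i - 1) gchoose j :: complex) = (- 1) ^ j * (of_nat (i + j) gchoose j)"
    by (subst gbinomial_negated_upper) (simp add: algebra_simps)
  then show ?thesis
    using binomial_symmetric[of i "i + j"] by (simp add: binomial_gbinomial del: of_nat_add)
qed

lemma (in complex_vector_space) divided_deriv_eq:
  "divided_deriv scale j F p w = scale (of_int (p + int j) gchoose j) (F (p + int j) w)"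
proof -
  have "(sderiv scale ^^ j) F p w = scale (pochhammer (of_int p + 1) j) (F (p + int j) w)" for p
  proof (induction j arbitrary: p)
    case (Suc j)
    have "(sderiv scale ^^ Suc j) F p w = scale (of_int (p + 1)) ((sderiv scale ^^ j) F (p + 1) w)"
      by (simp add: sderiv_def)
    then show ?case
      by (simp add: Suc.IH pochhammer_rec add_ac)
  qed simp
  then show ?thesis
    by (simp add: divided_deriv_def gbinomial_pochhammer')
qed

lemma V_cur_scale: "V_cur k (c *s \<alpha>) = V_scale c (V_cur k \<alpha>)"
proof -
  interpret VS: vector_space "V_scale :: _ \<Rightarrow> 'a VC \<Rightarrow> _" by (rule vector_space_V_scale)
  show ?thesis by (simp add: V_cur_expand VS.scale_sum_right V_scale_single)
qed

locale V_mod =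
  fixes k :: int and sc :: "complex \<Rightarrow> 'm::ab_group_add \<Rightarrow> 'm"
    and Y :: "'n::finite VC \<Rightarrow> int \<Rightarrow> 'm \<Rightarrow> 'm"
  assumes k_nonzero: "k \<noteq> 0" and V_module: "V_module k sc Y"
begin

sublocale complex_vector_space sc
  using V_module unfolding V_module_def complex_vector_space_def by blast

abbreviation H :: "'n hsp \<Rightarrow> int \<Rightarrow> 'm \<Rightarrow> 'm" where "H \<equiv> heis k Y"
abbreviation e :: "'n latC \<Rightarrow> int \<Rightarrow> 'm \<Rightarrow> 'm" where "e \<beta> \<equiv> Y (V_exp \<beta>)"

lemma Y_linear: "Vector_Spaces.linear sc sc (Y u n)"
  using V_module unfolding V_module_def by blast

lemma Y_linear_left: "Vector_Spaces.linear V_scale sc (\<lambda>u. Y u n w)"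
  using V_module unfolding V_module_def by blast

lemmas Y_simps = lin_simps[OF Y_linear] lin_simps[OF Y_linear_left]

lemma H_linear: "Vector_Spaces.linear sc sc (H \<alpha> n)"
  unfolding heis_def by (rule Y_linear)

lemmas H_simps = lin_simps[OF H_linear]

lemma truncation: "\<exists>N. \<forall>n\<ge>N. Y u n w = 0"
  using V_module unfolding V_module_def by blast

lemma Y_vac: "Y V_vac n w = (if n = - 1 then w else 0)"
  using V_module unfolding V_module_def by blast

lemma jacobi:
  "Sum_any (\<lambda>i::nat. sc ((- 1) ^ i * (of_int l gchoose i))
                            (Y u (m + l - int i) (Y v (n + int i) w)))
   - Sum_any (\<lambda>i::nat. sc ((- 1) powi l * (- 1) ^ i * (of_int l gchoose i))
                            (Y v (n + l - int i) (Y u (m + int i) w)))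
   = Sum_any (\<lambda>i::nat. sc (of_int m gchoose i)
                            (Y (V_Y k u (l + int i) v) (m + n - int i) w))"
  using V_module unfolding V_module_def by blast

text \<open>For l = 0 the binomials leave only the term i = 0 in both sums on the left of the Jacobi
  identity.\<close>

lemma commutator:
  "Y u m (Y v n w) - Y v n (Y u m w)
   = Sum_any (\<lambda>i::nat. sc (of_int m gchoose i) (Y (V_Y k u (int i) v) (m + n - int i) w))"
proof -
  have "Sum_any (\<lambda>i::nat. sc ((- 1) ^ i * (of_int 0 gchoose i)) (Y u (m + 0 - int i) (Y v (n + int i) w)))
      = Y u m (Y v n w)"
    by (subst Sum_any_single[of 0]) (auto simp: gbinomial_0_left)
  moreover have "Sum_any (\<lambda>i::nat. sc ((- 1) powi 0 * (- 1) ^ i * (of_int 0 gchoose i))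
        (Y v (n + 0 - int i) (Y u (m + int i) w))) = Y v n (Y u m w)"
    by (subst Sum_any_single[of 0]) (auto simp: gbinomial_0_left)
  ultimately show ?thesis
    using jacobi[of 0 u m v n w] by simp
qed

text \<open>For m = 0 only the term i = 0 survives on the right of the Jacobi identity, which
  isolates the operator of a product.\<close>

lemma iterate:
  "Y (V_Y k u l v) n w
   = Sum_any (\<lambda>i::nat. sc ((- 1) ^ i * (of_int l gchoose i)) (Y u (l - int i) (Y v (n + int i) w)))
   - Sum_any (\<lambda>i::nat. sc ((- 1) powi l * (- 1) ^ i * (of_int l gchoose i))
                            (Y v (n + l - int i) (Y u (int i) w)))"
proof -
  have "Sum_any (\<lambda>i::nat. sc (of_int 0 gchoose i) (Y (V_Y k u (l + int i) v) (0 + n - int i) w))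
      = Y (V_Y k u l v) n w"
    by (subst Sum_any_single[of 0]) (auto simp: gbinomial_0_left)
  then show ?thesis
    using jacobi[of l u 0 v n w] by simp
qed

section \<open>Commutators and products of the generating fields\<close>

lemma H_commutator:
  "H \<alpha> m (H \<beta> n w) = H \<beta> n (H \<alpha> m w) + sc (if m + n = 0 then of_int m * form k \<alpha> \<beta> else 0) w"
proof -
  \<comment> \<open>Of the products \<alpha>(i)\<beta>(-1)1 with i >= 0 only i = 1 can be nonzero,
    namely (\<alpha>, \<beta>)1; the vacuum mode m + n - 1 is the identity exactly if m + n =
    0.\<close>
  have "Sum_any (\<lambda>i::nat. sc (of_int m gchoose i)
        (Y (V_Y k (V_cur k \<alpha>) (int i) (V_cur k \<beta>)) (m + n - int i) w))
      = sc (of_int m gchoose 1) (Y (V_Y k (V_cur k \<alpha>) (int 1) (V_cur k \<beta>)) (m + n - int 1) w)"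
  proof (rule Sum_any_single)
    fix i :: nat assume "i \<noteq> 1"
    then have "V_Y k (V_cur k \<alpha>) (int i) (V_cur k \<beta>) = 0"
      by (cases "i = 0") (auto simp: V_Y_cur V_mode_cur_0 V_mode_cur_pos)
    then show "sc (of_int m gchoose i)
        (Y (V_Y k (V_cur k \<alpha>) (int i) (V_cur k \<beta>)) (m + n - int i) w) = 0"
      by (simp add: Y_simps)
  qed
  also have "\<dots> = sc (if m + n = 0 then of_int m * form k \<alpha> \<beta> else 0) w"
    by (simp add: V_Y_cur V_mode_cur_pos Y_simps Y_vac)
  finally show ?thesis
    using commutator[of "V_cur k \<alpha>" m "V_cur k \<beta>" n w] by (simp add: heis_def algebra_simps)
qed

lemma H_commute: "m + n \<noteq> 0 \<Longrightarrow> H \<alpha> m (H \<beta> n w) = H \<beta> n (H \<alpha> m w)"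
  by (simp add: H_commutator[of \<alpha> m])

lemma H_0_Y: "H \<alpha> 0 (Y v n w) = Y v n (H \<alpha> 0 w) + Y (V_mode k \<alpha> 0 v) n w"
proof -
  have "Sum_any (\<lambda>i::nat. sc (of_int 0 gchoose i) (Y (V_Y k (V_cur k \<alpha>) (int i) v) (0 + n - int i) w))
      = Y (V_mode k \<alpha> 0 v) n w"
    by (subst Sum_any_single[of 0]) (auto simp: gbinomial_0_left V_Y_cur)
  then show ?thesis
    using commutator[of "V_cur k \<alpha>" 0 v n w] by (simp add: heis_def algebra_simps)
qed

lemma H_e: "H \<alpha> m (e \<beta> n w) = e \<beta> n (H \<alpha> m w) + sc (form k \<alpha> (lat \<beta>)) (e \<beta> (m + n) w)"
proof -
  have "Sum_any (\<lambda>i::nat. sc (of_int m gchoose i)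
        (Y (V_Y k (V_cur k \<alpha>) (int i) (V_exp \<beta>)) (m + n - int i) w))
      = sc (form k \<alpha> (lat \<beta>)) (e \<beta> (m + n) w)"
    by (subst Sum_any_single[of 0]) (auto simp: V_Y_cur V_mode_exp_pos V_mode_exp_0 Y_simps)
  then show ?thesis
    using commutator[of "V_cur k \<alpha>" m "V_exp \<beta>" n w] by (simp add: heis_def algebra_simps)
qed

lemma e_commute: "e \<alpha> m (e \<beta> n w) = e \<beta> n (e \<alpha> m w)"
  using commutator[of "V_exp \<alpha>" m "V_exp \<beta>" n w] by (simp add: V_Y_exp_exp_nonneg Y_simps)

lemma e_0: "e 0 n w = (if n = - 1 then w else 0)"
  using Y_vac by (simp add: V_vac_def)

text \<open>As e^(\<alpha>+\<beta>) is the product of e^\<alpha> and e^\<beta> at index -1, the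
  iterate formula at l = -1 gives a normally ordered product; there (-1)^i binom(-1, i) = 1.\<close>

lemma e_add:
  "e (\<alpha> + \<beta>) n w = Sum_any (\<lambda>i. e \<alpha> (- 1 - int i) (e \<beta> (n + int i) w))
     + Sum_any (\<lambda>i. e \<beta> (n - 1 - int i) (e \<alpha> (int i) w))"
proof -
  have *: "((- 1) ^ i * (- 1 gchoose i) :: complex) = 1" for i
    using gbinomial_neg_Suc[of i 0] by simp
  have "e (\<alpha> + \<beta>) n w = Sum_any (\<lambda>i. e \<alpha> (- 1 - int i) (e \<beta> (n + int i) w))
     - Sum_any (\<lambda>i. - e \<beta> (n - 1 - int i) (e \<alpha> (int i) w))"
    using iterate[of "V_exp \<alpha>" "- 1" "V_exp \<beta>" n w]
    by (simp add: V_Y_exp_exp_minus1 * mult.assoc)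
  also have "Sum_any (\<lambda>i. - e \<beta> (n - 1 - int i) (e \<alpha> (int i) w))
      = - Sum_any (\<lambda>i. e \<beta> (n - 1 - int i) (e \<alpha> (int i) w))"
    by (simp add: Sum_any.expand_set sum_negf)
  finally show ?thesis by simp
qed

text \<open>\<alpha>(-j-1)v is the product of \<alpha>(-1)1 and v at index -j-1, and the iterate
  formula there is normal ordering with a divided derivative. Hence the operators on any module obey
  the recursion that defines those on Fock space.\<close>

lemma Y_V_mode_neg:
  "Y (V_mode k \<alpha> (- int j - 1) v) (- p - 1) w = normal_mult sc H \<alpha> j (\<lambda>p. Y v (- p - 1)) p w"
proof -
  let ?l = "- int j - 1"
  let ?X = "\<lambda>p. Y v (- p - 1)"
  \<comment> \<open>The divided derivative of the creation part has only nonnegative powers z^q: for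
    -j <= q < 0 the binomial coefficient vanishes.\<close>
  have binom0: "(of_int (q + int j) gchoose j :: complex) = 0" if "q < 0" "q + int j \<ge> 0" for q
  proof -
    have "(of_int (q + int j) gchoose j :: complex) = of_nat (nat (q + int j) choose j)"
      using that by (simp add: binomial_gbinomial)
    moreover have "nat (q + int j) < j" using that by linarith
    ultimately show ?thesis by simp
  qed
  have "(divided_deriv sc j (cur_part H {..<0} \<alpha>) \<star> ?X) p w
      = Sum_any (\<lambda>i. divided_deriv sc j (cur_part H {..<0} \<alpha>) (int i) (?X (p - int i) w))"
    unfolding sprod_def
  proof (rule Sum_any_reindex)
    fix q assume "q \<notin> range int"
    then have q: "q < 0" by (metis nonneg_int_cases not_less rangeI)
    then show "divided_deriv sc j (cur_part H {..<0} \<alpha>) q (?X (p - q) w) = 0"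
      using binom0[OF q] by (cases "q + int j \<ge> 0") (auto simp: divided_deriv_eq cur_part_def)
  qed simp
  also have "\<dots> = Sum_any (\<lambda>i. sc ((- 1) ^ i * (of_int ?l gchoose i)) (H \<alpha> (?l - int i) (Y v (- p - 1 + int i) w)))"
  proof (rule Sum_any.cong)
    fix i
    have "(of_int (int i + int j) gchoose j :: complex) = of_nat ((i + j) choose i)"
      using binomial_symmetric[of i "i + j"] by (simp add: binomial_gbinomial)
    moreover have idx: "- (int i + int j) - 1 = ?l - int i" "- (p - int i) - 1 = - p - 1 + int i"
      by simp_all
    ultimately show "divided_deriv sc j (cur_part H {..<0} \<alpha>) (int i) (?X (p - int i) w)
        = sc ((- 1) ^ i * (of_int ?l gchoose i)) (H \<alpha> (?l - int i) (Y v (- p - 1 + int i) w))"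
      unfolding gbinomial_neg_Suc divided_deriv_eq cur_part_def idx by simp
  qed
  finally have A: "(divided_deriv sc j (cur_part H {..<0} \<alpha>) \<star> ?X) p w = \<dots>" .
  \<comment> \<open>\<alpha>(i) with i >= 0 sits at z^(-i-1) in the current and at z^(-i-1-j) after
    the derivative; this is the offset in the reindexing.\<close>
  have "(?X \<star> divided_deriv sc j (cur_part H {0..} \<alpha>)) p w
      = Sum_any (\<lambda>i. ?X (p + int i + int j + 1) (divided_deriv sc j (cur_part H {0..} \<alpha>) (p - (p + int i + int j + 1)) w))"
    unfolding sprod_def
  proof (rule Sum_any_reindex)
    fix q assume "q \<notin> range (\<lambda>i. p + int i + int j + 1)"
    then have "q \<noteq> p + int (nat (q - p - int j - 1)) + int j + 1" by blast
    then have "q < p + int j + 1" by linarith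
    then show "?X q (divided_deriv sc j (cur_part H {0..} \<alpha>) (p - q) w) = 0"
      by (simp add: divided_deriv_eq cur_part_def Y_simps)
  qed (simp add: inj_def)
  also have "\<dots> = Sum_any (\<lambda>i. - sc ((- 1) powi ?l * (- 1) ^ i * (of_int ?l gchoose i))
                            (Y v (- p - 1 + ?l - int i) (H \<alpha> (int i) w)))"
  proof (rule Sum_any.cong)
    fix i
    have r: "p - (p + int i + int j + 1) + int j = - int i - 1" by simp
    have "((- 1) powi ?l :: complex) = - ((- 1) ^ j)"
      by (auto simp: power_int_def nat_add_distrib minus_one_power_iff)
    then have "((- 1) powi ?l * ((- 1) ^ i * (of_int ?l gchoose i)) :: complex)
        = - (of_int (- int i - 1) gchoose j)"
      using binomial_symmetric[of i "i + j"]
      unfolding gbinomial_neg_Suc gbinomial_neg_int by (simp add: add.commute)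
    then show "?X (p + int i + int j + 1) (divided_deriv sc j (cur_part H {0..} \<alpha>) (p - (p + int i + int j + 1)) w)
        = - sc ((- 1) powi ?l * (- 1) ^ i * (of_int ?l gchoose i))
                            (Y v (- p - 1 + ?l - int i) (H \<alpha> (int i) w))"
      unfolding divided_deriv_eq cur_part_def r mult.assoc
      by (simp add: Y_simps algebra_simps)
  qed
  also have "\<dots> = - Sum_any (\<lambda>i. sc ((- 1) powi ?l * (- 1) ^ i * (of_int ?l gchoose i))
                            (Y v (- p - 1 + ?l - int i) (H \<alpha> (int i) w)))"
    by (simp add: Sum_any.expand_set sum_negf)
  finally show ?thesis
    unfolding normal_mult_def A
    using iterate[of "V_cur k \<alpha>" ?l v "- p - 1" w] by (simp add: V_Y_cur heis_def)
qed

text \<open>The \<open>L(-1)\<close>-derivative property, where \<open>u\<^sub>-\<^sub>2\<one>\<close> plays the role of \<open>L(-1)u\<close>.\<close>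

lemma Y_derivative: "Y (V_Y k u (- 2) V_vac) n w = sc (- of_int n) (Y u (n - 1) w)"
proof -
  have c: "((- 1) ^ i * (of_int (- 2) gchoose i) :: complex) = of_nat (i + 1)" for i
    using gbinomial_neg_Suc[of i 1] by simp
  have s: "((- 1) powi (- 2) :: complex) = 1" by (simp add: power_int_def)
  \<comment> \<open>Y(1, z) = 1 leaves at most one term: i = -1 - n here if n < 0, and i = n - 1 in
    the other sum if n > 0; for n = 0 both sums vanish.\<close>
  have "Sum_any (\<lambda>i. sc ((- 1) ^ i * (of_int (- 2) gchoose i)) (Y u (- 2 - int i) (Y V_vac (n + int i) w)))
      = (if n < 0 then sc (- of_int n) (Y u (n - 1) w) else 0)"
  proof (cases "n < 0")
    case True
    then show ?thesis unfolding c
      by (subst Sum_any_single[of "nat (- 1 - n)"]) (auto simp: Y_vac Y_simps)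
  qed (simp add: Y_vac Y_simps)
  moreover have "Sum_any (\<lambda>i. sc ((- 1) powi (- 2) * (- 1) ^ i * (of_int (- 2) gchoose i))
          (Y V_vac (n + (- 2) - int i) (Y u (int i) w)))
      = (if n > 0 then sc (of_int n) (Y u (n - 1) w) else 0)"
  proof (cases "n > 0")
    case True
    then show ?thesis unfolding s mult_1_left c
      by (subst Sum_any_single[of "nat (n - 1)"]) (auto simp: Y_vac)
  qed (auto simp: Y_vac intro!: Sum_any.neutral)
  ultimately show ?thesis
    using iterate[of u "- 2" V_vac n w] by (cases n "0 :: int" rule: linorder_cases) auto
qed

text \<open>The coefficient of z^(p-1) in d/dz Y(e^\<beta>, z) = :\<beta>(z) Y(e^\<beta>, z):, found
  by computing the operator of \<beta>(-1)e^\<beta> in two ways: by \<open>Y_derivative\<close> and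
  by the iterate formula.\<close>

lemma e_derivative:
  "sc (of_int p) (e \<beta> (- p - 1) w)
   = Sum_any (\<lambda>i. H (lat \<beta>) (- 1 - int i) (e \<beta> (- p + int i) w))
     + Sum_any (\<lambda>i. e \<beta> (- p - 1 - int i) (H (lat \<beta>) (int i) w))"
proof -
  have *: "((- 1) ^ i * (- 1 gchoose i) :: complex) = 1" for i
    using gbinomial_neg_Suc[of i 0] by simp
  have "sc (of_int p) (e \<beta> (- p - 1) w) = Y (V_Y k (V_cur k (lat \<beta>)) (- 1) (V_exp \<beta>)) (- p) w"
    using Y_derivative[of "V_exp \<beta>" "- p" w] by (simp add: V_Y_exp_vac_minus2 V_Y_cur)
  also have "\<dots> = Sum_any (\<lambda>i. H (lat \<beta>) (- 1 - int i) (e \<beta> (- p + int i) w))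
     - Sum_any (\<lambda>i. - e \<beta> (- p - 1 - int i) (H (lat \<beta>) (int i) w))"
    using iterate[of "V_cur k (lat \<beta>)" "- 1" "V_exp \<beta>" "- p" w]
    by (simp add: * mult.assoc heis_def)
  also have "Sum_any (\<lambda>i. - e \<beta> (- p - 1 - int i) (H (lat \<beta>) (int i) w))
      = - Sum_any (\<lambda>i. e \<beta> (- p - 1 - int i) (H (lat \<beta>) (int i) w))"
    by (simp add: Sum_any.expand_set sum_negf)
  finally show ?thesis by simp
qed

lemma H_index_expand: "H \<alpha> n w = (\<Sum>b\<in>UNIV. sc (\<alpha> $ b) (H (basis_vec b) n w))"
proof -
  have "V_cur k \<alpha> = (\<Sum>b\<in>UNIV. V_scale (\<alpha> $ b) (V_cur k (basis_vec b)))"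
    unfolding V_cur_def by (rule V_mode_index_expand)
  then show ?thesis
    by (simp add: heis_def Y_simps)
qed

lemma H_index_scale: "H (c *s \<alpha>) n w = sc c (H \<alpha> n w)"
  by (simp add: heis_def V_cur_scale Y_simps)

lemma H_index_uminus: "H (- \<alpha>) n w = - H \<alpha> n w"
  by (simp add: hsp_uminus H_index_scale)

end


section \<open>The vacuum space\<close>

lemma (in module) subspace_Sum_any:
  assumes "subspace U" "\<And>x. g x \<in> U"
  shows "Sum_any g \<in> U"
  using assms by (auto simp: Sum_any.expand_set intro: subspace_sum)

lemma (in exp_rec) E_closed:
  assumes U: "subspace U" and X: "\<And>q w. w \<in> U \<Longrightarrow> X q w \<in> U" and w: "w \<in> U"
  shows "E n w \<in> U"
proof (induction n rule: less_induct)
  case (less n)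
  show ?case
  proof (cases "n = 0")
    case False
    have "scale (of_nat n) (E n w) \<in> U"
      unfolding rec using False by (intro subspace_sum[OF U] subspace_scale[OF U] X less) auto
    then have "scale (1 / of_nat n) (scale (of_nat n) (E n w)) \<in> U"
      by (rule subspace_scale[OF U])
    then show ?thesis using False by simp
  qed (simp add: E0 w)
qed

text \<open>The integer \<open>(\<alpha>, \<lambda>)\<close> for \<open>\<lambda> \<in> (1/k) L\<^sub>D\<close>; for other weights the value is meaningless.\<close>

definition weight :: "int \<Rightarrow> 'n::finite latC \<Rightarrow> 'n hsp \<Rightarrow> int" where
  "weight k \<alpha> lam = \<lfloor>Re (form k (lat \<alpha>) lam)\<rfloor>"

text \<open>For \<lambda> with coordinates m_i / k along the d_i, the factor k of the form cancels
  and leaves the integer sum of the \<alpha>_i m_i.\<close>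

lemma dual_D_pairing:
  assumes "k \<noteq> 0" "lam \<in> dual_D k"
  shows "of_int (weight k \<alpha> lam) = form k (lat \<alpha>) lam"
proof -
  obtain m where lam: "lam = (\<Sum>i\<in>UNIV. (of_int (m i) / of_int k) *s basis_vec (Inr i))"
    using assms(2) by (auto simp: dual_D_def)
  have "lam $ Inr i = of_int (m i) / of_int k" "lam $ Inl i = 0" for i
    by (simp_all add: lam basis_vec_def axis_def if_distrib sum.delta' cong: if_cong)
  then have "form k (lat \<alpha>) lam = of_int (\<Sum>i\<in>UNIV. \<alpha> $ i * m i)"
    using assms(1) by (simp add: form_def sum_distrib_left)
  then show ?thesis by (simp only: weight_def complex_Re_of_int floor_of_int)
qed

context V_mod
begin

abbreviation Em :: "'n hsp \<Rightarrow> int \<Rightarrow> 'm \<Rightarrow> 'm" where "Em \<equiv> E_minus sc H"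
abbreviation Ep :: "'n hsp \<Rightarrow> int \<Rightarrow> 'm \<Rightarrow> 'm" where "Ep \<equiv> E_plus sc H"

section \<open>The half exponentials on M and their commutators\<close>

lemma Em_rec: "exp_rec sc (minus_arg sc H \<gamma>) (\<lambda>n. Em \<gamma> (int n))"
  by (rule exp_rec_minus) (simp_all add: H_linear H_commute)

lemma Ep_rec: "exp_rec sc (plus_arg sc H \<gamma>) (\<lambda>n. Ep \<gamma> (- int n))"
  by (rule exp_rec_plus) (simp_all add: H_linear H_commute)

lemma Em_neg: "p < 0 \<Longrightarrow> Em \<gamma> p w = 0"
  by (rule E_minus_neg) (simp_all add: H_simps)

lemma Ep_pos: "p > 0 \<Longrightarrow> Ep \<gamma> p w = 0"
  by (rule E_plus_pos) (simp_all add: H_simps)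

lemma Em_0 [simp]: "Em \<gamma> 0 w = w"
  by (rule E_minus_0) (simp_all add: H_simps)

lemma Em_linear: "Vector_Spaces.linear sc sc (Em \<gamma> p)"
proof (cases "p < 0")
  case True
  then have "Em \<gamma> p = (\<lambda>w. 0)" by (simp add: Em_neg fun_eq_iff)
  then show ?thesis
    by unfold_locales (auto simp: scale_right_distrib scale_left_distrib)
next
  case False
  then show ?thesis using exp_rec.E_lin[OF Em_rec, of \<gamma> "nat p"] by simp
qed

lemma Ep_linear: "Vector_Spaces.linear sc sc (Ep \<gamma> p)"
proof (cases "p > 0")
  case True
  then have "Ep \<gamma> p = (\<lambda>w. 0)" by (simp add: Ep_pos fun_eq_iff)
  then show ?thesis
    by unfold_locales (auto simp: scale_right_distrib scale_left_distrib)
next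
  case False
  then show ?thesis using exp_rec.E_lin[OF Ep_rec, of \<gamma> "nat (- p)"] by simp
qed

lemma scale_minus_arg: "sc (of_nat q) (minus_arg sc H \<gamma> q w) = (if q = 0 then 0 else - H \<gamma> (- int q) w)"
  by (simp add: minus_arg_def)

lemma Em_H_nonpos:
  assumes "m \<le> 0"
  shows "H \<alpha> m (Em \<gamma> p w) = Em \<gamma> p (H \<alpha> m w)"
proof (cases "p < 0")
  case True
  then show ?thesis by (simp add: Em_neg H_simps)
next
  case False
  have "H \<alpha> m (minus_arg sc H \<gamma> q w) = minus_arg sc H \<gamma> q (H \<alpha> m w)" for q w
    using assms by (auto simp: minus_arg_def H_simps H_commute[of m "- int q"])
  then show ?thesis
    using exp_rec.E_commute[OF Em_rec H_linear, where n = "nat p"] False by fastforce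
qed

text \<open>Among the commutators of \<alpha>(m) with the coefficients -\<gamma>(-q)/q of the
  exponent only q = m contributes, with value -(\<alpha>, \<gamma>); \<open>E_commutator\<close>
  exponentiates this. \<open>Ep_H_neg\<close> is the mirror image.\<close>

lemma Em_H_pos:
  assumes "m \<ge> 1"
  shows "H \<alpha> (int m) (Em \<gamma> (int n) w) = Em \<gamma> (int n) (H \<alpha> (int m) w)
     - (if m \<le> n then sc (form k \<alpha> \<gamma>) (Em \<gamma> (int (n - m)) w) else 0)"
proof -
  have "H \<alpha> (int m) (minus_arg sc H \<gamma> q w)
      = minus_arg sc H \<gamma> q (H \<alpha> (int m) w) + (if q = m then sc (- form k \<alpha> \<gamma>) w else 0)" for q w
    using assms H_commutator[of \<alpha> "int m" \<gamma> "- int q" w]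
    by (cases "q = m") (auto simp: minus_arg_def H_simps scale_right_distrib)
  from exp_rec.E_commutator[OF Em_rec H_linear this assms, of n w] show ?thesis
    by auto
qed

lemma Ep_H_neg:
  assumes "m \<ge> 1"
  shows "H \<alpha> (- int m) (Ep \<gamma> (- int n) w) = Ep \<gamma> (- int n) (H \<alpha> (- int m) w)
     - (if m \<le> n then sc (form k \<alpha> \<gamma>) (Ep \<gamma> (- int (n - m)) w) else 0)"
proof -
  have "H \<alpha> (- int m) (plus_arg sc H \<gamma> q w)
      = plus_arg sc H \<gamma> q (H \<alpha> (- int m) w) + (if q = m then sc (- form k \<alpha> \<gamma>) w else 0)" for q w
    using assms H_commutator[of \<alpha> "- int m" \<gamma> "int q" w]
    by (cases "q = m") (auto simp: plus_arg_def H_simps scale_right_distrib scale_right_diff_distrib)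
  from exp_rec.E_commutator[OF Ep_rec H_linear this assms, of n w] show ?thesis
    by auto
qed

abbreviation \<Omega> :: "'m set" where "\<Omega> \<equiv> Omega k Y"
abbreviation \<Omega>\<^sub>w :: "'n hsp \<Rightarrow> 'm set" where "\<Omega>\<^sub>w \<equiv> Omega_wt k sc Y"

lemma Omega_H: "w \<in> \<Omega> \<Longrightarrow> n > 0 \<Longrightarrow> H \<alpha> n w = 0"
  by (simp add: Omega_def)

lemma subspace_Omega: "subspace \<Omega>"
  by (rule subspaceI) (auto simp: Omega_def H_simps)

lemma subspace_Omega_wt: "subspace (\<Omega>\<^sub>w lam)"
  unfolding Omega_wt_def
  using subspace_Omega
  by (intro subspaceI)
    (auto simp: H_simps scale_right_distrib subspace_0 subspace_add subspace_scale scale_left_commute)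

lemma Ep_Omega: "w \<in> \<Omega> \<Longrightarrow> Ep \<gamma> p w = (if p = 0 then w else 0)"
  by (rule E_plus_killed) (simp_all add: H_simps Omega_H)

text \<open>The coefficient of \<open>z\<^sup>p\<close> in \<open>Y(e\<^sup>\<beta>, z)\<close>:\<close>

definition ec :: "'n latC \<Rightarrow> int \<Rightarrow> 'm \<Rightarrow> 'm" where
  "ec \<beta> p = e \<beta> (- p - 1)"

lemma e_ec: "e \<beta> n = ec \<beta> (- n - 1)"
  by (simp add: ec_def)

lemma ec_linear: "Vector_Spaces.linear sc sc (ec \<beta> p)"
  unfolding ec_def by (rule Y_linear)

lemma H_ec: "H \<alpha> m (ec \<beta> p w) = ec \<beta> p (H \<alpha> m w) + sc (form k \<alpha> (lat \<beta>)) (ec \<beta> (p - m) w)"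
  by (simp add: ec_def H_e algebra_simps)

lemma ec_commute: "ec \<alpha> p (ec \<beta> q w) = ec \<beta> q (ec \<alpha> p w)"
  by (simp add: ec_def e_commute)

lemma truncation_below: "\<exists>P. \<forall>p<P. ec \<beta> p w = 0"
proof -
  obtain N where "\<forall>n\<ge>N. e \<beta> n w = 0" using truncation by blast
  then have "\<forall>p< - N. ec \<beta> p w = 0" by (simp add: ec_def)
  then show ?thesis by blast
qed


subsection \<open>The submodule generated by the vacuum space\<close>

text \<open>The sum is a coefficient of \<open>Z(\<beta>, z) w\<close>.\<close>

lemma Z_coefficient_in_Omega:
  assumes w: "w \<in> \<Omega>" and P: "\<And>p. p < P \<Longrightarrow> ec \<beta> p w = 0"
  shows "(\<Sum>q\<le>n. Em (lat \<beta>) (int q) (ec \<beta> (P + int (n - q)) w)) \<in> \<Omega>"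
proof -
  define y where "y p = ec \<beta> p w" for p
  have Py: "y p = 0" if "p < P" for p using that by (simp add: y_def P)
  have Hy: "H \<alpha> (int m) (y p) = sc (form k \<alpha> (lat \<beta>)) (y (p - int m))" if "m \<ge> 1" for \<alpha> m p
    using that by (simp add: y_def H_ec Omega_H[OF w] lin_simps[OF ec_linear])
  have "H \<alpha> (int m) (\<Sum>q\<le>n. Em (lat \<beta>) (int q) (y (P + int (n - q)))) = 0" if m: "m \<ge> 1" for \<alpha> m
  proof -
    \<comment> \<open>\<alpha>(m) picks up (\<alpha>, \<beta>) z^m from Y(e^\<beta>, z) and
      -(\<alpha>, \<beta>) z^m from E^-(\<beta>, z); after an index shift by m the two sums
      cancel.\<close>
    let ?c = "form k \<alpha> (lat \<beta>)"
    have "H \<alpha> (int m) (\<Sum>q\<le>n. Em (lat \<beta>) (int q) (y (P + int (n - q))))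
        = (\<Sum>q\<le>n. sc ?c (Em (lat \<beta>) (int q) (y (P + int (n - q) - int m))))
          - (\<Sum>q\<le>n. if m \<le> q then sc ?c (Em (lat \<beta>) (int (q - m)) (y (P + int (n - q)))) else 0)"
      by (simp add: H_simps Em_H_pos[OF m] Hy[OF m] lin_simps[OF Em_linear] sum_subtractf
          del: of_nat_diff)
    also have "(\<Sum>q\<le>n. sc ?c (Em (lat \<beta>) (int q) (y (P + int (n - q) - int m))))
        = (\<Sum>q \<in> {q. q + m \<le> n}. sc ?c (Em (lat \<beta>) (int q) (y (P + int (n - q) - int m))))"
    proof (rule sum.mono_neutral_right)
      show "\<forall>i\<in>{..n} - {q. q + m \<le> n}. sc ?c (Em (lat \<beta>) (int i) (y (P + int (n - i) - int m))) = 0"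
        by (auto simp: Py lin_simps[OF Em_linear])
    qed auto
    also have "\<dots> = (\<Sum>q \<in> {m..n}. sc ?c (Em (lat \<beta>) (int (q - m)) (y (P + int (n - q)))))"
      by (rule sum.reindex_bij_witness[where i = "\<lambda>q. q - m" and j = "\<lambda>q. q + m"])
        (auto simp: of_nat_diff algebra_simps)
    also have "\<dots> = (\<Sum>q\<le>n. if m \<le> q then sc ?c (Em (lat \<beta>) (int (q - m)) (y (P + int (n - q)))) else 0)"
      by (rule sum.mono_neutral_cong_left) auto
    finally show ?thesis by simp
  qed
  note killed = this
  have "H \<alpha> m (\<Sum>q\<le>n. Em (lat \<beta>) (int q) (y (P + int (n - q)))) = 0" if "m > 0" for \<alpha> m
    using that killed[of "nat m" \<alpha>] by simp
  then show ?thesis by (simp add: Omega_def y_def)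
qed

abbreviation Mbar :: "'m set" where "Mbar \<equiv> M_bar k sc Y"

lemma subspace_Mbar: "subspace Mbar"
  unfolding M_bar_def by (rule subspace_Inter) auto

lemma Omega_subset_Mbar: "\<Omega> \<subseteq> Mbar"
  unfolding M_bar_def by auto

lemma H_Mbar: "w \<in> Mbar \<Longrightarrow> H \<alpha> n w \<in> Mbar"
  unfolding M_bar_def by auto

lemma Mbar_minimal:
  "subspace U \<Longrightarrow> \<Omega> \<subseteq> U \<Longrightarrow> (\<And>\<alpha> n w. w \<in> U \<Longrightarrow> H \<alpha> n w \<in> U) \<Longrightarrow> Mbar \<subseteq> U"
  unfolding M_bar_def by auto

lemma Em_Mbar: "w \<in> Mbar \<Longrightarrow> Em \<gamma> (int n) w \<in> Mbar"
  by (rule exp_rec.E_closed[OF Em_rec subspace_Mbar])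
    (auto simp: minus_arg_def subspace_0[OF subspace_Mbar] intro!: subspace_neg[OF subspace_Mbar]
      subspace_scale[OF subspace_Mbar] H_Mbar)

text \<open>E^-(\<beta>, z) starts with 1, so a coefficient of Y(e^\<beta>, z)w is one of Z(\<beta>,
  z)w, which lies in \<open>\<Omega>\<close>, minus images under E^- of lower coefficients. The
  induction starts at the truncation bound.\<close>

lemma e_Omega_Mbar:
  assumes w: "w \<in> \<Omega>"
  shows "e \<beta> n w \<in> Mbar"
proof -
  obtain P where P: "\<And>p. p < P \<Longrightarrow> ec \<beta> p w = 0" using truncation_below by blast
  have above: "ec \<beta> (P + int n) w \<in> Mbar" for n
  proof (induction n rule: less_induct)
    case (less n)
    have eq: "(\<Sum>q\<le>n. Em (lat \<beta>) (int q) (ec \<beta> (P + int (n - q)) w))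
        = ec \<beta> (P + int n) w + (\<Sum>q=1..n. Em (lat \<beta>) (int q) (ec \<beta> (P + int (n - q)) w))"
      by (simp add: atMost_atLeast0 sum.atLeast_Suc_atMost)
    have "(\<Sum>q\<le>n. Em (lat \<beta>) (int q) (ec \<beta> (P + int (n - q)) w)) \<in> Mbar"
      using Z_coefficient_in_Omega[where P = P, OF w P] Omega_subset_Mbar by blast
    moreover have "(\<Sum>q=1..n. Em (lat \<beta>) (int q) (ec \<beta> (P + int (n - q)) w)) \<in> Mbar"
      using less by (intro subspace_sum[OF subspace_Mbar] Em_Mbar) (auto simp del: of_nat_diff)
    ultimately show ?case
      using subspace_diff[OF subspace_Mbar] unfolding eq by fastforce
  qed
  have "ec \<beta> p w \<in> Mbar" for p
  proof (cases "p < P")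
    case True
    then show ?thesis by (simp add: P subspace_0[OF subspace_Mbar])
  next
    case False
    then show ?thesis using above[of "nat (p - P)"] by simp
  qed
  then show ?thesis by (simp add: e_ec)
qed

text \<open>By the commutator with \<alpha>(m), the vectors that the modes of e^\<beta> keep inside
  \<open>Mbar\<close> form a subspace stable under the Heisenberg algebra, and it contains
  \<open>\<Omega>\<close>.\<close>

lemma e_Mbar:
  assumes "w \<in> Mbar"
  shows "e \<beta> n w \<in> Mbar"
proof -
  note S = subspace_Mbar
  let ?U = "{w \<in> Mbar. \<forall>n. e \<beta> n w \<in> Mbar}"
  have "Mbar \<subseteq> ?U"
  proof (rule Mbar_minimal)
    show "subspace ?U"
      by (rule subspaceI)
        (auto simp: Y_simps subspace_0[OF S] intro: subspace_add[OF S] subspace_scale[OF S])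
    show "\<Omega> \<subseteq> ?U"
      using Omega_subset_Mbar e_Omega_Mbar by auto
    show "H \<alpha> m w \<in> ?U" if "w \<in> ?U" for \<alpha> m w
    proof -
      have "e \<beta> n (H \<alpha> m w) = H \<alpha> m (e \<beta> n w) - sc (form k \<alpha> (lat \<beta>)) (e \<beta> (m + n) w)" for n
        by (simp add: H_e)
      then show ?thesis
        using that by (auto intro: H_Mbar subspace_diff[OF S] subspace_scale[OF S])
    qed
  qed
  then show ?thesis using assms by auto
qed

lemma Y_Mbar: "w \<in> Mbar \<Longrightarrow> Y v n w \<in> Mbar"
proof (induction v arbitrary: n w rule: V_induct[where k = k])
  case (mode b j v)
  note S = subspace_Mbar
  have "Y (V_Y k (V_cur k (basis_vec b)) (- int j - 1) v) n w \<in> Mbar"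
    unfolding iterate heis_def[where Y = Y, symmetric]
    by (intro subspace_diff[OF S] subspace_Sum_any[OF S] subspace_scale[OF S] H_Mbar mode)
  then show ?case by (simp add: V_Y_cur)
qed (auto simp: Y_simps e_Mbar subspace_0[OF subspace_Mbar]
  intro: subspace_add[OF subspace_Mbar] subspace_scale[OF subspace_Mbar])

theorem V_submodule_Mbar: "V_submodule sc Y Mbar"
  by (simp add: V_submodule_def subspace_Mbar Y_Mbar)


lemma Z_op_Omega:
  assumes "w \<in> \<Omega>"
  shows "Z_op k sc Y \<beta> p w = Sum_any (\<lambda>q. Em (lat \<beta>) q (ec \<beta> (p - q) w))"
proof -
  have "((\<lambda>p. Y (V_exp \<beta>) (- p - 1)) \<star> Ep (lat \<beta>)) q w = ec \<beta> q w" for q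
    unfolding sprod_def
    by (subst Sum_any_single[of q]) (auto simp: Ep_Omega[OF assms] Y_simps ec_def)
  then show ?thesis
    unfolding Z_op_def sprod_def[of "Em (lat \<beta>)"] by simp
qed


subsection \<open>The operators \<open>T\<^sub>\<alpha>\<close> on a weight space\<close>

lemma Omega_wt_Omega: "w \<in> \<Omega>\<^sub>w lam \<Longrightarrow> w \<in> \<Omega>"
  by (simp add: Omega_wt_def)

context
  fixes lam :: "'n hsp" and w :: 'm
  assumes lam: "lam \<in> dual_D k" and w: "w \<in> \<Omega>\<^sub>w lam"
begin

lemma H_0_wt: "H (lat \<beta>) 0 w = sc (of_int (weight k \<beta> lam)) w"
  using w by (simp add: Omega_wt_def dual_D_pairing[OF k_nonzero lam])

text \<open>On w the annihilation half of \<beta>(z) reduces to \<beta>(0), which is the scalar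
  (\<beta>, \<lambda>); in \<open>e_derivative\<close> it is moved to the left.\<close>

lemma ec_wt_rec:
  "sc (of_int (p - weight k \<beta> lam)) (ec \<beta> p w)
   = Sum_any (\<lambda>i. H (lat \<beta>) (- 1 - int i) (ec \<beta> (p - 1 - int i) w))"
proof -
  have "Sum_any (\<lambda>i. e \<beta> (- p - 1 - int i) (H (lat \<beta>) (int i) w))
      = sc (of_int (weight k \<beta> lam)) (ec \<beta> p w)"
    by (subst Sum_any_single[of 0])
      (auto simp: Omega_H[OF Omega_wt_Omega[OF w]] H_0_wt Y_simps ec_def)
  moreover have "e \<beta> (- p + int i) = ec \<beta> (p - 1 - int i)" for i
    by (simp add: ec_def algebra_simps)
  ultimately show ?thesis
    using e_derivative[of p \<beta> w] by (simp add: scale_left_diff_distrib ec_def[of \<beta> p])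
qed

text \<open>Induction upwards from the truncation bound: the right side of \<open>ec_wt_rec\<close>
  involves lower coefficients only, and the factor p - (\<beta>, \<lambda>) is nonzero.\<close>

lemma ec_below_wt:
  assumes "p < weight k \<beta> lam"
  shows "ec \<beta> p w = 0"
proof -
  let ?N = "weight k \<beta> lam"
  obtain P where P: "\<And>p. p < P \<Longrightarrow> ec \<beta> p w = 0" using truncation_below by blast
  have "ec \<beta> (P + int n) w = 0" if "P + int n < ?N" for n
    using that
  proof (induction n rule: less_induct)
    case (less n)
    have "ec \<beta> (P + int n - 1 - int i) w = 0" for i
    proof (cases "P + int n - 1 - int i < P")
      case False
      then have "P + int n - 1 - int i = P + int (n - 1 - i)" "n - 1 - i < n" by auto
      then show ?thesis using less by (metis add_less_cancel_left of_nat_less_iff order_less_trans)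
    qed (rule P)
    then have "sc (of_int (P + int n - ?N)) (ec \<beta> (P + int n) w) = 0"
      unfolding ec_wt_rec by (simp add: H_simps)
    moreover have "(of_int (P + int n - ?N) :: complex) \<noteq> 0"
      using less.prems unfolding of_int_eq_0_iff by simp
    ultimately show ?case unfolding scale_eq_0_iff by blast
  qed
  from this[of "nat (p - P)"] P[of p] assms show ?thesis by (cases "p < P") auto
qed

lemma ec_wt_rec_nat:
  "sc (of_nat n) (ec \<beta> (weight k \<beta> lam + int n) w)
   = (\<Sum>q=1..n. H (lat \<beta>) (- int q) (ec \<beta> (weight k \<beta> lam + int (n - q)) w))"
proof -
  let ?N = "weight k \<beta> lam"
  let ?g = "\<lambda>i. H (lat \<beta>) (- 1 - int i) (ec \<beta> (?N + int n - 1 - int i) w)"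
  have "sc (of_nat n) (ec \<beta> (?N + int n) w) = Sum_any ?g"
    using ec_wt_rec[of "?N + int n" \<beta>] by simp
  also have "\<dots> = sum ?g {..<n}"
    by (rule Sum_any_eq_sum) (auto simp: ec_below_wt H_simps)
  also have "\<dots> = (\<Sum>q=1..n. H (lat \<beta>) (- int q) (ec \<beta> (?N + int (n - q)) w))"
    by (rule sum.reindex_bij_witness[where i = "\<lambda>q. q - 1" and j = Suc])
      (auto simp: of_nat_diff algebra_simps)
  finally show ?thesis .
qed

text \<open>For E^-(-\<beta>, z) one has q X_q = \<beta>(-q), so \<open>ec_wt_rec_nat\<close> is the
  recursion of that exponential, with the lowest coefficient as initial value.\<close>

lemma ec_above_wt:
  "ec \<beta> (weight k \<beta> lam + int n) w = Em (- lat \<beta>) (int n) (ec \<beta> (weight k \<beta> lam) w)"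
proof -
  let ?y = "\<lambda>n. ec \<beta> (weight k \<beta> lam + int n) w"
  have "sc (of_nat n) (?y n) = (\<Sum>q=1..n. sc (of_nat q) (minus_arg sc H (- lat \<beta>) q (?y (n - q))))" for n
    unfolding ec_wt_rec_nat
    by (intro sum.cong refl) (auto simp: scale_minus_arg H_index_uminus)
  from exp_rec.solution_unique[where y = ?y, OF Em_rec this] show ?thesis by simp
qed

text \<open>In terms of the exponent of E^-(\<beta>, z) the recursion has the opposite sign, so
  multiplying by this exponential leaves only the lowest term.\<close>

lemma Z_wt:
  assumes "n > 0"
  shows "(\<Sum>q\<le>n. Em (lat \<beta>) (int q) (ec \<beta> (weight k \<beta> lam + int (n - q)) w)) = 0"
proof (rule exp_rec.inverse_solution[OF Em_rec])
  fix n
  show "sc (of_nat n) (ec \<beta> (weight k \<beta> lam + int n) w)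
      = - (\<Sum>q=1..n. sc (of_nat q) (minus_arg sc H (lat \<beta>) q (ec \<beta> (weight k \<beta> lam + int (n - q)) w)))"
    unfolding ec_wt_rec_nat sum_negf[symmetric]
    by (intro sum.cong refl) (auto simp: scale_minus_arg)
qed (auto simp: minus_arg_def H_simps H_commute assms)

text \<open>The source of the independence of T_\<beta> from z: Z(\<beta>, z)w is a single monomial
  in z.\<close>

lemma Z_op_wt:
  "Z_op k sc Y \<beta> p w = (if p = weight k \<beta> lam then ec \<beta> p w else 0)"
proof -
  let ?N = "weight k \<beta> lam"
  let ?y = "\<lambda>p. ec \<beta> p w"
  have Z: "Z_op k sc Y \<beta> p w = Sum_any (\<lambda>q. Em (lat \<beta>) q (?y (p - q)))"
    by (rule Z_op_Omega[OF Omega_wt_Omega[OF w]])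
  have outside: "Em (lat \<beta>) q (?y (p - q)) = 0" if "q < 0 \<or> p - q < ?N" for q
    using that by (auto simp: Em_neg ec_below_wt lin_simps[OF Em_linear])
  consider "p < ?N" | "p = ?N" | "p > ?N" by linarith
  then show ?thesis
  proof cases
    case 1
    have "Em (lat \<beta>) q (?y (p - q)) = 0" for q
      using 1 by (intro outside) auto
    then show ?thesis using 1 by (simp add: Z)
  next
    case 2
    have "Sum_any (\<lambda>q. Em (lat \<beta>) q (?y (p - q))) = Em (lat \<beta>) 0 (?y (p - 0))"
      using 2 by (intro Sum_any_single outside) auto
    then show ?thesis using 2 Z by simp
  next
    case 3
    define n where "n = nat (p - ?N)"
    have p: "p = ?N + int n" "n > 0" using 3 by (auto simp: n_def)
    have "Sum_any (\<lambda>q. Em (lat \<beta>) q (?y (p - q))) = (\<Sum>q\<in>int ` {..n}. Em (lat \<beta>) q (?y (p - q)))"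
    proof (rule Sum_any_eq_sum)
      fix q assume "q \<notin> int ` {..n}"
      then have "q < 0 \<or> int n < q"
        by (metis atMost_iff image_eqI linorder_not_less nonneg_int_cases of_nat_less_iff)
      then show "Em (lat \<beta>) q (?y (p - q)) = 0" using p by (intro outside) auto
    qed simp
    also have "\<dots> = (\<Sum>q\<le>n. Em (lat \<beta>) (int q) (?y (?N + int (n - q))))"
      by (subst sum.reindex) (auto simp: p(1) of_nat_diff algebra_simps intro!: sum.cong)
    finally show ?thesis using 3 Z_wt[OF p(2)] by (simp add: Z)
  qed
qed

text \<open>\<alpha>(n) with n > 0 produces a multiple of a coefficient below the lowest one, and
  \<alpha>(0) for \<alpha> in \<open>L\<^sub>C\<close> commutes with Y(e^\<beta>, z) as
  \<open>L\<^sub>C\<close> is isotropic.\<close>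

lemma T_wt_in: "ec \<beta> (weight k \<beta> lam) w \<in> \<Omega>\<^sub>w lam"
proof -
  let ?N = "weight k \<beta> lam"
  have "H \<alpha> n (ec \<beta> ?N w) = 0" if "n > 0" for \<alpha> n
    using that by (simp add: H_ec Omega_H[OF Omega_wt_Omega[OF w]] lin_simps[OF ec_linear] ec_below_wt)
  moreover have "H (lat \<alpha>) 0 (ec \<beta> ?N w) = sc (form k (lat \<alpha>) lam) (ec \<beta> ?N w)" for \<alpha>
    using w by (simp add: H_ec Omega_wt_def lin_simps[OF ec_linear])
  ultimately show ?thesis by (simp add: Omega_wt_def Omega_def)
qed

lemma H_0_wt_in: "H \<gamma> 0 w \<in> \<Omega>\<^sub>w lam"
proof -
  have "H \<alpha> n (H \<gamma> 0 w) = 0" if "n > 0" for \<alpha> n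
    using that by (simp add: H_commute[of n 0] Omega_H[OF Omega_wt_Omega[OF w]] H_simps)
  moreover have "H (lat \<alpha>) 0 (H \<gamma> 0 w) = sc (form k (lat \<alpha>) lam) (H \<gamma> 0 w)" for \<alpha>
    using w H_commutator[of "lat \<alpha>" 0 \<gamma> 0 w] by (simp add: Omega_wt_def H_simps)
  ultimately show ?thesis by (simp add: Omega_wt_def Omega_def)
qed

text \<open>
  By truncation in both factors, only the product of the two lowest coefficients survives in the
  sums of \<open>e_add\<close>.
\<close>

lemma T_wt_add:
  "ec (\<alpha> + \<beta>) (weight k (\<alpha> + \<beta>) lam) w = ec \<alpha> (weight k \<alpha> lam) (ec \<beta> (weight k \<beta> lam) w)"
proof -
  let ?a = "weight k \<alpha> lam" and ?b = "weight k \<beta> lam"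
  have "(of_int (weight k (\<alpha> + \<beta>) lam) :: complex) = of_int (?a + ?b)"
    by (simp add: dual_D_pairing[OF k_nonzero lam] lat_add form_add_left)
  then have ab: "weight k (\<alpha> + \<beta>) lam = ?a + ?b" by (simp only: of_int_eq_iff)
  \<comment> \<open>The two operators commute, so truncation on w is available for either of
    them.\<close>
  have 1: "ec \<alpha> p (ec \<beta> q w) = 0" if "p < ?a \<or> q < ?b" for p q
    using that
    by (metis ec_below_wt ec_commute lin_zero[OF ec_linear])
  have i: "- (- 1 - int i) - 1 = int i" "- (- (?a + ?b) - 1 + int i) - 1 = ?a + ?b - int i"
    "- (- (?a + ?b) - 1 - 1 - int i) - 1 = ?a + ?b + 1 + int i" for i by simp_all
  have "ec (\<alpha> + \<beta>) (?a + ?b) w = Sum_any (\<lambda>i. ec \<alpha> (int i) (ec \<beta> (?a + ?b - int i) w))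
      + Sum_any (\<lambda>i. ec \<alpha> (- int i - 1) (ec \<beta> (?a + ?b + 1 + int i) w))"
    using e_add[of \<alpha> \<beta> "- (?a + ?b) - 1" w] unfolding e_ec i
    by (simp add: ec_commute[of \<beta>])
  also have "\<dots> = ec \<alpha> ?a (ec \<beta> ?b w)"
  \<comment> \<open>The first sum runs over the exponents i >= 0 of Y(e^\<alpha>, z), the second
    over -i - 1 < 0, so the exponent \<open>?a\<close> occurs in exactly one of them.\<close>
  proof (cases "?a \<ge> 0")
    case True
    have "Sum_any (\<lambda>i. ec \<alpha> (int i) (ec \<beta> (?a + ?b - int i) w))
        = ec \<alpha> (int (nat ?a)) (ec \<beta> (?a + ?b - int (nat ?a)) w)"
    proof (rule Sum_any_single)
      fix i assume "i \<noteq> nat ?a"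
      then have "int i < ?a \<or> ?a + ?b - int i < ?b" using True by linarith
      then show "ec \<alpha> (int i) (ec \<beta> (?a + ?b - int i) w) = 0" by (rule 1)
    qed
    moreover have "Sum_any (\<lambda>i. ec \<alpha> (- int i - 1) (ec \<beta> (?a + ?b + 1 + int i) w)) = 0"
      using True by (simp add: 1)
    ultimately show ?thesis using True by simp
  next
    case False
    have "Sum_any (\<lambda>i. ec \<alpha> (- int i - 1) (ec \<beta> (?a + ?b + 1 + int i) w))
        = ec \<alpha> (- int (nat (- ?a - 1)) - 1) (ec \<beta> (?a + ?b + 1 + int (nat (- ?a - 1))) w)"
    proof (rule Sum_any_single)
      fix i assume "i \<noteq> nat (- ?a - 1)"
      then have "- int i - 1 < ?a \<or> ?a + ?b + 1 + int i < ?b" using False by linarith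
      then show "ec \<alpha> (- int i - 1) (ec \<beta> (?a + ?b + 1 + int i) w) = 0" by (rule 1)
    qed
    moreover have "Sum_any (\<lambda>i. ec \<alpha> (int i) (ec \<beta> (?a + ?b - int i) w)) = 0"
      using False by (simp add: 1)
    ultimately show ?thesis using False by simp
  qed
  finally show ?thesis by (simp add: ab)
qed

end

end


section \<open>The action of \<open>A\<close>\<close>

lemma axis_int_mult: "of_int (axis i (1 :: int) $ j) * c = (if j = i then c else 0 :: complex)"
  by (simp add: axis_def)

text \<open>Pairing with c_i recovers k times the coordinate along d_i.\<close>

lemma dual_D_separated:
  fixes lam \<mu> :: "'n::finite hsp"
  assumes "k \<noteq> 0" "lam \<in> dual_D k" "\<mu> \<in> dual_D k" "lam \<noteq> \<mu>"
  shows "\<exists>\<alpha>. form k (lat \<alpha>) lam \<noteq> form k (lat \<alpha>) \<mu>"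
proof -
  have Inl: "v $ Inl i = 0" if "v \<in> dual_D k" for v :: "'n hsp" and i
    using that by (auto simp: dual_D_def basis_vec_def axis_def)
  obtain b where "lam $ b \<noteq> \<mu> $ b" using assms(4) by (auto simp: vec_eq_iff)
  then obtain i where i: "lam $ Inr i \<noteq> \<mu> $ Inr i" using Inl assms(2,3) by (cases b) auto
  have "form k (lat (axis i 1)) v = of_int k * v $ Inr i" if "v \<in> dual_D k" for v
    by (simp add: form_def axis_int_mult)
  then have "form k (lat (axis i 1)) lam \<noteq> form k (lat (axis i 1)) \<mu>"
    using i assms by simp
  then show ?thesis by blast
qed

section \<open>The quotient algebra \<open>A\<close>\<close>

lemma ring_free_ring: "ring (free_ring :: 'n::finite free_alg ring)"
proof (rule ringI)
  show "abelian_group (free_ring :: 'n free_alg ring)"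
    by (rule abelian_groupI) (auto simp: free_ring_def add.assoc add.commute intro: exI[of _ "- _"])
  show "Group.monoid (free_ring :: 'n free_alg ring)"
    by (rule monoidI) (auto simp: free_ring_def mult.assoc)
qed (auto simp: free_ring_def distrib_left distrib_right)

lemma ideal_A_ideal: "ideal (A_ideal k) (free_ring :: 'n::finite free_alg ring)"
  unfolding A_ideal_def by (rule ring.genideal_ideal[OF ring_free_ring]) (simp add: free_ring_def)

lemma A_class_eqD:
  fixes x y :: "'n::finite free_alg"
  assumes "A_class k x = A_class k y"
  shows "x - y \<in> A_ideal k"
proof -
  have A_class: "A_class k z = (\<lambda>h. h + z) ` A_ideal k" for z :: "'n free_alg"
    by (auto simp: A_class_def a_r_coset_def' free_ring_def)
  have "0 \<in> A_ideal k"
    using additive_subgroup.zero_closed[OF ideal.axioms(1)[OF ideal_A_ideal]] by (simp add: free_ring_def)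
  then have "x \<in> A_class k x" unfolding A_class by force
  then obtain h where "h \<in> A_ideal k" "x = h + y" unfolding assms unfolding A_class by blast
  then show ?thesis by simp
qed

lemma carrier_A_alg: "carrier (A_alg k) = range (A_class k)"
  by (auto simp: A_alg_def FactRing_def A_RCOSETS_def' A_class_def free_ring_def)

lemma A_alg_add: "A_class k x \<oplus>\<^bsub>A_alg k\<^esub> A_class k y = A_class k (x + y)"
  using abelian_subgroup.a_rcos_sum[OF abelian_subgroupI3[OF ideal.axioms(1)[OF ideal_A_ideal]
    ring.is_abelian_group[OF ring_free_ring]], of x y]
  by (simp add: A_alg_def FactRing_def A_class_def free_ring_def)

lemma A_alg_mult: "A_class k x \<otimes>\<^bsub>A_alg k\<^esub> A_class k y = A_class k (x * y)"
  using ideal.rcoset_mult_add[OF ideal_A_ideal, of x y]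
  by (simp add: A_alg_def FactRing_def A_class_def free_ring_def)

lemma A_alg_one: "\<one>\<^bsub>A_alg k\<^esub> = A_class k 1"
  by (simp add: A_alg_def FactRing_def A_class_def free_ring_def)

context V_mod
begin

subsection \<open>Weight decompositions\<close>

abbreviation \<Omega>' :: "'m set" where "\<Omega>' \<equiv> Omega' k sc Y"

text \<open>Applying \<alpha>(0) - (\<alpha>, \<nu>) removes the component of weight \<nu> and
  multiplies that of weight \<lambda> by a factor which is nonzero for a separating
  \<alpha>.\<close>

lemma weight_vectors_independent:
  assumes "finite S" "S \<subseteq> dual_D k" "\<And>lam. lam \<in> S \<Longrightarrow> h lam \<in> \<Omega>\<^sub>w lam" "sum h S = 0" "\<mu> \<in> S"
  shows "h \<mu> = 0"
  using assms
proof (induction S arbitrary: h \<mu> rule: finite_induct)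
  case (insert \<nu> S)
  have zero: "h lam = 0" if lam: "lam \<in> S" for lam
  proof -
    have "lam \<noteq> \<nu>" "lam \<in> dual_D k" "\<nu> \<in> dual_D k" using lam insert by auto
    then obtain \<alpha> where \<alpha>: "form k (lat \<alpha>) lam \<noteq> form k (lat \<alpha>) \<nu>"
      using dual_D_separated[OF k_nonzero] by blast
    define g where "g \<mu> = sc (form k (lat \<alpha>) \<mu> - form k (lat \<alpha>) \<nu>) (h \<mu>)" for \<mu>
    have H: "H (lat \<alpha>) 0 (h \<mu>) = sc (form k (lat \<alpha>) \<mu>) (h \<mu>)" if "\<mu> \<in> insert \<nu> S" for \<mu>
      using insert.prems(2)[OF that] by (simp add: Omega_wt_def)
    have "sum g (insert \<nu> S) = H (lat \<alpha>) 0 (sum h (insert \<nu> S)) - sc (form k (lat \<alpha>) \<nu>) (sum h (insert \<nu> S))"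
      unfolding g_def scale_left_diff_distrib sum_subtractf scale_sum_right H_simps(6)
      by (simp only: H cong: sum.cong)
    then have "sum g (insert \<nu> S) = 0"
      using insert.prems(3) by (simp add: H_simps)
    moreover have "g \<nu> = 0" by (simp add: g_def)
    ultimately have "sum g S = 0" using insert.hyps by simp
    moreover have "g \<mu> \<in> \<Omega>\<^sub>w \<mu>" if "\<mu> \<in> S" for \<mu>
      unfolding g_def using insert.prems(2) that subspace_scale[OF subspace_Omega_wt] by blast
    ultimately have "g lam = 0"
      using insert.IH[of g lam] insert.prems lam by blast
    then show ?thesis using \<alpha> by (simp add: g_def)
  qed
  moreover have "h \<nu> = 0"
    using insert.prems(3) insert.hyps zero by simp
  ultimately show ?case using insert.prems by auto
qed simp

text \<open>The weight condition is imposed at every \<lambda>, where \<open>wt_decomp\<close> asks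
  for it on the support; as 0 lies in each weight space this is equivalent, and closure under sums
  becomes immediate.\<close>

definition decomp :: "('n hsp \<Rightarrow>\<^sub>0 'm) set" where
  "decomp = {f. Poly_Mapping.keys f \<subseteq> dual_D k \<and> (\<forall>lam. Poly_Mapping.lookup f lam \<in> \<Omega>\<^sub>w lam)}"

lemma decomp_single: "lam \<in> dual_D k \<Longrightarrow> w \<in> \<Omega>\<^sub>w lam \<Longrightarrow> Poly_Mapping.single lam w \<in> decomp"
  using subspace_0[OF subspace_Omega_wt] by (auto simp: decomp_def lookup_single when_def)

lemma decomp_add: "f \<in> decomp \<Longrightarrow> g \<in> decomp \<Longrightarrow> f + g \<in> decomp"
  using subspace_add[OF subspace_Omega_wt] keys_add[of f g] by (auto simp: decomp_def lookup_add)

lemma decomp_diff: "f \<in> decomp \<Longrightarrow> g \<in> decomp \<Longrightarrow> f - g \<in> decomp"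
  using subspace_diff[OF subspace_Omega_wt] keys_diff[of f g] by (auto simp: decomp_def lookup_minus)

lemma decomp_unique:
  assumes "f \<in> decomp" "g \<in> decomp" "pm_sum (\<lambda>_ x. x) f = pm_sum (\<lambda>_ x. x) g"
  shows "f = g"
proof -
  have "f - g \<in> decomp" using assms decomp_diff by blast
  have "pm_sum (\<lambda>_ x. x) f = pm_sum (\<lambda>_ x. x) ((f - g) + g)" by simp
  also have "\<dots> = pm_sum (\<lambda>_ x. x) (f - g) + pm_sum (\<lambda>_ x. x) g" by (rule pm_sum_add) auto
  finally have sum0: "(\<Sum>lam\<in>Poly_Mapping.keys (f - g). Poly_Mapping.lookup (f - g) lam) = 0"
    using assms by (simp add: pm_sum_def)
  have "Poly_Mapping.lookup (f - g) lam = 0" for lam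
    using weight_vectors_independent[OF finite_keys _ _ sum0, of lam] \<open>f - g \<in> decomp\<close>
    by (cases "lam \<in> Poly_Mapping.keys (f - g)") (auto simp: decomp_def in_keys_iff)
  then show ?thesis by (metis poly_mapping_eqI eq_iff_diff_eq_0 lookup_zero)
qed

lemma wt_decomp_eq:
  assumes "f \<in> decomp" "pm_sum (\<lambda>_ x. x) f = w"
  shows "wt_decomp k sc Y w = f"
proof -
  have *: "Poly_Mapping.keys f \<subseteq> dual_D k \<and>
             (\<forall>lam\<in>Poly_Mapping.keys f. Poly_Mapping.lookup f lam \<in> \<Omega>\<^sub>w lam) \<longleftrightarrow> f \<in> decomp" for f
    using subspace_0[OF subspace_Omega_wt] by (auto simp: decomp_def in_keys_iff)
  show ?thesis
    unfolding wt_decomp_def conj_assoc[symmetric] *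
    by (rule the_equality) (use assms decomp_unique in \<open>auto simp: pm_sum_def\<close>)
qed

lemma Omega'_induct [consumes 1, case_names wt add]:
  assumes "w \<in> \<Omega>'"
    and wt: "\<And>lam w. lam \<in> dual_D k \<Longrightarrow> w \<in> \<Omega>\<^sub>w lam \<Longrightarrow> P w"
    and add: "\<And>v w. v \<in> \<Omega>' \<Longrightarrow> w \<in> \<Omega>' \<Longrightarrow> P v \<Longrightarrow> P w \<Longrightarrow> P (v + w)"
  shows "P w"
proof -
  have "0 \<in> dual_D k" unfolding dual_D_def by (rule CollectI, rule exI[of _ "\<lambda>_. 0"]) simp
  then have "P 0" using wt subspace_0[OF subspace_Omega_wt] by blast
  have "w \<in> \<Omega>' \<and> P w"
    using assms(1) unfolding Omega'_def
  proof (induction w rule: span_induct_alt)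
    case base
    then show ?case using \<open>P 0\<close> span_zero by blast
  next
    case (step c x y)
    then obtain lam where lam: "lam \<in> dual_D k" "x \<in> \<Omega>\<^sub>w lam" by blast
    then have "sc c x \<in> \<Omega>\<^sub>w lam" using subspace_scale[OF subspace_Omega_wt] by blast
    then have "P (sc c x)" "sc c x \<in> \<Omega>'" using lam wt by (auto simp: Omega'_def intro: span_base)
    then show ?case using add[of "sc c x" y] step by (auto simp: Omega'_def intro: span_add)
  qed
  then show ?thesis ..
qed

lemma subspace_Omega': "subspace \<Omega>'"
  by (simp add: Omega'_def)

lemma Omega_wt_Omega': "lam \<in> dual_D k \<Longrightarrow> w \<in> \<Omega>\<^sub>w lam \<Longrightarrow> w \<in> \<Omega>'"
  unfolding Omega'_def by (rule span_base) blast

lemma Omega'_subset_Omega: "\<Omega>' \<subseteq> \<Omega>"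
  unfolding Omega'_def by (rule span_minimal) (auto simp: subspace_Omega Omega_wt_Omega)

lemma Omega'_decomp:
  assumes "w \<in> \<Omega>'"
  shows "wt_decomp k sc Y w \<in> decomp \<and> pm_sum (\<lambda>_ x. x) (wt_decomp k sc Y w) = w"
proof -
  have "\<exists>f\<in>decomp. pm_sum (\<lambda>_ x. x) f = w"
    using assms
  proof (induction w rule: Omega'_induct)
    case (wt lam w)
    then show ?case
      by (intro bexI[of _ "Poly_Mapping.single lam w"] decomp_single pm_sum_single) auto
  next
    case (add v w)
    then obtain f g where "f \<in> decomp" "g \<in> decomp" "pm_sum (\<lambda>_ x. x) f = v" "pm_sum (\<lambda>_ x. x) g = w"
      by blast
    then show ?case
      by (intro bexI[of _ "f + g"]) (auto simp: decomp_add intro!: pm_sum_add)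
  qed
  then show ?thesis using wt_decomp_eq by metis
qed


subsection \<open>The operators \<open>T\<^sub>\<alpha>\<close>\<close>

text \<open>Defined through the lowest coefficients on the weight components;
  \<open>T_series_eq\<close> identifies it with Z(\<alpha>, z) z^(-\<alpha>).\<close>

definition T :: "'n latC \<Rightarrow> 'm \<Rightarrow> 'm" where
  "T \<alpha> w = pm_sum (\<lambda>lam. ec \<alpha> (weight k \<alpha> lam)) (wt_decomp k sc Y w)"

lemma T_wt:
  assumes "lam \<in> dual_D k" "w \<in> \<Omega>\<^sub>w lam"
  shows "T \<alpha> w = ec \<alpha> (weight k \<alpha> lam) w"
proof -
  have "wt_decomp k sc Y w = Poly_Mapping.single lam w"
    using assms by (intro wt_decomp_eq decomp_single pm_sum_single) auto
  then show ?thesis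
    by (simp add: T_def pm_sum_single lin_simps[OF ec_linear])
qed

lemma T_add:
  assumes "v \<in> \<Omega>'" "w \<in> \<Omega>'"
  shows "T \<alpha> (v + w) = T \<alpha> v + T \<alpha> w"
proof -
  have "wt_decomp k sc Y (v + w) = wt_decomp k sc Y v + wt_decomp k sc Y w"
    using Omega'_decomp assms by (intro wt_decomp_eq) (auto simp: decomp_add pm_sum_add)
  then show ?thesis
    unfolding T_def by (simp add: pm_sum_add lin_simps[OF ec_linear])
qed

lemma T_in: "w \<in> \<Omega>' \<Longrightarrow> T \<alpha> w \<in> \<Omega>'"
proof (induction w rule: Omega'_induct)
  case (wt lam w)
  then show ?case using T_wt T_wt_in Omega_wt_Omega' by metis
next
  case (add v w)
  then show ?case by (simp add: T_add subspace_add[OF subspace_Omega'])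
qed

lemma T_scale: "w \<in> \<Omega>' \<Longrightarrow> T \<alpha> (sc c w) = sc c (T \<alpha> w)"
proof (induction w rule: Omega'_induct)
  case (wt lam w)
  then show ?case
    using T_wt[of lam w] T_wt[of lam "sc c w"] subspace_scale[OF subspace_Omega_wt]
    by (simp add: lin_simps[OF ec_linear])
next
  case (add v w)
  then show ?case
    by (simp add: T_add scale_right_distrib subspace_scale[OF subspace_Omega'])
qed

lemma H_0_in: "w \<in> \<Omega>' \<Longrightarrow> H \<gamma> 0 w \<in> \<Omega>'"
proof (induction w rule: Omega'_induct)
  case (wt lam w)
  then show ?case using H_0_wt_in Omega_wt_Omega' by metis
next
  case (add v w)
  then show ?case by (simp add: H_simps subspace_add[OF subspace_Omega'])
qed

lemma T_0: "w \<in> \<Omega>' \<Longrightarrow> T 0 w = w"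
proof (induction w rule: Omega'_induct)
  case (wt lam w)
  then show ?case by (simp add: T_wt weight_def ec_def e_0)
qed (simp add: T_add)

lemma T_plus: "w \<in> \<Omega>' \<Longrightarrow> T (\<alpha> + \<beta>) w = T \<alpha> (T \<beta> w)"
proof (induction w rule: Omega'_induct)
  case (wt lam w)
  then show ?case using T_wt_in[OF wt] by (simp add: T_wt[of lam] T_wt_add)
qed (simp add: T_add T_in)

lemma H_0_T: "w \<in> \<Omega>' \<Longrightarrow> H \<gamma> 0 (T \<beta> w) = T \<beta> (H \<gamma> 0 w) + sc (form k \<gamma> (lat \<beta>)) (T \<beta> w)"
proof (induction w rule: Omega'_induct)
  case (wt lam w)
  then show ?case using H_0_wt_in[OF wt] by (simp add: T_wt[of lam] H_ec)
qed (simp add: T_add H_0_in H_simps scale_right_distrib)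

text \<open>Truncation and the absence of negative powers in E^- leave finitely many nonzero terms,
  which additivity of \<open>Sum_any\<close> requires.\<close>

lemma Z_op_add:
  assumes "v \<in> \<Omega>" "w \<in> \<Omega>"
  shows "Z_op k sc Y \<beta> p (v + w) = Z_op k sc Y \<beta> p v + Z_op k sc Y \<beta> p w"
proof -
  have fin: "finite {q. Em (lat \<beta>) q (ec \<beta> (p - q) w) \<noteq> 0}" for w
  proof -
    obtain P where "\<And>p. p < P \<Longrightarrow> ec \<beta> p w = 0" using truncation_below by blast
    then have "{q. Em (lat \<beta>) q (ec \<beta> (p - q) w) \<noteq> 0} \<subseteq> {0..p - P}"
      by (auto simp: not_less[symmetric] Em_neg lin_simps[OF Em_linear])
    then show ?thesis by (rule finite_subset) simp
  qed
  show ?thesis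
    using assms subspace_add[OF subspace_Omega]
    by (simp add: Z_op_Omega lin_simps[OF ec_linear] lin_simps[OF Em_linear] Sum_any.distrib[OF fin fin])
qed

lemma Z_op_0: "Z_op k sc Y \<beta> p 0 = 0"
  using Z_op_add[of 0 0 \<beta> p] subspace_0[OF subspace_Omega] by simp

lemma Z_op_sum:
  "(\<And>x. x \<in> A \<Longrightarrow> g x \<in> \<Omega>) \<Longrightarrow> Z_op k sc Y \<beta> p (sum g A) = (\<Sum>x\<in>A. Z_op k sc Y \<beta> p (g x))"
  by (induction A rule: infinite_finite_induct)
    (simp_all add: Z_op_0 Z_op_add subspace_sum[OF subspace_Omega])

lemma T_series_eq:
  assumes "w \<in> \<Omega>'"
  shows "T_series k sc Y \<alpha> p w = (if p = 0 then T \<alpha> w else 0)"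
proof -
  let ?f = "wt_decomp k sc Y w"
  let ?K = "Poly_Mapping.keys ?f" and ?l = "Poly_Mapping.lookup ?f" and ?N = "weight k \<alpha>"
  have f: "?f \<in> decomp" using Omega'_decomp[OF assms] by blast
  have K: "lam \<in> dual_D k" "?l lam \<in> \<Omega>\<^sub>w lam" if "lam \<in> ?K" for lam
    using f that by (auto simp: decomp_def)
  have z: "Omega_z_pow k sc Y (- \<alpha>) r w = (\<Sum>lam\<in>?K. if r = - ?N lam then ?l lam else 0)" for r
    unfolding Omega_z_pow_def Let_def
  proof (intro sum.cong refl)
    fix lam assume "lam \<in> ?K"
    then have "of_int r = form k (lat (- \<alpha>)) lam \<longleftrightarrow> (of_int r :: complex) = of_int (- ?N lam)"
      using dual_D_pairing[OF k_nonzero K(1), of lam \<alpha>] by (simp add: lat_uminus)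
    then show "z_pow k lam (- \<alpha>) r (?l lam) = (if r = - ?N lam then ?l lam else 0)"
      unfolding z_pow_def of_int_eq_iff by simp
  qed
  \<comment> \<open>On the component of weight \<lambda>, z^(-\<alpha>) lives at the exponent
    -(\<alpha>, \<lambda>) and Z(\<alpha>, z) at (\<alpha>, \<lambda>), so the product sits at p =
    0.\<close>
  have "Z_op k sc Y \<alpha> q (Omega_z_pow k sc Y (- \<alpha>) (p - q) w)
      = (\<Sum>lam\<in>?K. if p = 0 \<and> q = ?N lam then ec \<alpha> q (?l lam) else 0)" for q
  proof -
    have "Z_op k sc Y \<alpha> q (Omega_z_pow k sc Y (- \<alpha>) (p - q) w)
      = (\<Sum>lam\<in>?K. Z_op k sc Y \<alpha> q (if p - q = - ?N lam then ?l lam else 0))"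
      unfolding z using K(2) Omega_wt_Omega subspace_0[OF subspace_Omega] by (intro Z_op_sum) auto
    also have "\<dots> = (\<Sum>lam\<in>?K. if p = 0 \<and> q = ?N lam then ec \<alpha> q (?l lam) else 0)"
      by (intro sum.cong refl) (auto simp: Z_op_0 Z_op_wt[OF K])
    finally show ?thesis .
  qed
  then have "T_series k sc Y \<alpha> p w
      = Sum_any (\<lambda>q. \<Sum>lam\<in>?K. if p = 0 \<and> q = ?N lam then ec \<alpha> q (?l lam) else 0)"
    by (simp add: T_series_def sprod_def)
  also have "\<dots> = (\<Sum>q\<in>?N ` ?K. \<Sum>lam\<in>?K. if p = 0 \<and> q = ?N lam then ec \<alpha> q (?l lam) else 0)"
    by (rule Sum_any_eq_sum) (auto intro!: sum.neutral)
  also have "\<dots> = (\<Sum>lam\<in>?K. \<Sum>q\<in>?N ` ?K. if p = 0 \<and> q = ?N lam then ec \<alpha> q (?l lam) else 0)"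
    by (rule sum.swap)
  also have "\<dots> = (\<Sum>lam\<in>?K. if p = 0 then ec \<alpha> (?N lam) (?l lam) else 0)"
    by (intro sum.cong refl) auto
  finally show ?thesis by (simp add: T_def pm_sum_def)
qed


subsection \<open>The module structure\<close>

primrec gen_act :: "'n gen \<Rightarrow> 'm \<Rightarrow> 'm" where
  "gen_act (Gen_e \<alpha>) = T \<alpha>"
| "gen_act (Gen_d i) = H (basis_vec (Inr i)) 0"

definition free_act :: "'n free_alg \<Rightarrow> 'm \<Rightarrow> 'm" where
  "free_act x w = pm_sum (\<lambda>u c. sc c (foldr gen_act (letters u) w)) x"

lemma word_act:
  assumes "v \<in> \<Omega>'" "w \<in> \<Omega>'"
  shows "foldr gen_act xs w \<in> \<Omega>'"
    and "foldr gen_act xs (v + w) = foldr gen_act xs v + foldr gen_act xs w"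
    and "foldr gen_act xs (sc c w) = sc c (foldr gen_act xs w)"
proof -
  have g: "gen_act g w \<in> \<Omega>'" "gen_act g (v + w) = gen_act g v + gen_act g w"
      "gen_act g (sc c w) = sc c (gen_act g w)" if "v \<in> \<Omega>'" "w \<in> \<Omega>'" for g v w
    using that by (cases g; simp add: T_in H_0_in T_add T_scale H_simps)+
  have "foldr gen_act xs w \<in> \<Omega>' \<and> foldr gen_act xs v \<in> \<Omega>'
    \<and> foldr gen_act xs (v + w) = foldr gen_act xs v + foldr gen_act xs w
    \<and> foldr gen_act xs (sc c w) = sc c (foldr gen_act xs w)"
    by (induction xs) (use assms g in auto)
  then show "foldr gen_act xs w \<in> \<Omega>'"
    "foldr gen_act xs (v + w) = foldr gen_act xs v + foldr gen_act xs w"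
    "foldr gen_act xs (sc c w) = sc c (foldr gen_act xs w)" by auto
qed

lemma free_act_0 [simp]: "free_act 0 w = 0"
  by (simp add: free_act_def)

lemma free_act_single: "free_act (Poly_Mapping.single u c) w = sc c (foldr gen_act (letters u) w)"
  unfolding free_act_def by (rule pm_sum_single) simp

lemma free_act_add: "free_act (x + y) w = free_act x w + free_act y w"
  unfolding free_act_def by (rule pm_sum_add) (simp_all add: scale_left_distrib)

lemma free_act_diff: "free_act (x - y) w = free_act x w - free_act y w"
  using free_act_add[of "x - y" y w] by simp

lemma free_act_sum: "free_act (sum g A) w = (\<Sum>x\<in>A. free_act (g x) w)"
  by (induction A rule: infinite_finite_induct) (simp_all add: free_act_add)

lemma free_act_in: "w \<in> \<Omega>' \<Longrightarrow> free_act x w \<in> \<Omega>'"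
  unfolding free_act_def pm_sum_def
  by (intro subspace_sum[OF subspace_Omega'] subspace_scale[OF subspace_Omega'] word_act)

lemma free_act_add_right: "v \<in> \<Omega>' \<Longrightarrow> w \<in> \<Omega>' \<Longrightarrow> free_act x (v + w) = free_act x v + free_act x w"
  unfolding free_act_def pm_sum_def sum.distrib[symmetric]
  by (intro sum.cong refl) (simp add: word_act scale_right_distrib)

text \<open>It suffices to treat words, whose product is concatenation; w is taken in
  \<open>\<Omega>'\<close>, on which the letters act linearly.\<close>

lemma free_act_mult:
  assumes w: "w \<in> \<Omega>'"
  shows "free_act (x * y) w = free_act x (free_act y w)"
proof (induction x rule: pm_induct)
  case (single u c)
  show ?case
  proof (induction y rule: pm_induct)
    case zero
    then show ?case using w word_act(3)[of 0 0 "letters u" 0] subspace_0[OF subspace_Omega']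
      by (simp add: free_act_single)
  next
    case (single v d)
    then show ?case
      using w by (simp add: mult_single free_act_single plus_word_def word_act)
  next
    case (add g h)
    then show ?case
      using w by (simp add: distrib_left free_act_add free_act_add_right free_act_in)
  qed
qed (simp_all add: distrib_right free_act_add)

lemma free_act_const: "free_act (free_const a) w = sc a w"
  by (simp add: free_const_def free_act_single zero_word_def)

lemma free_act_1: "free_act 1 w = w"
  using free_act_const[of 1 w] by (simp add: free_const_def)

lemma free_act_e: "free_act (free_e \<alpha>) w = T \<alpha> w"
  by (simp add: free_e_def free_act_single)

lemma free_act_d: "free_act (free_d i) w = H (basis_vec (Inr i)) 0 w"
  by (simp add: free_d_def free_act_single)

text \<open>The annihilator of the stable space \<open>\<Omega>'\<close> is a two-sided ideal of the
  free algebra, and it contains the relators by \<open>T_0\<close>, \<open>T_plus\<close>,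
  \<open>H_0_T\<close> and the commutation of zero modes.\<close>

lemma A_ideal_acts_zero:
  assumes "x \<in> A_ideal k" "w \<in> \<Omega>'"
  shows "free_act x w = 0"
proof -
  let ?K = "{x. \<forall>w\<in>\<Omega>'. free_act x w = 0}"
  have z: "free_act x 0 = 0" for x
    using free_act_add_right[of 0 0 x] subspace_0[OF subspace_Omega'] by simp
  have "ideal ?K free_ring"
  proof (rule idealI[OF ring_free_ring])
    have "inv\<^bsub>add_monoid free_ring\<^esub> x = - x" for x :: "'n free_alg"
      using abelian_group.minus_equality[OF ring.is_abelian_group[OF ring_free_ring], of "- x" x]
      by (simp add: free_ring_def a_inv_def)
    moreover have "free_act (- x) w = - free_act x w" for x w
      using free_act_diff[of 0 x w] by simp
    ultimately show "subgroup ?K (add_monoid free_ring)"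
      by unfold_locales (auto simp: free_ring_def free_act_add)
  qed (auto simp: free_ring_def free_act_mult free_act_in z)
  moreover have "A_relators k \<subseteq> ?K"
  proof
    fix x :: "'n free_alg" assume "x \<in> A_relators k"
    then consider "x = free_e 0 - 1" | \<alpha> \<beta> where "x = free_e (\<alpha> + \<beta>) - free_e \<alpha> * free_e \<beta>"
      | i \<alpha> where "x = free_d i * free_e \<alpha> - free_e \<alpha> * free_d i
          - free_const (form k (basis_vec (Inr i)) (lat \<alpha>)) * free_e \<alpha>"
      | i j where "x = free_d i * free_d j - free_d j * free_d i"
      unfolding A_relators_def by blast
    then show "x \<in> ?K"
    proof cases
      case (4 i j)
      have "H (basis_vec (Inr i)) 0 (H (basis_vec (Inr j)) 0 w)
          = H (basis_vec (Inr j)) 0 (H (basis_vec (Inr i)) 0 w)" for w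
        using H_commutator[of "basis_vec (Inr i)" 0 "basis_vec (Inr j)" 0 w] by simp
      then show ?thesis by (simp add: 4 free_act_diff free_act_mult free_act_d)
    qed (simp_all add: free_act_diff free_act_mult free_act_e free_act_1 free_act_d
          free_act_const T_0 T_plus H_0_T)
  qed
  ultimately have "A_ideal k \<subseteq> ?K"
    unfolding A_ideal_def by (rule ring.genideal_minimal[OF ring_free_ring])
  then show ?thesis using assms by blast
qed

text \<open>A coset acts through a chosen representative; by \<open>A_act_class\<close> every
  representative gives the same action on \<open>\<Omega>'\<close>.\<close>

definition A_act :: "'n free_alg set \<Rightarrow> 'm \<Rightarrow> 'm" where
  "A_act X = free_act (SOME x. X = A_class k x)"

lemma A_act_class:
  assumes "w \<in> \<Omega>'"
  shows "A_act (A_class k x) w = free_act x w"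
proof -
  have "A_class k x = A_class k (SOME y. A_class k x = A_class k y)"
    by (rule someI[of "\<lambda>y. A_class k x = A_class k y" x]) simp
  from A_class_eqD[OF this] show ?thesis
    using A_ideal_acts_zero[OF _ assms] by (fastforce simp: A_act_def free_act_diff)
qed

lemma H_h_D: "\<gamma> \<in> h_D \<Longrightarrow> H \<gamma> n w = (\<Sum>i\<in>UNIV. sc (\<gamma> $ Inr i) (H (basis_vec (Inr i)) n w))"
  by (subst H_index_expand)
    (simp add: UNIV_Plus_UNIV[symmetric] sum.Plus h_D_def del: UNIV_Plus_UNIV)

theorem A_structure: "Omega_A_structure k sc Y A_act"
proof -
  have "A_module k sc \<Omega>' A_act"
    unfolding A_module_def carrier_A_alg
    by (auto simp: A_act_class A_alg_add A_alg_mult A_alg_one A_const_def subspace_Omega' free_act_in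
        free_act_add free_act_add_right free_act_mult free_act_1 free_act_const subspace_add[OF subspace_Omega'])
  moreover have "A_act (A_d k \<gamma>) w = H \<gamma> 0 w" if "\<gamma> \<in> h_D" "w \<in> \<Omega>'" for \<gamma> w
    using that
    by (simp add: A_d_def A_act_class free_act_sum free_act_mult free_act_const free_act_d H_h_D)
  moreover have "T_series k sc Y \<alpha> p w = sconst (A_act (A_e k \<alpha>)) p w" if "w \<in> \<Omega>'" for \<alpha> p w
    using that by (simp add: T_series_eq sconst_def A_e_def A_act_class free_act_e)
  ultimately show ?thesis
    unfolding Omega_A_structure_def by blast
qed

end


section \<open>Transport of series along an injective map\<close>

text \<open>Injectivity on \<open>U\<close> is what lets \<open>\<psi>\<close> pass through
  \<open>Sum_any\<close>: a sum with infinitely many nonzero terms has the value 0, so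
  \<open>\<psi>\<close> has to preserve the set of nonzero terms.\<close>

locale transport =
  fixes sc1 :: "complex \<Rightarrow> 'a::ab_group_add \<Rightarrow> 'a" and sc2 :: "complex \<Rightarrow> 'b::ab_group_add \<Rightarrow> 'b"
    and U :: "'a set" and \<psi> :: "'a \<Rightarrow> 'b"
  assumes U0: "0 \<in> U" and U_add: "\<And>x y. x \<in> U \<Longrightarrow> y \<in> U \<Longrightarrow> x + y \<in> U"
    and U_scale: "\<And>c x. x \<in> U \<Longrightarrow> sc1 c x \<in> U"
    and tr_add: "\<And>x y. x \<in> U \<Longrightarrow> y \<in> U \<Longrightarrow> \<psi> (x + y) = \<psi> x + \<psi> y"
    and tr_scale: "\<And>c x. x \<in> U \<Longrightarrow> \<psi> (sc1 c x) = sc2 c (\<psi> x)"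
    and tr_kernel: "\<And>x. x \<in> U \<Longrightarrow> \<psi> x = 0 \<Longrightarrow> x = 0"
begin

lemma tr_0: "\<psi> 0 = 0"
  using tr_add[of 0 0] U0 by simp

lemma tr_sum: "(\<And>x. x \<in> A \<Longrightarrow> g x \<in> U) \<Longrightarrow> sum g A \<in> U \<and> \<psi> (sum g A) = (\<Sum>x\<in>A. \<psi> (g x))"
  by (induction A rule: infinite_finite_induct) (auto simp: U0 tr_0 U_add tr_add)

lemma tr_Sum_any:
  assumes "\<And>x. g x \<in> U"
  shows "Sum_any g \<in> U \<and> \<psi> (Sum_any g) = Sum_any (\<lambda>x. \<psi> (g x))"
proof -
  have "{x. \<psi> (g x) \<noteq> 0} = {x. g x \<noteq> 0}"
    using tr_kernel[OF assms] tr_0 by metis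
  then show ?thesis
    using tr_sum[of "{x. g x \<noteq> 0}" g] assms by (simp add: Sum_any.expand_set)
qed

definition rel :: "'a series \<Rightarrow> 'b series \<Rightarrow> bool" where
  "rel F G \<longleftrightarrow> (\<forall>p. \<forall>x\<in>U. F p x \<in> U \<and> \<psi> (F p x) = G p (\<psi> x))"

lemma rel_sprod: "rel F G \<Longrightarrow> rel F' G' \<Longrightarrow> rel (F \<star> F') (G \<star> G')"
  unfolding rel_def sprod_def
proof (intro allI ballI)
  fix p x
  assume F: "\<forall>p. \<forall>x\<in>U. F p x \<in> U \<and> \<psi> (F p x) = G p (\<psi> x)"
    "\<forall>p. \<forall>x\<in>U. F' p x \<in> U \<and> \<psi> (F' p x) = G' p (\<psi> x)" and x: "x \<in> U"
  then show "Sum_any (\<lambda>q. F q (F' (p - q) x)) \<in> U \<and>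
      \<psi> (Sum_any (\<lambda>q. F q (F' (p - q) x))) = Sum_any (\<lambda>q. G q (G' (p - q) (\<psi> x)))"
    using tr_Sum_any[of "\<lambda>q. F q (F' (p - q) x)"] by simp
qed

lemma rel_spower: "rel F G \<Longrightarrow> rel (spower F j) (spower G j)"
proof (induction j)
  case 0
  then show ?case by (simp add: rel_def sconst_def U0 tr_0)
qed (simp add: rel_sprod)

lemma rel_sexp:
  assumes "rel F G"
  shows "rel (sexp sc1 F) (sexp sc2 G)"
  unfolding rel_def
proof (intro allI ballI)
  fix p x assume "x \<in> U"
  then have "spower F j p x \<in> U" "\<psi> (spower F j p x) = spower G j p (\<psi> x)" for j
    using rel_spower[OF assms] by (auto simp: rel_def)
  then show "sexp sc1 F p x \<in> U \<and> \<psi> (sexp sc1 F p x) = sexp sc2 G p (\<psi> x)"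
    unfolding sexp_def using tr_Sum_any[of "\<lambda>j. sc1 (1 / fact j) (spower F j p x)"]
    by (simp add: U_scale tr_scale)
qed

lemma rel_sderiv: "rel F G \<Longrightarrow> rel (sderiv sc1 F) (sderiv sc2 G)"
  by (simp add: rel_def sderiv_def U_scale tr_scale)

lemma rel_divided_deriv: "rel F G \<Longrightarrow> rel (divided_deriv sc1 n F) (divided_deriv sc2 n G)"
proof -
  assume "rel F G"
  then have "rel ((sderiv sc1 ^^ n) F) ((sderiv sc2 ^^ n) G)"
    by (induction n) (auto intro: rel_sderiv)
  then show ?thesis
    by (simp add: rel_def divided_deriv_def U_scale tr_scale)
qed

context
  fixes a1 :: "'n::finite hsp \<Rightarrow> int \<Rightarrow> 'a \<Rightarrow> 'a" and a2 :: "'n hsp \<Rightarrow> int \<Rightarrow> 'b \<Rightarrow> 'b"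
  assumes a: "\<And>\<alpha> n x. x \<in> U \<Longrightarrow> a1 \<alpha> n x \<in> U \<and> \<psi> (a1 \<alpha> n x) = a2 \<alpha> n (\<psi> x)"
begin

lemma rel_half_exp: "rel (half_exp sc1 a1 N \<beta>) (half_exp sc2 a2 N \<beta>)"
  unfolding half_exp_def
  by (rule rel_sexp) (auto simp: rel_def U_scale tr_scale a U0 tr_0)

lemma rel_cur_part: "rel (cur_part a1 N \<alpha>) (cur_part a2 N \<alpha>)"
  by (auto simp: rel_def cur_part_def a U0 tr_0)

lemma rel_normal_mult:
  assumes "rel F G"
  shows "rel (normal_mult sc1 a1 \<alpha> n F) (normal_mult sc2 a2 \<alpha> n G)"
proof -
  have "rel (divided_deriv sc1 n (cur_part a1 {..<0} \<alpha>) \<star> F) (divided_deriv sc2 n (cur_part a2 {..<0} \<alpha>) \<star> G)"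
    "rel (F \<star> divided_deriv sc1 n (cur_part a1 {0..} \<alpha>)) (G \<star> divided_deriv sc2 n (cur_part a2 {0..} \<alpha>))"
    by (intro rel_sprod rel_divided_deriv rel_cur_part assms)+
  then show ?thesis
    by (simp add: rel_def normal_mult_def U_add tr_add)
qed

end

end


section \<open>Irreducible modules\<close>

lemma lat_axis: "lat (axis i 1) = basis_vec (Inl i)"
  by (rule lat_eqI) (auto simp: basis_vec_def axis_def)

lemma form_dual_D:
  fixes lam \<alpha> :: "'n::finite hsp"
  assumes "k \<noteq> 0" "lam = (\<Sum>i\<in>UNIV. (of_int (m i) / of_int k) *s basis_vec (Inr i))"
  shows "form k \<alpha> lam = (\<Sum>i\<in>UNIV. \<alpha> $ Inl i * of_int (m i))"
proof -
  have "lam $ Inr i = of_int (m i) / of_int k" "lam $ Inl i = 0" for i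
    by (simp_all add: assms(2) basis_vec_def axis_def if_distrib sum.delta' cong: if_cong)
  then show ?thesis
    using assms(1) by (simp add: form_def sum_distrib_left)
qed

context V_mod
begin

section \<open>The weight of an irreducible module\<close>

lemma V_mode_lat_0: "V_mode k (lat (\<alpha> :: 'n latC)) 0 v = 0"
proof -
  have "V_zero_mode k (lat \<alpha>) w = 0" for w :: "'n latC \<Rightarrow>\<^sub>0 complex"
    by (rule poly_mapping_eqI) (simp add: lookup_V_zero_mode)
  then show ?thesis
    by (simp add: fock_mode_def map_eq_zero_iff)
qed

text \<open>As \<open>L\<^sub>C\<close> is isotropic, \<alpha>(0) kills V, and hence on M it
  commutes with every Y(v, z).\<close>

lemma V_submodule_eigenspace: "V_submodule sc Y {w. H (lat \<alpha>) 0 w = sc c w}"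
proof -
  have "subspace {w. H (lat \<alpha>) 0 w = sc c w}"
    by (rule subspaceI) (auto simp: H_simps scale_right_distrib mult.commute)
  moreover have "H (lat \<alpha>) 0 (Y v n w) = sc c (Y v n w)" if "H (lat \<alpha>) 0 w = sc c w" for v n w
    using that H_0_Y[of "lat \<alpha>" v n w] by (simp add: V_mode_lat_0 Y_simps)
  ultimately show ?thesis
    by (simp add: V_submodule_def)
qed

text \<open>The normally ordered product of the commuting Y(e^\<alpha>, z) and Y(e^(-\<alpha>), z)
  is Y(e^0, z) = 1, so neither annihilates a nonzero vector.\<close>

lemma ec_nonzero:
  assumes "w \<noteq> 0"
  shows "\<exists>p. ec \<alpha> p w \<noteq> 0"
proof (rule ccontr)
  assume "\<nexists>p. ec \<alpha> p w \<noteq> 0"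
  then have "e \<alpha> n w = 0" for n by (simp add: e_ec)
  moreover then have "e \<alpha> m (e (- \<alpha>) n w) = 0" for m n
    by (simp add: e_commute[of \<alpha>] Y_simps)
  ultimately have "e (- \<alpha> + \<alpha>) (- 1) w = 0"
    unfolding e_add by (simp add: Y_simps)
  then show False using assms by (simp add: e_0)
qed

text \<open>At the exponent p of the lowest nonzero coefficient v of Y(e^\<alpha>, z)w, the
  differential equation keeps only its zero mode term and reads p v = \<alpha>(0) v. No weight of w
  is presupposed.\<close>

lemma lowest_ec_eigenvector:
  assumes w: "w \<in> \<Omega>" "w \<noteq> 0"
  shows "\<exists>p v. v \<noteq> 0 \<and> H (lat \<alpha>) 0 v = sc (of_int p) v"
proof -
  obtain P where P: "\<And>p. p < P \<Longrightarrow> ec \<alpha> p w = 0" using truncation_below by blast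
  define n where "n = (LEAST n. ec \<alpha> (P + int n) w \<noteq> 0)"
  obtain q where q: "ec \<alpha> q w \<noteq> 0" using ec_nonzero[OF w(2)] by blast
  then have "\<not> q < P" using P by blast
  then have "ec \<alpha> (P + int (nat (q - P))) w \<noteq> 0" using q by simp
  then have n: "ec \<alpha> (P + int n) w \<noteq> 0"
    unfolding n_def by (rule LeastI)
  have low: "ec \<alpha> p w = 0" if "p < P + int n" for p
  proof (cases "p < P")
    case False
    then have "nat (p - P) < n" using that by auto
    then show ?thesis using not_less_Least[of "nat (p - P)" "\<lambda>n. ec \<alpha> (P + int n) w \<noteq> 0"] False by (auto simp: n_def)
  qed (rule P)
  let ?p = "P + int n"
  have "e \<alpha> (- ?p + int i) w = 0" for i
    using low by (simp add: e_ec)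
  moreover have "Sum_any (\<lambda>i. e \<alpha> (- ?p - 1 - int i) (H (lat \<alpha>) (int i) w)) = ec \<alpha> ?p (H (lat \<alpha>) 0 w)"
    by (subst Sum_any_single[of 0]) (auto simp: Omega_H[OF w(1)] Y_simps ec_def)
  ultimately have "sc (of_int ?p) (ec \<alpha> ?p w) = ec \<alpha> ?p (H (lat \<alpha>) 0 w)"
    using e_derivative[of ?p \<alpha> w] by (simp add: ec_def[of \<alpha> ?p] H_simps)
  then have "H (lat \<alpha>) 0 (ec \<alpha> ?p w) = sc (of_int ?p) (ec \<alpha> ?p w)"
    by (simp add: H_ec)
  then show ?thesis using n by blast
qed

lemma irreducible_weight:
  assumes irr: "V_irreducible sc Y" and ne: "\<Omega> \<noteq> {0}"
  shows "\<exists>lam\<in>dual_D k. \<forall>\<alpha> w. H (lat \<alpha>) 0 w = sc (form k (lat \<alpha>) lam) w"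
proof -
  obtain w where w: "w \<in> \<Omega>" "w \<noteq> 0" using ne subspace_0[OF subspace_Omega] by blast
  have "\<exists>p::int. \<forall>v. H (lat \<alpha>) 0 v = sc (of_int p) v" for \<alpha>
  proof -
    obtain p v where "v \<noteq> 0" "H (lat \<alpha>) 0 v = sc (of_int p) v"
      using lowest_ec_eigenvector[OF w] by blast
    then have "{w. H (lat \<alpha>) 0 w = sc (of_int p) w} = UNIV"
      using irr V_submodule_eigenspace[of \<alpha> "of_int p"] unfolding V_irreducible_def by blast
    then show ?thesis by blast
  qed
  then obtain p :: "'n latC \<Rightarrow> int" where p: "\<And>\<alpha> v. H (lat \<alpha>) 0 v = sc (of_int (p \<alpha>)) v" by metis
  \<comment> \<open>The coordinates make (c_i, \<lambda>) the eigenvalue of c_i(0); the other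
    \<alpha> follow by linearity.\<close>
  define lam :: "'n hsp" where
    "lam = (\<Sum>i\<in>UNIV. (of_int (p (axis i 1)) / of_int k) *s basis_vec (Inr i))"
  have "lam \<in> dual_D k"
    unfolding dual_D_def lam_def by (intro CollectI exI[of _ "\<lambda>i. p (axis i 1)"]) simp
  moreover have "H (lat \<alpha>) 0 v = sc (form k (lat \<alpha>) lam) v" for \<alpha> v
  proof -
    have "H (lat \<alpha>) 0 v = (\<Sum>i\<in>UNIV. sc (of_int (\<alpha> $ i)) (H (basis_vec (Inl i)) 0 v))"
      by (subst H_index_expand)
        (simp add: UNIV_Plus_UNIV[symmetric] sum.Plus del: UNIV_Plus_UNIV)
    also have "\<dots> = sc (form k (lat \<alpha>) lam) v"
      unfolding form_dual_D[OF k_nonzero lam_def] scale_sum_left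
      by (simp add: p flip: lat_axis)
    finally show ?thesis .
  qed
  ultimately show ?thesis by blast
qed

lemma irreducible_Mbar:
  assumes "V_irreducible sc Y" "\<Omega> \<noteq> {0}"
  shows "Mbar = UNIV"
  using assms V_submodule_Mbar Omega_subset_Mbar subspace_0[OF subspace_Omega]
  unfolding V_irreducible_def by blast

end


section \<open>The isomorphism with \<open>V\<^sub>\<lambda>\<^sub>,\<^sub>W\<close>\<close>

text \<open>The basis dual to \<open>basis_vec\<close> under the form. For n > 0 the mode
  \<alpha>(n) of \<alpha> = \<open>dual_vec k b\<close> is n times the partial derivative by
  b(-n).\<close>

definition dual_vec :: "int \<Rightarrow> 'n + 'n \<Rightarrow> 'n::finite hsp" where
  "dual_vec k b = (1 / of_int k) *s basis_vec (case b of Inl i \<Rightarrow> Inr i | Inr i \<Rightarrow> Inl i)"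

lemma form_dual_vec:
  assumes "k \<noteq> 0"
  shows "form k (dual_vec k b) (basis_vec b') = (if b = b' then 1 else 0)"
  using assms unfolding dual_vec_def form_scale_left
  by (cases b; cases b')
    (auto simp: form_def basis_vec_def axis_def if_distrib[where f = "\<lambda>x. x * _"] cong: if_cong)

text \<open>The derivative by b(-j-1) recovers the coefficients of all monomials containing this
  variable up to nonzero integer factors, as the injectivity argument requires.\<close>

lemma lookup_fock_mode_dual:
  fixes sc :: "complex \<Rightarrow> 'w::ab_group_add \<Rightarrow> 'w"
  assumes vs: "vector_space sc" and k: "k \<noteq> 0"
  shows "Poly_Mapping.lookup (fock_mode k sc z0 (dual_vec k b) (int j + 1) f) M
    = sc (of_nat (Suc j * Suc (count M (b, j)))) (Poly_Mapping.lookup f (add_mset (b, j) M))"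
proof (induction f rule: pm_induct)
  case zero
  interpret vector_space sc by fact
  show ?case by (simp add: fock_mode_zero[OF vs])
next
  case (add g h)
  interpret vector_space sc by fact
  show ?case using add
    by (simp add: fock_mode_add[OF vs] lookup_add scale_right_distrib del: of_nat_mult of_nat_Suc)
next
  case (single M' w)
  interpret vector_space sc by fact
  have "fock_mode k sc z0 (dual_vec k b) (int j + 1) (Poly_Mapping.single M' w)
      = (\<Sum>b'\<in>UNIV. if b' = b then
          Poly_Mapping.single (M' - {#(b, j)#}) (sc (of_nat (Suc j * count M' (b, j))) w) else 0)"
    by (subst fock_mode_single_pos[OF vs], simp)
      (intro sum.cong refl, auto simp: form_dual_vec[OF k] algebra_simps)
  also have "\<dots> = Poly_Mapping.single (M' - {#(b, j)#}) (sc (of_nat (Suc j * count M' (b, j))) w)"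
    by simp
  finally have single: "fock_mode k sc z0 (dual_vec k b) (int j + 1) (Poly_Mapping.single M' w) = \<dots>" .
  show ?case
  proof (cases "(b, j) \<in># M'")
    case True
    then obtain N where "M' = add_mset (b, j) N" by (metis mset_add)
    then show ?thesis unfolding single by (auto simp: lookup_single when_def)
  next
    case False
    then have "count M' (b, j) = 0" "M' \<noteq> add_mset (b, j) M" by (auto simp: not_in_iff)
    then show ?thesis unfolding single by (simp add: lookup_single)
  qed
qed

text \<open>The setting of the third claim once the weight is found: irreducibility enters through
  \<open>H_lat\<close> and \<open>Mbar_UNIV\<close>, and \<rho> is any structure as in the second
  claim.\<close>

locale V_mod_weight = V_mod k sc Y
  for k :: int and sc :: "complex \<Rightarrow> 'm::ab_group_add \<Rightarrow> 'm"
    and Y :: "'n::finite VC \<Rightarrow> int \<Rightarrow> 'm \<Rightarrow> 'm" +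
  fixes lam :: "'n hsp" and \<rho> :: "'n free_alg set \<Rightarrow> 'm \<Rightarrow> 'm"
  assumes lam: "lam \<in> dual_D k"
    and H_lat: "\<And>\<alpha> w. H (lat \<alpha>) 0 w = sc (form k (lat \<alpha>) lam) w"
    and Mbar_UNIV: "Mbar = UNIV"
    and \<rho>: "Omega_A_structure k sc Y \<rho>"
begin

lemma Omega_wt_eq: "\<Omega>\<^sub>w lam = \<Omega>"
  by (auto simp: Omega_wt_def H_lat)

lemma Omega'_eq: "\<Omega>' = \<Omega>"
  using Omega_wt_Omega'[OF lam] Omega'_subset_Omega unfolding Omega_wt_eq by blast

lemma A_module_\<rho>: "A_module k sc \<Omega> \<rho>"
  using \<rho> unfolding Omega_A_structure_def Omega'_eq by blast

lemma \<rho>_in: "w \<in> \<Omega> \<Longrightarrow> \<rho> (A_class k x) w \<in> \<Omega>"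
  using A_module_\<rho> unfolding A_module_def carrier_A_alg by blast

lemma \<rho>_add: "v \<in> \<Omega> \<Longrightarrow> w \<in> \<Omega> \<Longrightarrow> \<rho> (A_class k x) (v + w) = \<rho> (A_class k x) v + \<rho> (A_class k x) w"
  using A_module_\<rho> unfolding A_module_def carrier_A_alg by blast

lemma \<rho>_0: "\<rho> (A_class k x) 0 = 0"
  using \<rho>_add[of 0 0 x] subspace_0[OF subspace_Omega] by simp

lemma \<rho>_e:
  assumes "w \<in> \<Omega>"
  shows "\<rho> (A_e k \<beta>) w = ec \<beta> (weight k \<beta> lam) w"
proof -
  have "T_series k sc Y \<beta> 0 w = sconst (\<rho> (A_e k \<beta>)) 0 w"
    using \<rho> assms unfolding Omega_A_structure_def Omega'_eq by blast
  then show ?thesis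
    using assms T_series_eq[of w \<beta> 0] T_wt[OF lam, of w \<beta>]
    by (simp add: sconst_def Omega'_eq Omega_wt_eq)
qed

definition zero_mode :: "'n hsp \<Rightarrow> 'm \<Rightarrow> 'm" where
  "zero_mode \<alpha> w = sc (form k \<alpha> lam) w + \<rho> (A_d k \<alpha>) w"

lemma zero_mode_H:
  assumes w: "w \<in> \<Omega>"
  shows "zero_mode \<alpha> w = H \<alpha> 0 w"
proof -
  obtain m where m: "lam = (\<Sum>i\<in>UNIV. (of_int (m i) / of_int k) *s basis_vec (Inr i))"
    using lam by (auto simp: dual_D_def)
  \<comment> \<open>\<open>A_d\<close> depends only on the coordinates along the d_i, so \<alpha>
    may be replaced by its component in \<open>h_D\<close>, where \<rho> is prescribed.\<close>
  define \<gamma> :: "'n hsp" where "\<gamma> = (\<chi> b. case b of Inl i \<Rightarrow> 0 | Inr i \<Rightarrow> \<alpha> $ Inr i)"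
  have \<gamma>: "\<gamma> \<in> h_D" "\<gamma> $ Inr i = \<alpha> $ Inr i" for i
    by (simp_all add: h_D_def \<gamma>_def)
  have "A_d k \<alpha> = A_d k \<gamma>"
    by (simp add: A_d_def \<gamma>)
  then have D: "\<rho> (A_d k \<alpha>) w = H \<gamma> 0 w"
    using \<rho> w \<gamma> unfolding Omega_A_structure_def Omega'_eq by simp
  have "form k (lat (axis i 1)) lam = of_int (m i)" for i
    by (simp add: form_dual_D[OF k_nonzero m] axis_int_mult)
  then have "H (basis_vec (Inl i)) 0 w = sc (of_int (m i)) w" for i
    using H_lat[of "axis i 1" w] by (simp add: lat_axis)
  then have C: "sc (form k \<alpha> lam) w = (\<Sum>i\<in>UNIV. sc (\<alpha> $ Inl i) (H (basis_vec (Inl i)) 0 w))"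
    by (simp add: form_dual_D[OF k_nonzero m] scale_sum_left)
  have "H \<alpha> 0 w = (\<Sum>i\<in>UNIV. sc (\<alpha> $ Inl i) (H (basis_vec (Inl i)) 0 w))
      + (\<Sum>i\<in>UNIV. sc (\<alpha> $ Inr i) (H (basis_vec (Inr i)) 0 w))"
    by (subst H_index_expand) (simp add: UNIV_Plus_UNIV[symmetric] sum.Plus del: UNIV_Plus_UNIV)
  then show ?thesis
    unfolding zero_mode_def C D H_h_D[OF \<gamma>(1)] by (simp add: \<gamma>)
qed


subsection \<open>The Fock space description of the module\<close>

abbreviation W :: "('n, 'm) fock set" where "W \<equiv> VlW_space \<Omega>"
abbreviation fm :: "'n hsp \<Rightarrow> int \<Rightarrow> ('n, 'm) fock \<Rightarrow> ('n, 'm) fock" where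
  "fm \<equiv> fock_mode k sc zero_mode"

interpretation P: vector_space "pm_scale sc :: complex \<Rightarrow> ('n, 'm) fock \<Rightarrow> _"
  by (rule vector_space_pm_scale) (rule vector_space_axioms)

lemma subspace_W: "P.subspace W"
  by (rule P.subspaceI)
    (auto simp: VlW_space_def lookup_add lookup_pm_scale subspace_0[OF subspace_Omega]
      subspace_add[OF subspace_Omega] subspace_scale[OF subspace_Omega])

lemma single_W: "w \<in> \<Omega> \<Longrightarrow> Poly_Mapping.single M w \<in> W"
  by (auto simp: VlW_space_def lookup_single when_def subspace_0[OF subspace_Omega])

lemma W_induct [consumes 1, case_names zero single add]:
  assumes "f \<in> W" "P 0" "\<And>M w. w \<in> \<Omega> \<Longrightarrow> P (Poly_Mapping.single M w)"
    "\<And>g h. g \<in> W \<Longrightarrow> h \<in> W \<Longrightarrow> P g \<Longrightarrow> P h \<Longrightarrow> P (g + h)"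
  shows "P f"
  by (rule pm_values_induct[where W = \<Omega> and f = f])
    (use assms subspace_0[OF subspace_Omega] subspace_add[OF subspace_Omega] in \<open>auto simp: VlW_space_def\<close>)

text \<open>
  \<open>mon M w\<close> is the image in \<open>M\<close> of the element \<open>M \<otimes> w\<close> of Fock space, and \<open>\<psi>\<close> the resulting map
  from \<open>M(1) \<otimes> \<Omega>\<^sub>M\<close> to \<open>M\<close>. The creation operators commute, so the fold over a multiset is well-defined.
\<close>

definition creation :: "('n + 'n) \<times> nat \<Rightarrow> 'm \<Rightarrow> 'm" where
  "creation x = H (basis_vec (fst x)) (- int (snd x) - 1)"

definition mon :: "'n monom \<Rightarrow> 'm \<Rightarrow> 'm" where
  "mon M w = fold_mset creation w M"

definition \<psi> :: "('n, 'm) fock \<Rightarrow> 'm" where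
  "\<psi> f = pm_sum mon f"

lemma mon_empty [simp]: "mon {#} w = w"
  by (simp add: mon_def)

lemma mon_add_mset: "mon (add_mset x M) w = creation x (mon M w)"
proof -
  interpret comp_fun_commute creation
    by unfold_locales (auto simp: fun_eq_iff creation_def H_commute)
  show ?thesis by (simp add: mon_def)
qed

lemma mon_linear: "Vector_Spaces.linear sc sc (mon M)"
proof (induction M)
  case empty
  show ?case by unfold_locales (auto simp: scale_right_distrib scale_left_distrib)
next
  case (add x M)
  show ?case
    by unfold_locales
      (auto simp: mon_add_mset creation_def H_simps lin_simps[OF add] scale_right_distrib scale_left_distrib)
qed

lemma mon_commute:
  assumes "n \<le> 0"
  shows "H \<alpha> n (mon M w) = mon M (H \<alpha> n w)"
  by (induction M) (use assms in \<open>auto simp: mon_add_mset creation_def H_commute[of n]\<close>)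

text \<open>\<alpha>(n) kills w and has scalar commutators with the creation operators, so it acts
  as a derivation on the monomial.\<close>

lemma mon_annihilate:
  assumes n: "n > 0" and w: "w \<in> \<Omega>"
  shows "H \<alpha> n (mon M w) = (\<Sum>b\<in>UNIV.
    sc (of_int n * form k \<alpha> (basis_vec b) * of_nat (count M (b, nat (n - 1)))) (mon (M - {#(b, nat (n - 1))#}) w))"
proof (induction M)
  case empty
  then show ?case by (simp add: Omega_H[OF w n])
next
  case (add x M)
  obtain b0 j where x: "x = (b0, j)" by (cases x)
  let ?y = "\<lambda>b. (b, nat (n - 1))"
  let ?c = "\<lambda>b. of_int n * form k \<alpha> (basis_vec b)"
  have "H \<alpha> n (mon (add_mset x M) w)
      = creation x (H \<alpha> n (mon M w)) + (if nat (n - 1) = j then sc (?c b0) (mon M w) else 0)"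
    using n by (auto simp: mon_add_mset x creation_def H_commutator[of \<alpha> n "basis_vec b0" "- int j - 1"])
  also have "(if nat (n - 1) = j then sc (?c b0) (mon M w) else 0)
      = (\<Sum>b\<in>UNIV. if ?y b = x then sc (?c b) (mon M w) else 0)"
    by (simp add: x)
  also have "creation x (H \<alpha> n (mon M w)) + \<dots>
      = (\<Sum>b\<in>UNIV. creation x (sc (?c b * of_nat (count M (?y b))) (mon (M - {#?y b#}) w))
          + (if ?y b = x then sc (?c b) (mon M w) else 0))"
    unfolding add creation_def by (simp add: H_simps sum.distrib)
  also have "\<dots> = (\<Sum>b\<in>UNIV. sc (?c b * of_nat (count (add_mset x M) (?y b)))
          (mon (add_mset x M - {#?y b#}) w))"
  proof (intro sum.cong refl)
    fix b
    have lin: "creation x (sc c v) = sc c (creation x v)" for c v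
      by (simp add: creation_def H_simps)
    show "creation x (sc (?c b * of_nat (count M (?y b))) (mon (M - {#?y b#}) w))
          + (if ?y b = x then sc (?c b) (mon M w) else 0)
        = sc (?c b * of_nat (count (add_mset x M) (?y b))) (mon (add_mset x M - {#?y b#}) w)"
    proof (cases "?y b = x")
      case True
      \<comment> \<open>If x does not occur in M the scalar is 0, so the truncated multiset
        difference does no harm.\<close>
      have "creation x (sc (?c b * of_nat (count M x)) (mon (M - {#x#}) w))
          = sc (?c b * of_nat (count M x)) (mon M w)"
      proof (cases "x \<in># M")
        case True
        then show ?thesis by (simp add: lin insert_DiffM flip: mon_add_mset)
      qed (simp add: not_in_iff creation_def H_simps)
      then show ?thesis using True
        by (simp add: distrib_left scale_left_distrib add.commute)
    next
      case False
      then have "add_mset x M - {#?y b#} = add_mset x (M - {#?y b#})"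
        by (simp add: diff_add_mset_swap)
      then show ?thesis using False by (simp add: lin mon_add_mset)
    qed
  qed
  finally show ?case .
qed

lemma \<psi>_single: "\<psi> (Poly_Mapping.single M w) = mon M w"
  unfolding \<psi>_def by (rule pm_sum_single) (simp add: lin_simps[OF mon_linear])

lemma \<psi>_add: "\<psi> (f + g) = \<psi> f + \<psi> g"
  unfolding \<psi>_def by (rule pm_sum_add) (simp_all add: lin_simps[OF mon_linear])

lemma \<psi>_0 [simp]: "\<psi> 0 = 0"
  by (simp add: \<psi>_def)

lemma \<psi>_sum: "\<psi> (sum g A) = (\<Sum>x\<in>A. \<psi> (g x))"
  by (induction A rule: infinite_finite_induct) (simp_all add: \<psi>_add)

lemma \<psi>_scale: "\<psi> (pm_scale sc c f) = sc c (\<psi> f)"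
proof (induction f rule: pm_induct)
  case (single M w)
  then show ?case by (simp add: pm_scale_single \<psi>_single lin_simps[OF mon_linear])
qed (simp_all add: \<psi>_add P.scale_right_distrib scale_right_distrib)

lemma zero_mode_in: "w \<in> \<Omega> \<Longrightarrow> zero_mode \<alpha> w \<in> \<Omega>"
  unfolding zero_mode_def A_d_def
  by (intro subspace_add[OF subspace_Omega] subspace_scale[OF subspace_Omega] \<rho>_in)

lemma zero_mode_0: "zero_mode \<alpha> 0 = 0"
  by (simp add: zero_mode_def A_d_def \<rho>_0)

lemma lookup_map_zero_mode:
  "Poly_Mapping.lookup (Poly_Mapping.map (zero_mode \<alpha>) f) M = zero_mode \<alpha> (Poly_Mapping.lookup f M)"
  by (rule lookup_map_zero) (rule zero_mode_0)

lemma fm_add: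
  assumes "f \<in> W" "g \<in> W"
  shows "fm \<alpha> n (f + g) = fm \<alpha> n f + fm \<alpha> n g"
proof (cases "n = 0")
  case True
  have "zero_mode \<alpha> (v + w) = zero_mode \<alpha> v + zero_mode \<alpha> w" if "v \<in> \<Omega>" "w \<in> \<Omega>" for v w
    using that by (simp add: zero_mode_H subspace_add[OF subspace_Omega] H_simps)
  then show ?thesis
    using assms True
    by (intro poly_mapping_eqI) (simp add: fock_mode_def lookup_map_zero_mode lookup_add VlW_space_def)
next
  case False
  then show ?thesis by (simp add: fock_mode_add[OF vector_space_axioms])
qed

lemma fm_zero: "fm \<alpha> n 0 = 0"
  by (rule fock_mode_zero[OF vector_space_axioms])

lemma \<psi>_fm:
  assumes "f \<in> W"
  shows "fm \<alpha> n f \<in> W \<and> \<psi> (fm \<alpha> n f) = H \<alpha> n (\<psi> f)"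
  using assms
proof (induction f rule: W_induct)
  case zero
  then show ?case by (simp add: fm_zero P.subspace_0[OF subspace_W] H_simps)
next
  case (add g h)
  then show ?case by (simp add: fm_add \<psi>_add H_simps P.subspace_add[OF subspace_W])
next
  case (single M w)
  note sW = single_W subspace_scale[OF subspace_Omega] P.subspace_sum[OF subspace_W]
  consider "n < 0" | "n = 0" | "n > 0" by linarith
  then show ?case
  proof cases
    case 1
    have "\<psi> (fm \<alpha> n (Poly_Mapping.single M w)) = (\<Sum>b\<in>UNIV. sc (\<alpha> $ b) (H (basis_vec b) n (mon M w)))"
      using 1
      by (simp add: fock_mode_single_neg[OF vector_space_axioms] \<psi>_sum \<psi>_single mon_add_mset
          creation_def lin_simps[OF mon_linear] H_simps)
    also have "\<dots> = H \<alpha> n (mon M w)" by (rule H_index_expand[symmetric])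
    finally show ?thesis
      using 1 single by (simp add: fock_mode_single_neg[OF vector_space_axioms] \<psi>_single sW)
  next
    case 2
    have "fm \<alpha> 0 (Poly_Mapping.single M w) = Poly_Mapping.single M (zero_mode \<alpha> w)"
      by (simp add: fock_mode_def zero_mode_0)
    then show ?thesis
      using 2 single zero_mode_in[OF single, of \<alpha>]
      by (simp add: \<psi>_single single_W mon_commute zero_mode_H)
  next
    case 3
    then show ?thesis
      using single
      by (simp add: fock_mode_single_pos[OF vector_space_axioms] sW \<psi>_sum \<psi>_single
          lin_simps[OF mon_linear] mon_annihilate)
  qed
qed

text \<open>
  The kernel is stable under the annihilation operators, that is, under the partial derivatives;
  an element of it killed by all of them is constant.
\<close>

lemma \<psi>_kernel_bounded:
  assumes "f \<in> W" "\<psi> f = 0" "\<And>M. M \<in> Poly_Mapping.keys f \<Longrightarrow> size M < d"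
  shows "f = 0"
  using assms
proof (induction d arbitrary: f)
  case 0
  then have "Poly_Mapping.keys f = {}" by blast
  then show ?case by simp
next
  case (Suc d)
  have "Poly_Mapping.lookup f (add_mset (b, j) M) = 0" for b j M
  proof -
    \<comment> \<open>The derivative of f by b(-j-1), up to a factor: it stays in the kernel, has
      lower degree and determines the coefficients of f at monomials containing that
      variable.\<close>
    let ?g = "fm (dual_vec k b) (int j + 1) f"
    have l: "Poly_Mapping.lookup ?g M
      = sc (of_nat (Suc j * Suc (count M (b, j)))) (Poly_Mapping.lookup f (add_mset (b, j) M))" for M
      by (rule lookup_fock_mode_dual[OF vector_space_axioms k_nonzero])
    have "?g \<in> W" "\<psi> ?g = 0" using \<psi>_fm[OF Suc.prems(1)] Suc.prems(2) by (simp_all add: H_simps)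
    moreover have "size M < d" if "M \<in> Poly_Mapping.keys ?g" for M
    proof -
      have "add_mset (b, j) M \<in> Poly_Mapping.keys f"
        using that unfolding in_keys_iff l by auto
      then show ?thesis using Suc.prems(3) by fastforce
    qed
    ultimately have "?g = 0" by (rule Suc.IH)
    then have "sc (of_nat (Suc j * Suc (count M (b, j)))) (Poly_Mapping.lookup f (add_mset (b, j) M)) = 0"
      using l[of M] by simp
    then show ?thesis by (simp del: of_nat_mult of_nat_Suc)
  qed
  then have nonempty: "Poly_Mapping.lookup f M = 0" if "M \<noteq> {#}" for M
    using that by (metis multiset_cases surj_pair)
  have f: "f = Poly_Mapping.single {#} (Poly_Mapping.lookup f {#})"
    by (rule poly_mapping_eqI) (auto simp: lookup_single when_def nonempty)
  have "\<psi> f = Poly_Mapping.lookup f {#}"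
    by (subst f) (simp add: \<psi>_single)
  then have "Poly_Mapping.lookup f {#} = 0"
    using Suc.prems(2) by simp
  then show ?case using f by simp
qed

lemma \<psi>_kernel:
  assumes "f \<in> W" "\<psi> f = 0"
  shows "f = 0"
proof (rule \<psi>_kernel_bounded[OF assms])
  fix M assume "M \<in> Poly_Mapping.keys f"
  then show "size M < Suc (Max (size ` Poly_Mapping.keys f))" by (simp add: le_imp_less_Suc)
qed

lemma \<psi>_surj: "\<psi> ` W = UNIV"
proof -
  have "Mbar \<subseteq> \<psi> ` W"
  proof (rule Mbar_minimal)
    show "subspace (\<psi> ` W)"
    proof (rule subspaceI)
      show "0 \<in> \<psi> ` W" using P.subspace_0[OF subspace_W] \<psi>_0 by (metis imageI)
      show "x + y \<in> \<psi> ` W" if "x \<in> \<psi> ` W" "y \<in> \<psi> ` W" for x y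
        using that P.subspace_add[OF subspace_W] \<psi>_add by (auto simp flip: \<psi>_add)
      show "sc c x \<in> \<psi> ` W" if "x \<in> \<psi> ` W" for c x
        using that P.subspace_scale[OF subspace_W] by (auto simp flip: \<psi>_scale)
    qed
    show "\<Omega> \<subseteq> \<psi> ` W"
    proof
      fix w assume "w \<in> \<Omega>"
      then have "w = \<psi> (Poly_Mapping.single {#} w)" "Poly_Mapping.single {#} w \<in> W"
        by (simp_all add: \<psi>_single single_W)
      then show "w \<in> \<psi> ` W" by blast
    qed
    show "H \<alpha> n w \<in> \<psi> ` W" if "w \<in> \<psi> ` W" for \<alpha> n w
      using that \<psi>_fm by (auto simp: image_iff) metis
  qed
  then show ?thesis using Mbar_UNIV by blast
qed

sublocale transport "pm_scale sc" sc W \<psi>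
  by unfold_locales
    (auto simp: P.subspace_0[OF subspace_W] P.subspace_add[OF subspace_W] P.subspace_scale[OF subspace_W]
      \<psi>_add \<psi>_scale \<psi>_kernel)


subsection \<open>Vertex operators\<close>

lemma Ep_creation:
  assumes "m \<ge> 1"
  shows "Ep \<gamma> p (H \<alpha> (- int m) w) = H \<alpha> (- int m) (Ep \<gamma> p w) + sc (form k \<alpha> \<gamma>) (Ep \<gamma> (p + int m) w)"
proof (cases "p > 0")
  case True
  then show ?thesis by (simp add: Ep_pos H_simps)
next
  case False
  define n where "n = nat (- p)"
  have p: "p = - int n" using False by (simp add: n_def)
  show ?thesis
    using Ep_H_neg[OF assms, of \<alpha> \<gamma> n w] unfolding p
    by (cases "m \<le> n") (auto simp: Ep_pos algebra_simps of_nat_diff)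
qed

lemma Ep_annihilation:
  assumes "m \<ge> 0"
  shows "Ep \<gamma> p (H \<alpha> m w) = H \<alpha> m (Ep \<gamma> p w)"
proof (cases "p > 0")
  case True
  then show ?thesis by (simp add: Ep_pos H_simps)
next
  case False
  have comm: "H \<alpha> m (plus_arg sc H \<gamma> q w) = plus_arg sc H \<gamma> q (H \<alpha> m w)" for q w
    using assms by (auto simp: plus_arg_def H_simps H_commute[of m "int q"])
  show ?thesis
    using exp_rec.E_commute[OF Ep_rec H_linear comm, of "nat (- p)" w] False by simp
qed

text \<open>M is generated by \<open>\<Omega>\<close>, where E^+ is trivial. The bound makes the
  coefficients of the product of E^- and E^+ finite sums.\<close>

lemma Ep_nilpotent: "\<exists>P. \<forall>p<P. Ep \<gamma> p w = 0"
proof -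
  let ?U = "{w. \<exists>P. \<forall>p<P. Ep \<gamma> p w = 0}"
  note lin = lin_simps[OF Ep_linear]
  have "Mbar \<subseteq> ?U"
  proof (rule Mbar_minimal)
    show "subspace ?U"
    proof (rule subspaceI)
      show "x + y \<in> ?U" if xy: "x \<in> ?U" "y \<in> ?U" for x y
      proof -
        obtain P where "\<forall>p<P. Ep \<gamma> p x = 0" using xy(1) by blast
        moreover obtain Q where "\<forall>p<Q. Ep \<gamma> p y = 0" using xy(2) by blast
        ultimately have "\<forall>p<min P Q. Ep \<gamma> p (x + y) = 0" by (simp add: lin)
        then show ?thesis by blast
      qed
    qed (auto simp: lin)
    show "\<Omega> \<subseteq> ?U"
    proof
      fix w assume "w \<in> \<Omega>"
      then have "\<forall>p<0. Ep \<gamma> p w = 0" by (simp add: Ep_Omega)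
      then show "w \<in> ?U" by blast
    qed
    show "H \<alpha> n w \<in> ?U" if w: "w \<in> ?U" for \<alpha> n w
    proof -
      obtain P where P: "\<forall>p<P. Ep \<gamma> p w = 0" using w by blast
      \<comment> \<open>By \<open>Ep_annihilation\<close> and \<open>Ep_creation\<close>,
        \<alpha>(n) moves the bound by at most the absolute value of n.\<close>
      have "\<forall>p<P - \<bar>n\<bar>. Ep \<gamma> p (H \<alpha> n w) = 0"
      proof (cases "n \<ge> 0")
        case True
        then show ?thesis using P by (simp add: Ep_annihilation H_simps)
      next
        case False
        then have n: "n = - int (nat (- n))" "nat (- n) \<ge> 1" by auto
        show ?thesis
          using P False by (subst n(1)) (auto simp only: Ep_creation[OF n(2)], simp add: H_simps)
      qed
      then show ?thesis by blast
    qed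
  qed
  then show ?thesis using Mbar_UNIV by blast
qed

context
  fixes \<beta> :: "'n latC"
begin

definition exps :: "int \<Rightarrow> 'm \<Rightarrow> 'm" where
  "exps r w = (Em (- lat \<beta>) \<star> Ep (- lat \<beta>)) r w"

lemma exps_finite: "finite {q. Em \<gamma> q (Ep \<gamma>' (r - q) w) \<noteq> 0}"
proof -
  obtain P where "\<And>p. p < P \<Longrightarrow> Ep \<gamma>' p w = 0" using Ep_nilpotent by blast
  then have "{q. Em \<gamma> q (Ep \<gamma>' (r - q) w) \<noteq> 0} \<subseteq> {0..r - P}"
    by (auto simp: not_less[symmetric] Em_neg lin_simps[OF Em_linear])
  then show ?thesis by (rule finite_subset) simp
qed

lemma exps_add: "exps r (v + w) = exps r v + exps r w"
  by (simp add: exps_def sprod_def lin_simps[OF Em_linear] lin_simps[OF Ep_linear]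
      Sum_any.distrib[OF exps_finite exps_finite])

text \<open>E^- commutes with creation operators, and moving \<alpha>(-m) past E^+ yields the same
  correction as moving it past Y(e^\<beta>, z) in \<open>H_ec\<close>.\<close>

lemma exps_creation:
  assumes "m \<ge> 1"
  shows "exps r (H \<alpha> (- int m) w) = H \<alpha> (- int m) (exps r w) - sc (form k \<alpha> (lat \<beta>)) (exps (r + int m) w)"
proof -
  let ?g = "- lat \<beta>"
  define c where "c = form k \<alpha> (- lat \<beta>)"
  let ?x = "\<lambda>r q. Em ?g q (Ep ?g (r - q) w)"
  have pull: "A (Sum_any (?x r)) = Sum_any (\<lambda>q. A (?x r q))" "finite {q. A (?x r q) \<noteq> 0}"
    if "Vector_Spaces.linear sc sc A" for A r
  proof -
    have sub: "{q. A (?x r q) \<noteq> 0} \<subseteq> {q. ?x r q \<noteq> 0}"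
      using lin_zero[OF that] by auto
    show "finite {q. A (?x r q) \<noteq> 0}"
      using exps_finite by (rule finite_subset[OF sub])
    show "A (Sum_any (?x r)) = Sum_any (\<lambda>q. A (?x r q))"
      using exps_finite sub
      by (simp add: Sum_any.expand_superset[OF exps_finite sub] Sum_any.expand_set lin_sum[OF that])
  qed
  have sc_lin: "Vector_Spaces.linear sc sc (sc c)" for c
    by unfold_locales (auto simp: scale_right_distrib scale_left_distrib mult.commute)
  have "Em ?g q (Ep ?g (r - q) (H \<alpha> (- int m) w))
      = H \<alpha> (- int m) (?x r q) + sc c (?x (r + int m) q)" for q
  proof -
    have "r - q + int m = r + int m - q" by simp
    then show ?thesis
      unfolding Ep_creation[OF assms] c_def by (simp only: lin_simps[OF Em_linear]) (simp add: Em_H_nonpos)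
  qed
  then have "exps r (H \<alpha> (- int m) w)
      = Sum_any (\<lambda>q. H \<alpha> (- int m) (?x r q)) + Sum_any (\<lambda>q. sc c (?x (r + int m) q))"
    by (simp add: exps_def sprod_def Sum_any.distrib[OF pull(2)[OF H_linear] pull(2)[OF sc_lin]])
  moreover have "form k \<alpha> (lat \<beta>) = - c" by (simp add: c_def)
  ultimately show ?thesis
    by (simp add: exps_def sprod_def pull(1)[OF H_linear, symmetric] pull(1)[OF sc_lin, symmetric])
qed

text \<open>Both sides have the same commutators with creation operators, and on
  \<open>\<Omega>\<close> they agree by \<open>ec_above_wt\<close>, since E^+ is trivial
  there.\<close>

lemma ec_mon:
  assumes w: "w \<in> \<Omega>"
  shows "ec \<beta> (weight k \<beta> lam + r) (mon M w) = exps r (mon M (ec \<beta> (weight k \<beta> lam) w))"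
proof (induction M arbitrary: r)
  case empty
  let ?N = "weight k \<beta> lam"
  have w': "w \<in> \<Omega>\<^sub>w lam" using w by (simp add: Omega_wt_eq)
  have "ec \<beta> ?N w \<in> \<Omega>" using T_wt_in[OF lam w'] by (simp add: Omega_wt_eq)
  then have "exps r (ec \<beta> ?N w) = Em (- lat \<beta>) r (ec \<beta> ?N w)"
    unfolding exps_def sprod_def
    by (subst Sum_any_single[of r]) (auto simp: Ep_Omega lin_simps[OF Em_linear])
  moreover have "ec \<beta> (?N + r) w = Em (- lat \<beta>) r (ec \<beta> ?N w)"
  proof (cases "r < 0")
    case True
    then show ?thesis by (simp add: Em_neg ec_below_wt[OF lam w'])
  next
    case False
    then show ?thesis using ec_above_wt[OF lam w', of \<beta> "nat r"] by simp
  qed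
  ultimately show ?case by simp
next
  case (add x M)
  obtain b j where x: "x = (b, j)" by (cases x)
  have c: "creation x = H (basis_vec b) (- int (Suc j))"
  proof -
    have "- int j - 1 = - int (Suc j)" by simp
    then show ?thesis by (simp only: creation_def x fst_conv snd_conv)
  qed
  have le: "1 \<le> Suc j" by simp
  show ?case
    unfolding mon_add_mset c
    using H_ec[of "basis_vec b" "- int (Suc j)" \<beta> "weight k \<beta> lam + r" "mon M w"]
    by (simp only: exps_creation[OF le] add.IH[symmetric])
      (simp add: algebra_simps)
qed

end

abbreviation vexp :: "'n latC \<Rightarrow> ('n, 'm) fock series" where
  "vexp \<equiv> vop_exp k sc zero_mode (\<lambda>\<beta>. \<rho> (A_e k \<beta>)) lam"

text \<open>\<open>rel_half_exp\<close> carries the half exponentials from Fock space to M, and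
  \<open>ec_mon\<close> identifies the result with Y(e^\<beta>, z); the shift by \<open>?N\<close>
  is the effect of z^\<beta>.\<close>

lemma rel_vexp: "rel (vexp \<beta>) (\<lambda>p. e \<beta> (- p - 1))"
  unfolding rel_def
proof (intro allI ballI)
  fix p and f assume f: "f \<in> W"
  let ?N = "weight k \<beta> lam" and ?g = "Poly_Mapping.map (\<rho> (A_e k \<beta>)) f"
  have e0: "\<rho> (A_e k \<beta>) 0 = 0" by (simp add: A_e_def \<rho>_0)
  have map_add: "Poly_Mapping.map (\<rho> (A_e k \<beta>)) (g + h)
      = Poly_Mapping.map (\<rho> (A_e k \<beta>)) g + Poly_Mapping.map (\<rho> (A_e k \<beta>)) h"
    if "g \<in> W" "h \<in> W" for g h
    using that e0
    by (intro poly_mapping_eqI) (simp add: lookup_map_zero lookup_add A_e_def \<rho>_add VlW_space_def)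
  have g: "?g \<in> W"
    using f e0 by (simp add: VlW_space_def lookup_map_zero A_e_def \<rho>_in)
  have "rel (E_minus (pm_scale sc) fm (- lat \<beta>) \<star> E_plus (pm_scale sc) fm (- lat \<beta>))
      (Em (- lat \<beta>) \<star> Ep (- lat \<beta>))"
    unfolding E_minus_def E_plus_def by (intro rel_sprod rel_half_exp \<psi>_fm)
  then have "vexp \<beta> p f \<in> W \<and> \<psi> (vexp \<beta> p f) = exps \<beta> (p - ?N) (\<psi> ?g)"
    using g unfolding rel_def exps_def
    by (simp add: vop_exp_eq[OF vector_space_axioms, where ea = "\<lambda>\<beta>. \<rho> (A_e k \<beta>)", OF e0 dual_D_pairing[OF k_nonzero lam]])
  moreover have "exps \<beta> (p - ?N) (\<psi> ?g) = ec \<beta> p (\<psi> f)"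
    using f
  proof (induction f rule: W_induct)
    case zero
    have "Poly_Mapping.map (\<rho> (A_e k \<beta>)) (0 :: ('n, 'm) fock) = 0"
      by (simp add: map_eq_zero_iff)
    moreover have "exps \<beta> (p - ?N) 0 = 0"
      using exps_add[of \<beta> "p - ?N" 0 0] by simp
    ultimately show ?case by (simp add: lin_simps[OF ec_linear])
  next
    case (single M w)
    then show ?case
      using ec_mon[of w \<beta> "p - ?N" M] by (simp add: \<psi>_single e0 \<rho>_e)
  next
    case (add g h)
    then show ?case by (simp add: map_add \<psi>_add exps_add lin_simps[OF ec_linear])
  qed
  ultimately show "vexp \<beta> p f \<in> W \<and> \<psi> (vexp \<beta> p f) = e \<beta> (- p - 1) (\<psi> f)"
    by (simp add: ec_def)
qed

text \<open>Each letter contributes a normally ordered current on both sides: by definition on Fock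
  space, by \<open>Y_V_mode_neg\<close> on M.\<close>

lemma rel_word:
  "rel (vop_word k sc zero_mode (\<lambda>\<beta>. \<rho> (A_e k \<beta>)) lam (map (\<lambda>(b, j). (basis_vec b, j)) xs) \<beta>)
     (\<lambda>p. Y (Poly_Mapping.single (mset xs) (Poly_Mapping.single \<beta> 1)) (- p - 1))"
  unfolding vop_word_def V_single_word[of xs \<beta> k]
proof (induction xs)
  case Nil
  then show ?case by (simp add: rel_vexp)
next
  case (Cons x xs)
  obtain b j where x: "x = (b, j)" by (cases x)
  let ?v = "foldr (\<lambda>(b, j). V_mode k (basis_vec b) (- int j - 1)) xs (V_exp \<beta>)"
  have "(\<lambda>p. Y (V_mode k (basis_vec b) (- int j - 1) ?v) (- p - 1))
      = normal_mult sc H (basis_vec b) j (\<lambda>p. Y ?v (- p - 1))"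
    by (intro ext) (rule Y_V_mode_neg)
  then show ?case
    using rel_normal_mult[where ?a1.0 = fm and ?a2.0 = H, OF \<psi>_fm Cons.IH] by (simp add: x)
qed

lemma VlW_Y_eq: "VlW_Y k sc \<rho> lam = vop k sc zero_mode (\<lambda>\<beta>. \<rho> (A_e k \<beta>)) lam"
  by (simp add: VlW_Y_def zero_mode_def[abs_def])

lemma \<psi>_Y:
  assumes "f \<in> W"
  shows "VlW_Y k sc \<rho> lam v n f \<in> W \<and> \<psi> (VlW_Y k sc \<rho> lam v n f) = Y v n (\<psi> f)"
  unfolding VlW_Y_eq
proof (induction v rule: pm_induct)
  case zero
  then show ?case by (simp add: vop_0[OF vector_space_axioms] U0 Y_simps)
next
  case (add u v)
  then show ?case by (simp add: vop_add[OF vector_space_axioms] U_add \<psi>_add Y_simps)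
next
  case (single M x)
  show ?case
  proof (induction x rule: pm_induct)
    case zero
    then show ?case by (simp add: vop_0[OF vector_space_axioms] U0 Y_simps)
  next
    case (add u v)
    then show ?case by (simp add: single_add vop_add[OF vector_space_axioms] U_add \<psi>_add Y_simps)
  next
    case (single \<beta> c)
    \<comment> \<open>The listing chosen in \<open>vop\<close>; \<open>rel_word\<close> holds for
      every listing.\<close>
    define xs where "xs = (SOME xs. mset xs = M)"
    have "mset xs = M" unfolding xs_def by (rule someI_ex) (rule ex_mset)
    then have "Poly_Mapping.single M (Poly_Mapping.single \<beta> c)
        = V_scale c (Poly_Mapping.single (mset xs) (Poly_Mapping.single \<beta> 1))"
      by (simp add: V_scale_single)
    then show ?case
      using rel_word[of xs \<beta>] assms
      unfolding vop_single[OF vector_space_axioms] xs_def[symmetric] rel_def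
      by (simp add: U_scale \<psi>_scale Y_simps)
  qed
qed

theorem isomorphic:
  "V_isomorphic sc Y UNIV (pm_scale sc) (VlW_Y k sc \<rho> lam) (VlW_space \<Omega>)"
proof -
  have inj: "inj_on \<psi> W"
  proof (rule inj_onI)
    fix f g assume fg: "f \<in> W" "g \<in> W" "\<psi> f = \<psi> g"
    have "\<psi> f = \<psi> (f - g) + \<psi> g" by (simp flip: \<psi>_add)
    then have "\<psi> (f - g) = 0" using fg by simp
    then have "f - g = 0" using fg P.subspace_diff[OF subspace_W] by (intro \<psi>_kernel) auto
    then show "f = g" by simp
  qed
  then have "bij_betw \<psi> W UNIV"
    using \<psi>_surj by (simp add: bij_betw_def)
  then have bij: "bij_betw (inv_into W \<psi>) UNIV W"
    by (rule bij_betw_inv_into)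
  \<comment> \<open>\<open>\<psi>\<close> leads from Fock space to M, so the isomorphism sought is
    its inverse.\<close>
  define \<phi> where "\<phi> = inv_into W \<psi>"
  have \<phi>: "\<phi> x \<in> W" "\<psi> (\<phi> x) = x" for x
    unfolding \<phi>_def using \<psi>_surj by (simp_all add: inv_into_into f_inv_into_f)
  have \<phi>_eqI: "\<phi> x = f" if "f \<in> W" "\<psi> f = x" for f x
    using that \<phi>[of x] inj by (auto dest: inj_onD)
  show ?thesis
    unfolding V_isomorphic_def
    using bij \<phi> \<psi>_Y[OF \<phi>(1)]
    by (intro exI[of _ \<phi>])
      (auto simp: \<phi>_def[symmetric] \<psi>_add \<psi>_scale intro!: \<phi>_eqI U_add U_scale)
qed

end

theorem theorem5p4:
  fixes k :: int
    and sc :: "complex \<Rightarrow> 'm::ab_group_add \<Rightarrow> 'm"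
    and Y :: "'n::finite VC \<Rightarrow> int \<Rightarrow> 'm \<Rightarrow> 'm"
  assumes "k \<noteq> 0"
    and "V_module k sc Y"
  shows "V_submodule sc Y (M_bar k sc Y)
    \<and> (\<exists>\<rho>. Omega_A_structure k sc Y \<rho>)
    \<and> (V_irreducible sc Y \<and> Omega k Y \<noteq> {0} \<longrightarrow>
         Omega' k sc Y = Omega k Y \<and>
         (\<exists>lam\<in>dual_D k. \<forall>\<rho>. Omega_A_structure k sc Y \<rho> \<longrightarrow>
            V_isomorphic sc Y UNIV
              (pm_scale sc) (VlW_Y k sc \<rho> lam) (VlW_space (Omega k Y))))"
proof -
  interpret V_mod k sc Y
    by unfold_locales (use assms in auto)
  have "Omega' k sc Y = Omega k Y \<and>
         (\<exists>lam\<in>dual_D k. \<forall>\<rho>. Omega_A_structure k sc Y \<rho> \<longrightarrow>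
            V_isomorphic sc Y UNIV
              (pm_scale sc) (VlW_Y k sc \<rho> lam) (VlW_space (Omega k Y)))"
    if irr: "V_irreducible sc Y" and ne: "Omega k Y \<noteq> {0}"
  proof -
    obtain lam where lam: "lam \<in> dual_D k" "\<And>\<alpha> w. H (lat \<alpha>) 0 w = sc (form k (lat \<alpha>) lam) w"
      using irreducible_weight[OF irr ne] by blast
    have wt: "V_mod_weight k sc Y lam \<rho>" if "Omega_A_structure k sc Y \<rho>" for \<rho>
      by unfold_locales (use lam that irreducible_Mbar[OF irr ne] in auto)
    \<comment> \<open>\<open>Omega'_eq\<close> lives in a locale that fixes an
      \<open>A\<close>-structure; the one from \<open>A_structure\<close> is supplied.\<close>
    show ?thesis
      using lam V_mod_weight.Omega'_eq[OF wt[OF A_structure]] V_mod_weight.isomorphic[OF wt] by blast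
  qed
  then show ?thesis
    using V_submodule_Mbar A_structure by blast
qed

end
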